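(* Let $X$ be a compact Riemannian manifold, let $r\ge1$, and let $T\colon X\to X$ be a $C^r$-diffeomorphism with an ergodic natural measure $\mu$ (or, more generally, any $T$-invariant ergodic Borel probability measure $\mu$ on $X$). Let $k\in\mathbb{N}$ satisfy $k > \underline{\mathrm{ID}}(\mu)$. Then for a prevalent set of Lipschitz observables $h\colon X\to\mathbb{R}$, the $k$-delay coordinate map $\phi_{h,k}$ is injective on a set of full $\mu$-measure, and $\nu_{h,k}$-almost every point of $\mathbb{R}^k$ is predictable.
   Context: By the Whitney theorem, $X$ is regarded as smoothly embedded in some $\mathbb{R}^N$. **Lower information dimension.** For a Borel probability measure $\mu$ in $\mathbb{R}^N$ with compact support, $$\underline{\mathrm{ID}}(\mu) = \liminf_{\varepsilon\to0}\int_{\operatorname{supp}\mu}\frac{\log\mu(B(x,\varepsilon))}{\log\varepsilon}\,d\mu(x).$$ **Delay coordinate map.** For $T\colon X\to X$, $h \colon X \to \mathbb{R}$ and $k\in\mathbb{N}$, $\phi_{h,k}\colon X \to \mathbb{R}^k$ is $\phi_{h,k}(x) = (h(x), h(Tx), \ldots, h(T^{k-1}x))$, and $\nu_{h,k} = (\phi_{h,k})_*\mu$. **Predictability.** Write $\phi = \phi_{h,k}$, $\nu = \nu_{h,k}$. For $y \in \operatorname{supp}\nu$ and $\varepsilon > 0$ put $$\chi_\varepsilon(y) = \frac{1}{\mu(\phi^{-1}(B(y,\varepsilon)))}\int_{\phi^{-1}(B(y,\varepsilon))} \phi(Tx)\,d\mu(x),$$ $$\sigma_\varepsilon(y) = \Big(\frac{1}{\mu(\phi^{-1}(B(y,\varepsilon)))}\int_{\phi^{-1}(B(y,\varepsilon))}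 \|\phi(Tx)-\chi_\varepsilon(y)\|^2\,d\mu(x)\Big)^{1/2},$$ and $\sigma(y) = \lim_{\varepsilon\to0}\sigma_\varepsilon(y)$ if the limit exists ($B(y,\varepsilon)$ is the open ball). The point $y$ is predictable if $\sigma(y)$ exists and equals $0$. **Natural measure.** A compact set $\Lambda\subset X$ with $T(\Lambda)\subset\Lambda$ is an attractor if $B(\Lambda) = \{x\in X: \lim_{n\to\infty}\mathrm{dist}(T^nx,\Lambda) = 0\}$ is an open set containing $\Lambda$. A $T$-invariant Borel probability measure $\mu$ on $\Lambda$ is natural if $\frac1n\sum_{i=0}^{n-1}\delta_{T^ix}\to\mu$ weak-$^*$ for almost every $x\in B(\Lambda)$ with respect to the volume measure on $X$. **Prevalence.** $\mathrm{Lip}(X)$ is the space of Lipschitz functions $h\colon X\to\mathbb{R}$ with norm $\|h\|_\infty + \mathrm{Lip}(h)$, where $\mathrm{Lip}(h)$ is the Lipschitz constant. A Borel subset $S$ of a normed space $V$ is prevalent if there is a Borel measure $\lambda$ on $V$, positive and finite on some compact set in $V$, such that for every $v\in V$ one has $v+e\in S$ for $\lambda$-almost every $e\in V$. A non-Borel subset is prevalent if it contains a prevalent Borel subset. "For a prevalent set of Lipschitz observables" refers to prevalent subsets of $\mathrm{Lip}(X)$. *)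

theory Defs
  imports "HOL-Probability.Probability"
begin

section \<open>Maps of class C^r and embedded manifolds\<close>

text \<open>Class C^n on an open subset of a Euclidean space, through iterated directional derivatives.\<close>

primrec Ck_on :: "nat \<Rightarrow> 'a::euclidean_space set \<Rightarrow> ('a \<Rightarrow> 'b::real_normed_vector) \<Rightarrow> bool" where
  "Ck_on 0 U f \<longleftrightarrow> continuous_on U f"
| "Ck_on (Suc n) U f \<longleftrightarrow>
     (\<forall>x\<in>U. f differentiable (at x)) \<and> (\<forall>v. Ck_on n U (\<lambda>x. frechet_derivative f (at x) v))"

definition Cr_on :: "enat \<Rightarrow> 'a::euclidean_space set \<Rightarrow> ('a \<Rightarrow> 'b::real_normed_vector) \<Rightarrow> bool" where
  "Cr_on r U f \<longleftrightarrow> (\<forall>n. enat n \<le> r \<longrightarrow> Ck_on n U f)"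

text \<open>On a subset \<open>X\<close> of Euclidean space, such as an embedded manifold, a map is of class C^r if it
  extends locally to a C^r map of the ambient space.\<close>

definition Cr_map :: "enat \<Rightarrow> 'a::euclidean_space set \<Rightarrow> ('a \<Rightarrow> 'b::real_normed_vector) \<Rightarrow> bool" where
  "Cr_map r X f \<longleftrightarrow>
     (\<forall>x\<in>X. \<exists>U F. open U \<and> x \<in> U \<and> Cr_on r U F \<and> (\<forall>y\<in>U \<inter> X. F y = f y))"

definition Cr_diffeo :: "enat \<Rightarrow> 'a::euclidean_space set \<Rightarrow> ('a \<Rightarrow> 'a) \<Rightarrow> bool" where
  "Cr_diffeo r X T \<longleftrightarrow> bij_betw T X X \<and> Cr_map r X T \<and> Cr_map r X (the_inv_into X T)"

text \<open>The model subspaces of the slice charts are the coordinate subspaces \<open>span B\<close>, \<open>B \<subseteq> Basis\<close>;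
  up to a linear isometry of the ambient space this is no restriction.\<close>

definition slice_chart ::
  "'a::euclidean_space set \<Rightarrow> 'a set \<Rightarrow> 'a set \<Rightarrow> 'a set \<Rightarrow> ('a \<Rightarrow> 'a) \<Rightarrow> ('a \<Rightarrow> 'a) \<Rightarrow> bool" where
  "slice_chart X B U V f f' \<longleftrightarrow>
     B \<subseteq> Basis \<and> open U \<and> open V \<and> homeomorphism U V f f' \<and>
     Cr_on \<infinity> U f \<and> Cr_on \<infinity> V f' \<and> f ` (U \<inter> X) = V \<inter> span B"

definition embedded_manifold :: "nat \<Rightarrow> 'a::euclidean_space set \<Rightarrow> bool" where
  "embedded_manifold d X \<longleftrightarrow>
     (\<forall>x\<in>X. \<exists>B U V f f'. card B = d \<and> x \<in> U \<and> slice_chart X B U V f f')"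

text \<open>Velocities of curves in \<open>X\<close> through \<open>x\<close>.\<close>

definition tangent_space :: "'a::euclidean_space set \<Rightarrow> 'a \<Rightarrow> 'a set" where
  "tangent_space X x =
     {v. \<exists>\<gamma> \<epsilon>. 0 < \<epsilon> \<and> \<gamma> ` {-\<epsilon><..<\<epsilon>} \<subseteq> X \<and> \<gamma> 0 = x \<and> (\<gamma> has_vector_derivative v) (at (0::real))}"

text \<open>The metric is arbitrary, not necessarily the one induced from the ambient space. Its smoothness
  is tested on smooth tangent vector fields.\<close>

definition riemannian_metric :: "'a::euclidean_space set \<Rightarrow> ('a \<Rightarrow> 'a \<Rightarrow> 'a \<Rightarrow> real) \<Rightarrow> bool" where
  "riemannian_metric X g \<longleftrightarrow>
     (\<forall>x\<in>X. \<forall>u\<in>tangent_space X x. \<forall>v\<in>tangent_space X x. \<forall>w\<in>tangent_space X x.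
        g x u v = g x v u \<and>
        (\<forall>a b. g x (a *\<^sub>R u + b *\<^sub>R v) w = a * g x u w + b * g x v w) \<and>
        (u \<noteq> 0 \<longrightarrow> 0 < g x u u)) \<and>
     (\<forall>Y Z. Cr_map \<infinity> X Y \<and> Cr_map \<infinity> X Z \<and>
        (\<forall>x\<in>X. Y x \<in> tangent_space X x \<and> Z x \<in> tangent_space X x) \<longrightarrow>
        Cr_map \<infinity> X (\<lambda>x. g x (Y x) (Z x)))"

text \<open>Lebesgue measure of dimension \<open>card B\<close> on \<open>span B\<close>, as a Borel measure of the ambient space;
  the unit point mass at 0 if \<open>B\<close> is empty.\<close>

definition subspace_lebesgue :: "'a::euclidean_space set \<Rightarrow> 'a measure" where
  "subspace_lebesgue B =
     distr (\<Pi>\<^sub>M b\<in>B. (lborel :: real measure)) borel (\<lambda>c. \<Sum>b\<in>B. c b *\<^sub>R b)"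

text \<open>The determinant of the Gram matrix of the coordinate fields \<open>\<partial>f'/\<partial>b\<close>, \<open>b \<in> B\<close>, at the point with
  coordinates \<open>z\<close>, by the Leibniz formula (the index set \<open>B\<close> is not a type).\<close>

definition gram_det ::
  "('a::euclidean_space \<Rightarrow> 'a \<Rightarrow> 'a \<Rightarrow> real) \<Rightarrow> 'a set \<Rightarrow> ('a \<Rightarrow> 'a) \<Rightarrow> 'a \<Rightarrow> real" where
  "gram_det g B f' z =
     (\<Sum>p | p permutes B. of_int (sign p) *
        (\<Prod>b\<in>B. g (f' z) (frechet_derivative f' (at z) b) (frechet_derivative f' (at z) (p b))))"

text \<open>The Riemannian volume is the unique Borel measure on \<open>X\<close> with density \<open>sqrt (det g)\<close> in every
  chart.\<close>

definition riemannian_volume ::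
  "'a::euclidean_space set \<Rightarrow> ('a \<Rightarrow> 'a \<Rightarrow> 'a \<Rightarrow> real) \<Rightarrow> 'a measure" where
  "riemannian_volume X g =
     (THE M. sets M = sets (restrict_space borel X) \<and>
        (\<forall>B U V f f'. slice_chart X B U V f f' \<longrightarrow>
           (\<forall>A\<in>sets M. A \<subseteq> U \<longrightarrow>
              emeasure M A =
                (\<integral>\<^sup>+ z. ennreal (sqrt (gram_det g B f' z)) * indicator (f ` A) z
                   \<partial>subspace_lebesgue B))))"

section \<open>Invariant, ergodic and natural measures\<close>

definition invariant_measure :: "('a \<Rightarrow> 'a) \<Rightarrow> 'a measure \<Rightarrow> bool" where
  "invariant_measure T M \<longleftrightarrow> T \<in> measurable M M \<and> distr M M T = M"

definition ergodic_measure :: "('a \<Rightarrow> 'a) \<Rightarrow> 'a measure \<Rightarrow> bool" where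
  "ergodic_measure T M \<longleftrightarrow>
     (\<forall>A\<in>sets M. T -` A \<inter> space M = A \<longrightarrow> measure M A = 0 \<or> measure M A = 1)"

definition basin :: "'a::euclidean_space set \<Rightarrow> ('a \<Rightarrow> 'a) \<Rightarrow> 'a set \<Rightarrow> 'a set" where
  "basin X T \<Lambda> = {x \<in> X. (\<lambda>n. infdist ((T ^^ n) x) \<Lambda>) \<longlonglongrightarrow> 0}"

definition attractor :: "'a::euclidean_space set \<Rightarrow> ('a \<Rightarrow> 'a) \<Rightarrow> 'a set \<Rightarrow> bool" where
  "attractor X T \<Lambda> \<longleftrightarrow>
     compact \<Lambda> \<and> \<Lambda> \<subseteq> X \<and> T ` \<Lambda> \<subseteq> \<Lambda> \<and>
     openin (top_of_set X) (basin X T \<Lambda>) \<and> \<Lambda> \<subseteq> basin X T \<Lambda>"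

text \<open>A measure on the attractor is represented as a measure on \<open>X\<close> giving it full mass. The weak-*
  convergence of the empirical measures is tested on continuous functions.\<close>

definition natural_measure ::
  "'a::euclidean_space set \<Rightarrow> ('a \<Rightarrow> 'a \<Rightarrow> 'a \<Rightarrow> real) \<Rightarrow> ('a \<Rightarrow> 'a) \<Rightarrow> 'a measure \<Rightarrow> bool" where
  "natural_measure X g T \<mu> \<longleftrightarrow>
     prob_space \<mu> \<and> sets \<mu> = sets (restrict_space borel X) \<and> invariant_measure T \<mu> \<and>
     (\<exists>\<Lambda>. attractor X T \<Lambda> \<and> measure \<mu> \<Lambda> = 1 \<and>
        (AE x in riemannian_volume X g. x \<in> basin X T \<Lambda> \<longrightarrow>
           (\<forall>u :: 'a \<Rightarrow> real. continuous_on X u \<longrightarrow>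
              (\<lambda>n. (\<Sum>i<n. u ((T ^^ i) x)) / real n) \<longlonglongrightarrow> (\<integral>x. u x \<partial>\<mu>))))"

section \<open>Information dimension\<close>

definition measure_support :: "'a::topological_space measure \<Rightarrow> 'a set" where
  "measure_support M = {x \<in> space M. \<forall>U. open U \<and> x \<in> U \<longrightarrow> 0 < emeasure M (U \<inter> space M)}"

definition lower_info_dim :: "'a::euclidean_space measure \<Rightarrow> ereal" where
  "lower_info_dim \<mu> =
     Liminf (at_right 0) (\<lambda>\<epsilon>.
       ereal (LINT x:measure_support \<mu>|\<mu>. ln (measure \<mu> (ball x \<epsilon> \<inter> space \<mu>)) / ln \<epsilon>))"

section \<open>Delay coordinates and predictability\<close>

text \<open>The coordinates of \<open>\<real>\<^sup>k\<close> are indexed by a linearly ordered type with \<open>k\<close> elements: the \<open>i\<close>-th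
  delay is the rank of the index, so the exponents run through 0, ..., k - 1 in order.\<close>

definition delay_map ::
  "('a \<Rightarrow> 'a) \<Rightarrow> ('a \<Rightarrow> real) \<Rightarrow> 'a \<Rightarrow> real ^ 'k::{finite,linorder}" where
  "delay_map T h x = (\<chi> i. h ((T ^^ card {j. j < i}) x))"

definition pred_mean ::
  "'a measure \<Rightarrow> ('a \<Rightarrow> 'a) \<Rightarrow> ('a \<Rightarrow> 'b::euclidean_space) \<Rightarrow> real \<Rightarrow> 'b \<Rightarrow> 'b" where
  "pred_mean \<mu> T \<phi> \<epsilon> y =
     (let P = \<phi> -` ball y \<epsilon> \<inter> space \<mu>
      in (1 / measure \<mu> P) *\<^sub>R (LINT x:P|\<mu>. \<phi> (T x)))"

definition pred_deviation ::
  "'a measure \<Rightarrow> ('a \<Rightarrow> 'a) \<Rightarrow> ('a \<Rightarrow> 'b::euclidean_space) \<Rightarrow> real \<Rightarrow> 'b \<Rightarrow> real" where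
  "pred_deviation \<mu> T \<phi> \<epsilon> y =
     (let P = \<phi> -` ball y \<epsilon> \<inter> space \<mu>
      in sqrt ((1 / measure \<mu> P) * (LINT x:P|\<mu>. (norm (\<phi> (T x) - pred_mean \<mu> T \<phi> \<epsilon> y))\<^sup>2)))"

definition predictable ::
  "'a measure \<Rightarrow> ('a \<Rightarrow> 'a) \<Rightarrow> ('a \<Rightarrow> 'b::euclidean_space) \<Rightarrow> 'b \<Rightarrow> bool" where
  "predictable \<mu> T \<phi> y \<longleftrightarrow>
     y \<in> measure_support (distr \<mu> borel \<phi>) \<and>
     ((\<lambda>\<epsilon>. pred_deviation \<mu> T \<phi> \<epsilon> y) \<longlongrightarrow> 0) (at_right 0)"

section \<open>Prevalence in the space of Lipschitz functions\<close>

text \<open>A function on \<open>X\<close> is represented by its extension by 0, which is compatible with the pointwise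
  vector space operations.\<close>

definition Lip :: "'a::metric_space set \<Rightarrow> ('a \<Rightarrow> real) set" where
  "Lip X = {h. (\<exists>C. lipschitz_on C X h) \<and> (\<forall>x. x \<notin> X \<longrightarrow> h x = 0)}"

definition Lip_norm :: "'a::metric_space set \<Rightarrow> ('a \<Rightarrow> real) \<Rightarrow> real" where
  "Lip_norm X h = (SUP x\<in>X. \<bar>h x\<bar>) + Inf {C. lipschitz_on C X h}"

text \<open>Here \<open>V\<close> is a vector space of real functions under the pointwise operations, with norm \<open>nrm\<close>.
  The locale of metric spaces demands a nonnegative distance also outside of the carrier.\<close>

definition norm_topology :: "('a \<Rightarrow> real) set \<Rightarrow> (('a \<Rightarrow> real) \<Rightarrow> real) \<Rightarrow> ('a \<Rightarrow> real) topology" where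
  "norm_topology V nrm =
     Metric_space.mtopology V (\<lambda>f g. if f \<in> V \<and> g \<in> V then nrm (\<lambda>x. f x - g x) else 0)"

definition norm_borel :: "('a \<Rightarrow> real) set \<Rightarrow> (('a \<Rightarrow> real) \<Rightarrow> real) \<Rightarrow> ('a \<Rightarrow> real) measure" where
  "norm_borel V nrm = sigma V {U. openin (norm_topology V nrm) U}"

definition borel_prevalent ::
  "('a \<Rightarrow> real) set \<Rightarrow> (('a \<Rightarrow> real) \<Rightarrow> real) \<Rightarrow> ('a \<Rightarrow> real) set \<Rightarrow> bool" where
  "borel_prevalent V nrm S \<longleftrightarrow>
     S \<in> sets (norm_borel V nrm) \<and>
     (\<exists>L. sets L = sets (norm_borel V nrm) \<and>
        (\<exists>K. compactin (norm_topology V nrm) K \<and> 0 < emeasure L K \<and> emeasure L K < \<infinity>) \<and>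
        (\<forall>v\<in>V. AE e in L. (\<lambda>x. v x + e x) \<in> S))"

definition prevalent ::
  "('a \<Rightarrow> real) set \<Rightarrow> (('a \<Rightarrow> real) \<Rightarrow> real) \<Rightarrow> ('a \<Rightarrow> real) set \<Rightarrow> bool" where
  "prevalent V nrm S \<longleftrightarrow> S \<subseteq> V \<and> (\<exists>S'\<subseteq>S. borel_prevalent V nrm S')"

end

theory Submission
  imports Defs "HOL-Computational_Algebra.Polynomial"
begin

text \<open>
  Let \<open>D\<close> be the set of points \<open>x\<close> with \<open>\<mu> (ball x \<epsilon>) > c * \<epsilon> powr s\<close> for arbitrarily small \<open>\<epsilon>\<close>, where \<open>s < k\<close>
  and \<open>c > 0\<close>. As the information dimension is less than \<open>k\<close>, Fatou's argument gives \<open>D\<close> positive measure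
  for some \<open>s\<close>; since \<open>T\<close> is Lipschitz, \<open>D\<close> is forward invariant, hence of full measure by ergodicity.
  Vitali's lemma then covers \<open>D\<close> by balls with an arbitrarily small sum of \<open>k\<close>-th powers of radii.
  Perturb an observable by a random linear combination of finitely many probe functions that interpolate
  any values at \<open>2 k\<close> points. For fixed \<open>x\<close> and fixed aperiodic \<open>y\<close> off the orbit of \<open>x\<close>, the delay vectors of \<open>x\<close>
  and \<open>y\<close> are \<open>\<epsilon>\<close>-close with probability at most a constant times \<open>\<epsilon> ^ k\<close>, so almost surely no \<open>y\<close> in \<open>D\<close> has the delay
  vector of \<open>x\<close>. Fubini's theorem gives injectivity on a set of full measure. If the periodic points are not
  negligible, \<open>\<mu>\<close> lives on one finite orbit and separating pairs of points suffices.

  If the delay map \<open>\<phi>\<close> is injective on a set of full measure, it is a homeomorphism on compact sets \<open>K\<close> of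
  measure close to 1, and \<open>\<phi> \<circ> T\<close> is there a continuous function of \<open>\<phi>\<close>. The deviation
  tends to 0 at every \<open>y\<close> in \<open>\<phi> ` K\<close> at which the part of the ball around \<open>y\<close> that comes from outside \<open>K\<close> has
  density 0, and almost every such \<open>y\<close> is of this kind by Besicovitch's covering argument.
\<close>

section \<open>Probe functions\<close>

text \<open>For a fixed \<open>x\<close> only the partners \<open>y\<close> have to be covered, and
  \<open>x\<close> is then integrated out; this is why \<open>k\<close> must exceed the dimension
  once and not twice. The lower dimension yields heavy balls only at scales that depend on the
  point, so covers of a single mesh are not at hand and the radii vary with the centre. The
  Lipschitz property of \<open>T\<close> and of the observables turns an error \<epsilon> in
  \<open>y\<close> into an error of order \<epsilon> in the delay vector. Two delay vectors involve
  the orbit segments of \<open>x\<close> and \<open>y\<close>, hence \<open>2 * k\<close> points; if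
  the segments meet, the duality behind the volume estimate breaks down, but by injectivity of
  \<open>T\<close> this concerns finitely many \<open>y\<close> for each \<open>x\<close>.
  Prevalence and Fubini's theorem ask for measurability of sets defined by the existence of a
  partner, so partners are sought in compact sets and at distance at least a fixed gap, both of
  which then run through countable families. For predictability nothing is known about the image
  measure, in particular no doubling property; hence Besicovitch's covering argument and not
  Vitali's.\<close>

definition moment_vec :: "nat \<Rightarrow> 'a::euclidean_space" where
  "moment_vec l = (\<Sum>b\<in>Basis. real l ^ to_nat_on Basis b *\<^sub>R b)"

lemma inner_moment_vec:
  "(x::'a::euclidean_space) \<bullet> moment_vec l = poly (\<Sum>b\<in>Basis. monom (x \<bullet> b) (to_nat_on Basis b)) (real l)"
  by (simp add: moment_vec_def inner_sum_right poly_sum poly_monom mult.commute)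

text \<open>As a function of \<open>l\<close> the inner product is a polynomial whose coefficients
  are the coordinates of \<open>x\<close>; the bound counts its roots.\<close>

lemma card_moment_zeros:
  fixes x :: "'a::euclidean_space"
  assumes "x \<noteq> 0"
  shows "finite {l. x \<bullet> moment_vec l = 0}" "card {l. x \<bullet> moment_vec l = 0} \<le> DIM('a)"
proof -
  let ?p = "\<Sum>b\<in>Basis. monom (x \<bullet> b) (to_nat_on Basis b)"
  have bij: "bij_betw (to_nat_on (Basis::'a set)) Basis {..<DIM('a)}"
    by (rule to_nat_on_finite) simp
  have inj: "inj_on (to_nat_on (Basis::'a set)) Basis"
    using bij by (simp add: bij_betw_def)
  obtain b where b: "b \<in> Basis" "x \<bullet> b \<noteq> 0"
    using assms euclidean_all_zero_iff by blast
  have "coeff ?p (to_nat_on Basis b) = (\<Sum>c\<in>Basis. if c = b then x \<bullet> c else 0)"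
    unfolding coeff_sum
    by (rule sum.cong) (use inj b in \<open>auto simp: inj_on_def\<close>)
  then have ne: "?p \<noteq> 0" using b by auto
  have deg: "degree ?p \<le> DIM('a)"
  proof (rule degree_le, intro allI impI)
    fix i assume "DIM('a) < i"
    then have "to_nat_on Basis c \<noteq> i" if "c \<in> Basis" for c :: 'a
      using bij_betw_apply[OF bij that] by auto
    then show "coeff ?p i = 0" by (simp add: coeff_sum)
  qed
  have sub: "real ` {l. x \<bullet> moment_vec l = 0} \<subseteq> {t. poly ?p t = 0}"
    by (auto simp: inner_moment_vec)
  have fin: "finite {t. poly ?p t = 0}" using ne by (rule poly_roots_finite)
  show f: "finite {l. x \<bullet> moment_vec l = 0}"
    using finite_subset[OF sub fin] finite_image_iff[of real] inj_of_nat inj_on_subset by blast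
  have "card {l. x \<bullet> moment_vec l = 0} = card (real ` {l. x \<bullet> moment_vec l = 0})"
    by (simp add: card_image)
  also have "\<dots> \<le> card {t. poly ?p t = 0}" using card_mono fin sub by blast
  also have "\<dots> \<le> degree ?p" using ne card_poly_roots_bound by blast
  finally show "card {l. x \<bullet> moment_vec l = 0} \<le> DIM('a)" using deg by simp
qed

text \<open>Each of the at most \<open>n * n\<close> pairs of distinct points is confused by at most
  \<open>DIM('a)\<close> indices, so among \<open>n * n * DIM('a) + 1\<close> indices one confuses
  no pair.\<close>

lemma moment_vec_separates:
  fixes Z :: "'a::euclidean_space set"
  assumes "finite Z" "card Z \<le> n"
  shows "\<exists>l\<le>n * n * DIM('a). inj_on (\<lambda>x. x \<bullet> moment_vec l) Z"
proof (rule ccontr)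
  assume no: "\<not> ?thesis"
  let ?P = "{(x,y) \<in> Z \<times> Z. x \<noteq> y}"
  have fP: "finite ?P" using assms by (auto intro: finite_subset[of _ "Z \<times> Z"])
  have cP: "card ?P \<le> n * n"
  proof -
    have "card ?P \<le> card (Z \<times> Z)" using assms by (intro card_mono) auto
    also have "\<dots> \<le> n * n" using assms by (simp add: card_cartesian_product mult_le_mono)
    finally show ?thesis .
  qed
  have "{..n * n * DIM('a)} \<subseteq> (\<Union>p\<in>?P. {l. (fst p - snd p) \<bullet> moment_vec l = 0})"
  proof
    fix l assume "l \<in> {..n * n * DIM('a)}"
    then have "\<not> inj_on (\<lambda>x. x \<bullet> moment_vec l) Z" using no by auto
    then show "l \<in> (\<Union>p\<in>?P. {l. (fst p - snd p) \<bullet> moment_vec l = 0})"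
      unfolding inj_on_def by (auto simp: inner_diff_left)
  qed
  then have "card {..n * n * DIM('a)} \<le> card (\<Union>p\<in>?P. {l. (fst p - snd p) \<bullet> moment_vec l = 0})"
    using fP by (intro card_mono finite_UN_I card_moment_zeros(1)) auto
  also have "\<dots> \<le> (\<Sum>p\<in>?P. card {l. (fst p - snd p) \<bullet> moment_vec l = 0})"
    using fP by (rule card_UN_le)
  also have "\<dots> \<le> (\<Sum>p\<in>?P. DIM('a))"
    by (intro sum_mono card_moment_zeros(2)) auto
  also have "\<dots> \<le> n * n * DIM('a)" using cP by simp
  finally show False by simp
qed

text \<open>Powers of linear functionals along the moment curve: one of the functionals is injective on any given
  \<open>n\<close> points, and its powers below \<open>n\<close> interpolate there.\<close>

definition probe_index :: "'a::euclidean_space itself \<Rightarrow> nat \<Rightarrow> (nat \<times> nat) set" where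
  "probe_index _ n = {..n * n * DIM('a)} \<times> {..<n}"

definition probe :: "nat \<times> nat \<Rightarrow> 'a::euclidean_space \<Rightarrow> real" where
  "probe i x = (x \<bullet> moment_vec (fst i)) ^ snd i"

lemma finite_probe_index [simp]: "finite (probe_index a n)"
  by (simp add: probe_index_def)

text \<open>Lagrange interpolation in the single coordinate \<open>x \<bullet> moment_vec l\<close>
  that separates \<open>Z\<close>. As \<open>z\<close> is not among the roots of the node
  polynomial, its degree is below \<open>card Z\<close>, so the powers below \<open>n\<close>
  suffice.\<close>

lemma probe_interpolation:
  fixes Z :: "'a::euclidean_space set"
  assumes "finite Z" "card Z \<le> n" "z \<in> Z"
  shows "\<exists>a. \<forall>x\<in>Z. (\<Sum>i\<in>probe_index TYPE('a) n. a i * probe i x) = (if x = z then 1 else 0)"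
proof -
  obtain l where l: "l \<le> n * n * DIM('a)" and inj: "inj_on (\<lambda>x. x \<bullet> moment_vec l) Z"
    using moment_vec_separates[OF assms(1,2)] by blast
  let ?v = "moment_vec l :: 'a"
  define P where "P = (\<Prod>p\<in>Z - {z}. [:- (p \<bullet> ?v), 1:])"
  have ev: "poly P (x \<bullet> ?v) = (\<Prod>p\<in>Z - {z}. (x - p) \<bullet> ?v)" for x
    by (simp add: P_def poly_prod inner_diff_left)
  have nz: "poly P (z \<bullet> ?v) \<noteq> 0"
    using assms inj by (auto simp: ev inner_diff_left inj_on_def)
  have z0: "poly P (x \<bullet> ?v) = 0" if "x \<in> Z" "x \<noteq> z" for x
    unfolding ev using that assms by (intro prod_zero) (auto intro!: bexI[of _ x])
  have "degree P \<le> (\<Sum>p\<in>Z - {z}. 1)"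
    unfolding P_def using assms(1) by (intro order.trans[OF degree_prod_sum_le]) auto
  then have "degree P < n"
    using assms card_gt_0_iff[of Z] by (auto simp: card_Diff_singleton)
  then have pe: "poly P t = (\<Sum>j<n. coeff P j * t ^ j)" for t
    unfolding poly_altdef
    by (intro sum.mono_neutral_left) (auto simp: coeff_eq_0)
  \<comment> \<open>Only the powers of the separating functional \<open>l\<close> receive a nonzero
    coefficient.\<close>
  define a where "a i = (if fst i = l then coeff P (snd i) / poly P (z \<bullet> ?v) else 0)" for i :: "nat \<times> nat"
  have "(\<Sum>i\<in>probe_index TYPE('a) n. a i * probe i x) = poly P (x \<bullet> ?v) / poly P (z \<bullet> ?v)" for x
  proof -
    have "(\<Sum>i\<in>probe_index TYPE('a) n. a i * probe i x)
        = (\<Sum>m\<le>n * n * DIM('a). \<Sum>j<n. if m = l then coeff P j / poly P (z \<bullet> ?v) * (x \<bullet> moment_vec m) ^ j else 0)"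
      unfolding probe_index_def sum.cartesian_product
      by (rule sum.cong) (auto simp: a_def probe_def)
    also have "\<dots> = (\<Sum>m\<le>n * n * DIM('a). if m = l then (\<Sum>j<n. coeff P j / poly P (z \<bullet> ?v) * (x \<bullet> moment_vec m) ^ j) else 0)"
      by (rule sum.cong) auto
    also have "\<dots> = (\<Sum>j<n. coeff P j / poly P (z \<bullet> ?v) * (x \<bullet> ?v) ^ j)"
      using l by simp
    also have "\<dots> = poly P (x \<bullet> ?v) / poly P (z \<bullet> ?v)"
      by (simp add: pe sum_divide_distrib)
    finally show ?thesis .
  qed
  then show ?thesis using nz z0 by (intro exI[of _ a]) auto
qed

lemma continuous_probe [continuous_intros]: "continuous_on A (probe i)"
  unfolding probe_def by (intro continuous_intros)

section \<open>The volume of slabs\<close>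

abbreviation lborel_fun :: "'i set \<Rightarrow> ('i \<Rightarrow> real) measure" where
  "lborel_fun I \<equiv> (\<Pi>\<^sub>M i\<in>I. lborel)"

text \<open>Boxes determine the product measure, and on a box each factor is translation invariant.
  The restriction \<open>\<lambda>i\<in>I\<close> keeps the translates extensional, as the points of
  the product space are.\<close>

lemma PiM_lborel_translate:
  fixes s :: "'i \<Rightarrow> real"
  assumes "finite I"
  shows "distr (lborel_fun I) (lborel_fun I) (\<lambda>x. \<lambda>i\<in>I. x i + s i) = (lborel_fun I)"
proof -
  interpret product_sigma_finite "\<lambda>i::'i. lborel :: real measure" ..
  show ?thesis
  proof (rule PiM_eqI[OF assms])
    show "sets (distr (lborel_fun I) (lborel_fun I) (\<lambda>x. \<lambda>i\<in>I. x i + s i)) = sets (lborel_fun I)"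
      by simp
    fix A :: "'i \<Rightarrow> real set" assume A: "\<And>i. i \<in> I \<Longrightarrow> A i \<in> sets lborel"
    have m: "(\<lambda>x. \<lambda>i\<in>I. x i + s i) \<in> (lborel_fun I) \<rightarrow>\<^sub>M (lborel_fun I)"
      by measurable
    have "emeasure (distr (lborel_fun I) (lborel_fun I) (\<lambda>x. \<lambda>i\<in>I. x i + s i)) (Pi\<^sub>E I A)
        = emeasure (lborel_fun I) ((\<lambda>x. \<lambda>i\<in>I. x i + s i) -` Pi\<^sub>E I A \<inter> space (lborel_fun I))"
      using A assms by (intro emeasure_distr[OF m] sets_PiM_I_finite) auto
    also have "(\<lambda>x. \<lambda>i\<in>I. x i + s i) -` Pi\<^sub>E I A \<inter> space (lborel_fun I)
      = Pi\<^sub>E I (\<lambda>i. (\<lambda>t. s i + t) -` A i)"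
      by (auto simp: space_PiM PiE_def Pi_def extensional_def add.commute)
    also have "emeasure (lborel_fun I) \<dots> = (\<Prod>i\<in>I. emeasure lborel ((\<lambda>t. s i + t) -` A i))"
    proof (rule emeasure_PiM[OF assms])
      fix i assume "i \<in> I"
      then have "A i \<in> sets borel" using A by simp
      then have "(\<lambda>t. s i + t) -` A i \<inter> space borel \<in> sets borel"
        by (rule measurable_sets[rotated]) measurable
      then show "(\<lambda>t. s i + t) -` A i \<in> sets lborel" by simp
    qed
    also have "\<dots> = (\<Prod>i\<in>I. emeasure lborel (A i))"
    proof (rule prod.cong[OF refl])
      fix i assume "i \<in> I"
      then have Ai: "A i \<in> sets borel" using A by simp
      have "emeasure lborel (A i) = emeasure (distr lborel borel ((+) (s i))) (A i)"
        by (simp only: lborel_distr_plus)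
      also have "\<dots> = emeasure lborel ((\<lambda>t. s i + t) -` A i)"
        using Ai by (subst emeasure_distr) auto
      finally show "emeasure lborel ((\<lambda>t. s i + t) -` A i) = emeasure lborel (A i)" by simp
    qed
    finally show "emeasure (distr (lborel_fun I) (lborel_fun I) (\<lambda>x. \<lambda>i\<in>I. x i + s i)) (Pi\<^sub>E I A) = (\<Prod>i\<in>I. emeasure lborel (A i))" .
  qed
qed

lemma emeasure_PiM_lborel_translate:
  fixes s :: "'i \<Rightarrow> real"
  assumes "finite I" "S \<in> sets (lborel_fun I)"
  shows "(\<lambda>x. \<lambda>i\<in>I. x i + s i) -` S \<inter> space (lborel_fun I) \<in> sets (lborel_fun I)"
    "emeasure (lborel_fun I) ((\<lambda>x. \<lambda>i\<in>I. x i + s i) -` S \<inter> space (lborel_fun I))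
     = emeasure (lborel_fun I) S"
proof -
  have m: "(\<lambda>x. \<lambda>i\<in>I. x i + s i) \<in> (lborel_fun I) \<rightarrow>\<^sub>M (lborel_fun I)"
    by measurable
  show "(\<lambda>x. \<lambda>i\<in>I. x i + s i) -` S \<inter> space (lborel_fun I) \<in> sets (lborel_fun I)"
    using m assms(2) by (rule measurable_sets)
  show "emeasure (lborel_fun I) ((\<lambda>x. \<lambda>i\<in>I. x i + s i) -` S \<inter> space (lborel_fun I))
     = emeasure (lborel_fun I) S"
    using emeasure_distr[OF m assms(2)] PiM_lborel_translate[OF assms(1), of s] by simp
qed

text \<open>The translates of the slab by the integer combinations of \<open>3 \<epsilon> v b\<close> are pairwise disjoint and
  stay in a fixed cube.\<close>

lemma slab_volume:
  fixes m v :: "nat \<Rightarrow> 'i \<Rightarrow> real" and w :: "nat \<Rightarrow> real"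
  assumes I: "finite I" and c: "0 \<le> c"
    and dual: "\<And>a b. a < k \<Longrightarrow> b < k \<Longrightarrow> (\<Sum>i\<in>I. m a i * v b i) = (if a = b then 1 else 0)"
    and bnd: "\<And>b i. b < k \<Longrightarrow> i \<in> I \<Longrightarrow> \<bar>v b i\<bar> \<le> c"
    and eps: "0 < \<epsilon>" "\<epsilon> \<le> 1"
  defines "S \<equiv> {x \<in> space (lborel_fun I).
      (\<forall>i\<in>I. x i \<in> {0..1}) \<and> (\<forall>a<k. \<bar>w a + (\<Sum>i\<in>I. m a i * x i)\<bar> \<le> \<epsilon>)}"
  shows "S \<in> sets (lborel_fun I)"
    "emeasure (lborel_fun I) S \<le> ennreal ((6 * real k * c + 1) ^ card I * 2 ^ k * \<epsilon> ^ k)"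
proof -
  let ?L = "lborel_fun I"
  interpret product_sigma_finite "\<lambda>i::'i. lborel :: real measure" ..
  show S: "S \<in> sets ?L" unfolding S_def using I by measurable
  \<comment> \<open>The number of translates in each of the \<open>k\<close> directions:
    \<open>\<epsilon> * K \<le> 1\<close> keeps the shifts bounded independently of \<epsilon>, and
    \<open>1 \<le> 2 * \<epsilon> * K\<close> makes the translates numerous enough.\<close>
  define K where "K = nat \<lfloor>1 / \<epsilon>\<rfloor>"
  have K1: "real K \<le> 1 / \<epsilon>" "1 / (2 * \<epsilon>) \<le> real K"
  proof -
    have "1 \<le> 1 / \<epsilon>" using eps by simp
    then have f: "1 \<le> \<lfloor>1 / \<epsilon>\<rfloor>" by (simp add: le_floor_iff)
    have "real K = of_int \<lfloor>1 / \<epsilon>\<rfloor>" unfolding K_def by (intro of_nat_nat order.trans[OF _ f]) simp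
    with f have "1 \<le> real K" "real K \<le> 1 / \<epsilon>" "1 / \<epsilon> < real K + 1" by linarith+
    then have "real K \<le> 1 / \<epsilon>" "1 / \<epsilon> \<le> 2 * real K" by linarith+
    then show "real K \<le> 1 / \<epsilon>" "1 / (2 * \<epsilon>) \<le> real K"
      using eps by (auto simp: field_simps)
  qed
  define R where "R = 3 * real k * c"
  have R0: "0 \<le> R" using c by (simp add: R_def)
  let ?Q = "{..<k} \<rightarrow>\<^sub>E {..<K}"
  \<comment> \<open>By duality this shift changes the \<open>a\<close>-th linear form by exactly
    \<open>3 * \<epsilon> * q a\<close> up to sign. The slab has width \<open>2 * \<epsilon>\<close>
    in that form, so the factor 3 separates different translates.\<close>
  define sh where "sh q i = - (3 * \<epsilon> * (\<Sum>b<k. real (q b) * v b i))" for q :: "nat \<Rightarrow> nat" and i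
  define T where "T q = (\<lambda>x. \<lambda>i\<in>I. x i + sh q i) -` S \<inter> space ?L" for q
  have shb: "\<bar>sh q i\<bar> \<le> R" if "q \<in> ?Q" "i \<in> I" for q i
  proof -
    have "\<bar>\<Sum>b<k. real (q b) * v b i\<bar> \<le> (\<Sum>b<k. real K * c)"
    proof (intro order.trans[OF sum_abs] sum_mono)
      fix b assume b: "b \<in> {..<k}"
      then have "q b < K" using that(1) by auto
      then show "\<bar>real (q b) * v b i\<bar> \<le> real K * c"
        unfolding abs_mult using b bnd[of b i] that(2) by (intro mult_mono) auto
    qed
    also have "\<dots> = real K * (real k * c)" by simp
    finally have "3 * \<epsilon> * \<bar>\<Sum>b<k. real (q b) * v b i\<bar> \<le> 3 * \<epsilon> * (real K * (real k * c))"
      using eps by (intro mult_left_mono) auto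
    also have "\<dots> = 3 * (\<epsilon> * real K) * (real k * c)" by simp
    also have "\<dots> \<le> 3 * 1 * (real k * c)"
      using K1(1) eps c by (intro mult_right_mono mult_left_mono) (auto simp: field_simps)
    finally show ?thesis using eps by (simp add: sh_def R_def abs_mult)
  qed
  have msh: "(\<Sum>i\<in>I. m a i * sh q i) = - (3 * \<epsilon> * real (q a))" if "a < k" for a q
  proof -
    have "(\<Sum>i\<in>I. m a i * sh q i) = - (3 * \<epsilon> * (\<Sum>i\<in>I. \<Sum>b<k. m a i * (real (q b) * v b i)))"
      by (simp add: sh_def sum_distrib_left sum_negf algebra_simps)
    also have "(\<Sum>i\<in>I. \<Sum>b<k. m a i * (real (q b) * v b i)) = (\<Sum>b<k. real (q b) * (\<Sum>i\<in>I. m a i * v b i))"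
      by (subst sum.swap) (simp add: sum_distrib_left algebra_simps)
    also have "\<dots> = (\<Sum>b<k. if a = b then real (q b) else 0)"
      by (rule sum.cong) (use dual that in auto)
    also have "\<dots> = real (q a)" using that by simp
    finally show ?thesis .
  qed
  have Tmem: "\<bar>w a + (\<Sum>i\<in>I. m a i * x i) - 3 * \<epsilon> * real (q a)\<bar> \<le> \<epsilon>" if "x \<in> T q" "a < k" for x q a
  proof -
    have "\<bar>w a + (\<Sum>i\<in>I. m a i * (x i + sh q i))\<bar> \<le> \<epsilon>"
      using that by (auto simp: T_def S_def)
    also have "(\<Sum>i\<in>I. m a i * (x i + sh q i)) = (\<Sum>i\<in>I. m a i * x i) + (\<Sum>i\<in>I. m a i * sh q i)"
      by (simp add: algebra_simps sum.distrib)
    finally show ?thesis using msh[OF that(2)] by (simp add: algebra_simps)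
  qed
  have disj: "disjoint_family_on T ?Q"
    unfolding disjoint_family_on_def
  proof (intro ballI impI, rule ccontr)
    fix q q' assume q: "q \<in> ?Q" "q' \<in> ?Q" "q \<noteq> q'" and "T q \<inter> T q' \<noteq> {}"
    then obtain x where x: "x \<in> T q" "x \<in> T q'" by auto
    obtain a where a: "a < k" "q a \<noteq> q' a" using q by (meson PiE_ext lessThan_iff)
    have "1 \<le> \<bar>real (q a) - real (q' a)\<bar>" using a by linarith
    then have "3 * \<epsilon> * 1 \<le> 3 * \<epsilon> * \<bar>real (q a) - real (q' a)\<bar>"
      using eps by (intro mult_left_mono) auto
    also have "\<dots> = \<bar>3 * \<epsilon> * real (q a) - 3 * \<epsilon> * real (q' a)\<bar>"
      using eps by (simp add: abs_mult flip: right_diff_distrib)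
    also have "\<dots> \<le> 2 * \<epsilon>" using Tmem[OF x(1) a(1)] Tmem[OF x(2) a(1)] by linarith
    finally show False using eps by simp
  qed
  have Tsets: "T q \<in> sets ?L" for q
    unfolding T_def by (rule emeasure_PiM_lborel_translate[OF I S])
  have Tsub: "T q \<subseteq> Pi\<^sub>E I (\<lambda>_. {-R..1 + R})" if "q \<in> ?Q" for q
  proof
    fix x assume x: "x \<in> T q"
    have "x i \<in> {-R..1 + R}" if i: "i \<in> I" for i
    proof -
      have "x i + sh q i \<in> {0..1}" using x i by (auto simp: T_def S_def)
      then show ?thesis using shb[OF \<open>q \<in> ?Q\<close> i] by auto
    qed
    then show "x \<in> Pi\<^sub>E I (\<lambda>_. {-R..1 + R})" using x by (auto simp: T_def space_PiM)
  qed
  \<comment> \<open>All \<open>K ^ k\<close> translates have the volume of \<open>S\<close> and fit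
    disjointly into a cube of side \<open>1 + 2 * R\<close>, which is the
    \<open>6 * real k * c + 1\<close> of the claim.\<close>
  have "of_nat (K ^ k) * emeasure ?L S = (\<Sum>q\<in>?Q. emeasure ?L (T q))"
    by (simp add: T_def emeasure_PiM_lborel_translate[OF I S] card_PiE)
  also have "\<dots> = emeasure ?L (\<Union>q\<in>?Q. T q)"
    by (rule sum_emeasure) (use disj Tsets in \<open>auto intro: finite_PiE\<close>)
  also have "\<dots> \<le> emeasure ?L (Pi\<^sub>E I (\<lambda>_. {-R..1 + R}))"
    using Tsub I by (intro emeasure_mono sets_PiM_I_finite) auto
  also have "\<dots> = (\<Prod>i\<in>I. emeasure lborel {-R..1 + R})"
    using I by (intro emeasure_PiM) auto
  also have "\<dots> = ennreal ((1 + 2 * R) ^ card I)"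
  proof -
    have "emeasure lborel {-R..1 + R} = ennreal (1 + 2 * R)"
      using R0 by (subst emeasure_lborel_Icc) (auto simp: algebra_simps)
    then show ?thesis using R0 by (simp only: prod_constant ennreal_power)
  qed
  finally have main: "of_nat (K ^ k) * emeasure ?L S \<le> ennreal ((1 + 2 * R) ^ card I)" .
  have one: "1 \<le> (2 * \<epsilon>) ^ k * real (K ^ k)"
  proof -
    have "1 \<le> (2 * \<epsilon> * real K) ^ k" using K1 eps by (intro one_le_power) (auto simp: field_simps)
    then show ?thesis by (simp add: power_mult_distrib)
  qed
  have "emeasure ?L S = ennreal 1 * emeasure ?L S" by simp
  also have "\<dots> \<le> ennreal ((2 * \<epsilon>) ^ k * real (K ^ k)) * emeasure ?L S"
    using one by (intro mult_right_mono ennreal_leI) auto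
  also have "\<dots> = ennreal ((2 * \<epsilon>) ^ k) * (of_nat (K ^ k) * emeasure ?L S)"
    using eps by (simp add: ennreal_mult mult.assoc ennreal_of_nat_eq_real_of_nat)
  also have "\<dots> \<le> ennreal ((2 * \<epsilon>) ^ k) * ennreal ((1 + 2 * R) ^ card I)"
    using main by (intro mult_left_mono) auto
  also have "\<dots> = ennreal ((6 * real k * c + 1) ^ card I * 2 ^ k * \<epsilon> ^ k)"
    using eps R0 by (simp add: ennreal_mult[symmetric] R_def power_mult_distrib algebra_simps)
  finally show "emeasure ?L S \<le> ennreal ((6 * real k * c + 1) ^ card I * 2 ^ k * \<epsilon> ^ k)" .
qed

section \<open>Small unions of slabs\<close>

text \<open>Countable subadditivity for an index set without an enumeration, as the centres of a
  Vitali subfamily are given.\<close>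

lemma emeasure_UN_countable_le:
  assumes "countable F" "\<And>y. y \<in> F \<Longrightarrow> A y \<in> sets N"
  shows "emeasure N (\<Union>y\<in>F. A y) \<le> (\<integral>\<^sup>+ y. emeasure N (A y) \<partial>count_space F)"
proof -
  have "emeasure N (\<Union>y\<in>F. A y) = (\<integral>\<^sup>+ x. indicator (\<Union>y\<in>F. A y) x \<partial>N)"
    using assms by (intro nn_integral_indicator[symmetric] sets.countable_UN') auto
  also have "\<dots> \<le> (\<integral>\<^sup>+ x. (\<integral>\<^sup>+ y. indicator (A y) x \<partial>count_space F) \<partial>N)"
  proof (rule nn_integral_mono)
    fix x
    show "indicator (\<Union>y\<in>F. A y) x \<le> (\<integral>\<^sup>+ y. indicator (A y) x \<partial>count_space F)"
    proof (cases "\<exists>y\<in>F. x \<in> A y")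
      case True
      then obtain y where y: "y \<in> F" "x \<in> A y" by blast
      then have "(1::ennreal) = indicator (A y) x" by simp
      also have "\<dots> \<le> (\<integral>\<^sup>+ y. indicator (A y) x \<partial>count_space F)"
        by (rule nn_integral_ge_point[OF y(1)])
      finally show ?thesis by (auto simp: indicator_def)
    qed (auto simp: indicator_def)
  qed
  also have "\<dots> = (\<integral>\<^sup>+ y. (\<integral>\<^sup>+ x. indicator (A y) x \<partial>N) \<partial>count_space F)"
    using assms by (intro nn_integral_count_space_nn_integral) auto
  also have "\<dots> = (\<integral>\<^sup>+ y. emeasure N (A y) \<partial>count_space F)"
    using assms by (intro nn_integral_cong) auto
  finally show ?thesis .
qed

text \<open>A set \<open>E\<close> of this kind has zero \<open>k\<close>-dimensional Hausdorff measure, and by Vitali's lemma the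
  small covering balls may be centred in \<open>E\<close>, where the bound on \<open>S y\<close> is available.\<close>

lemma null_union_transversal:
  fixes M :: "'a::euclidean_space measure" and N :: "'p measure"
  assumes "finite_measure M" "sets M = sets (restrict_space borel X)"
    and c: "0 < c" and s: "s < real k"
    and E: "\<And>y \<delta>. y \<in> E \<Longrightarrow> 0 < \<delta> \<Longrightarrow> \<exists>\<epsilon>. 0 < \<epsilon> \<and> \<epsilon> < \<delta> \<and> c * \<epsilon> powr s < measure M (ball y \<epsilon> \<inter> X)"
    and \<Lambda>: "1 \<le> \<Lambda>" and C: "0 \<le> C"
    and S: "\<And>y \<epsilon>. y \<in> E \<Longrightarrow> 0 < \<epsilon> \<Longrightarrow> \<epsilon> \<le> 1 \<Longrightarrow> S y \<epsilon> \<in> sets N \<and> emeasure N (S y \<epsilon>) \<le> ennreal (C * \<epsilon> ^ k)"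
    and bad: "\<And>y y' \<epsilon>. y \<in> E \<Longrightarrow> y' \<in> E \<Longrightarrow> 0 < \<epsilon> \<Longrightarrow> dist y y' \<le> \<epsilon> \<Longrightarrow> bad y \<subseteq> S y' (\<Lambda> * \<epsilon>)"
  shows "\<exists>Z\<in>null_sets N. (\<Union>y\<in>E. bad y) \<subseteq> Z"
proof -
  interpret finite_measure M by fact
  have spM: "space M = X" using assms(2)[THEN sets_eq_imp_space_eq] by (simp add: space_restrict_space)
  have ballM: "ball y \<epsilon> \<inter> X \<in> sets M" for y \<epsilon>
    unfolding assms(2) sets_restrict_space by (subst Int_commute) (intro imageI borel_open open_ball)
  \<comment> \<open>The factor \<open>C * (5 * \<Lambda>) ^ k\<close> comes from the slabs belonging
    to fivefold balls, and \<open>measure M X / c\<close> bounds the sum of the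
    \<open>r y powr s\<close> over disjoint balls. The restriction on \<delta> below keeps the slab
    parameter at most 1, where the bound on \<open>S\<close> holds.\<close>
  define B where "B = C * (5 * \<Lambda>) ^ k * (measure M X / c)"
  have step: "\<exists>Z\<in>sets N. (\<Union>y\<in>E. bad y) \<subseteq> Z \<and> emeasure N Z \<le> ennreal (B * \<delta> powr (real k - s))"
    if d: "0 < \<delta>" "\<delta> \<le> 1 / (5 * \<Lambda>)" for \<delta>
  proof -
    obtain r where r: "\<And>y. y \<in> E \<Longrightarrow> 0 < r y \<and> r y < \<delta> \<and> c * r y powr s < measure M (ball y (r y) \<inter> X)"
    proof -
      have "\<forall>y\<in>E. \<exists>\<epsilon>. 0 < \<epsilon> \<and> \<epsilon> < \<delta> \<and> c * \<epsilon> powr s < measure M (ball y \<epsilon> \<inter> X)"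
        using E d(1) by blast
      from bchoice[OF this] show ?thesis using that by blast
    qed
    \<comment> \<open>Disjointness of the small balls bounds the sum of their masses by the total
      mass, while the fivefold balls still cover \<open>E\<close>.\<close>
    obtain F where F: "countable F" "F \<subseteq> E" "pairwise (\<lambda>i j. disjnt (ball i (r i)) (ball j (r j))) F"
      "E \<subseteq> (\<Union>i\<in>F. ball i (5 * r i))"
      by (rule Vitali_covering_lemma_balls[where S=E and K=E and a="\<lambda>x. x" and r=r and B=\<delta>]) (use r in force)+
    define Z where "Z = (\<Union>y\<in>F. S y (\<Lambda> * (5 * r y)))"
    have small: "0 < \<Lambda> * (5 * r y)" "\<Lambda> * (5 * r y) \<le> 1" if "y \<in> F" for y
    proof -
      have ry: "0 < r y" "r y < \<delta>" using r F(2) that by auto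
      show "0 < \<Lambda> * (5 * r y)" using ry \<Lambda> by simp
      have "5 * \<Lambda> * r y \<le> 5 * \<Lambda> * \<delta>" using ry \<Lambda> by (intro mult_left_mono) auto
      also have "\<dots> \<le> 1" using d \<Lambda> by (simp add: field_simps)
      finally show "\<Lambda> * (5 * r y) \<le> 1" by (simp add: algebra_simps)
    qed
    have SF: "S y (\<Lambda> * (5 * r y)) \<in> sets N"
      "emeasure N (S y (\<Lambda> * (5 * r y))) \<le> ennreal (C * (\<Lambda> * (5 * r y)) ^ k)" if "y \<in> F" for y
      using S small that F(2) by blast+
    have "(\<Union>y\<in>E. bad y) \<subseteq> Z"
    proof (rule UN_least)
      fix y assume y: "y \<in> E"
      then obtain y' where y': "y' \<in> F" "y \<in> ball y' (5 * r y')" using F(4) by blast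
      have "bad y \<subseteq> S y' (\<Lambda> * (5 * r y'))"
        using y y' F(2) r by (intro bad) (auto simp: dist_commute intro: less_imp_le)
      then show "bad y \<subseteq> Z" using y' by (auto simp: Z_def)
    qed
    moreover have "Z \<in> sets N" unfolding Z_def using F(1) SF by (intro sets.countable_UN') auto
    moreover have "emeasure N Z \<le> ennreal (B * \<delta> powr (real k - s))"
    proof -
      let ?D = "C * (5 * \<Lambda>) ^ k * \<delta> powr (real k - s) / c"
      have D0: "0 \<le> ?D" using C \<Lambda> c by simp
      have one: "emeasure N (S y (\<Lambda> * (5 * r y))) \<le> ennreal ?D * emeasure M (ball y (r y) \<inter> X)"
        if y: "y \<in> F" for y
      proof -
        have ry: "0 < r y" "r y < \<delta>" "c * r y powr s < measure M (ball y (r y) \<inter> X)"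
          using r F(2) that by auto
        \<comment> \<open>The exponent \<open>s\<close> is paid for by the mass of the ball; the
          surplus \<open>real k - s\<close> gives the power of \<delta> that tends to 0.\<close>
        have "r y ^ k = r y powr (real k - s) * r y powr s"
          using ry by (simp add: powr_realpow flip: powr_add)
        also have "\<dots> \<le> \<delta> powr (real k - s) * r y powr s"
          using ry s by (intro mult_right_mono powr_mono2) auto
        also have "\<dots> \<le> \<delta> powr (real k - s) * (measure M (ball y (r y) \<inter> X) / c)"
          using ry c by (intro mult_left_mono) (auto simp: field_simps)
        finally have "C * (5 * \<Lambda>) ^ k * r y ^ k \<le> C * (5 * \<Lambda>) ^ k * (\<delta> powr (real k - s) * (measure M (ball y (r y) \<inter> X) / c))"
          using C \<Lambda> by (intro mult_left_mono) auto
        then have "C * (\<Lambda> * (5 * r y)) ^ k \<le> ?D * measure M (ball y (r y) \<inter> X)"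
          by (simp add: power_mult_distrib algebra_simps)
        then have "ennreal (C * (\<Lambda> * (5 * r y)) ^ k) \<le> ennreal (?D * measure M (ball y (r y) \<inter> X))"
          by (rule ennreal_leI)
        also have "\<dots> = ennreal ?D * emeasure M (ball y (r y) \<inter> X)"
          unfolding emeasure_eq_measure using D0 by (rule ennreal_mult')
        finally show ?thesis using SF(2)[OF y] by (rule order.trans[rotated])
      qed
      have "emeasure N Z \<le> (\<integral>\<^sup>+ y. emeasure N (S y (\<Lambda> * (5 * r y))) \<partial>count_space F)"
        unfolding Z_def using F(1) SF by (intro emeasure_UN_countable_le) auto
      also have "\<dots> \<le> (\<integral>\<^sup>+ y. ennreal ?D * emeasure M (ball y (r y) \<inter> X) \<partial>count_space F)"
        by (rule nn_integral_mono) (use one in auto)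
      also have "\<dots> = ennreal ?D * (\<integral>\<^sup>+ y. emeasure M (ball y (r y) \<inter> X) \<partial>count_space F)"
        by (rule nn_integral_cmult) auto
      also have "(\<integral>\<^sup>+ y. emeasure M (ball y (r y) \<inter> X) \<partial>count_space F) = emeasure M (\<Union>y\<in>F. ball y (r y) \<inter> X)"
        using F(1,3) ballM
        by (intro emeasure_UN_countable[symmetric]) (auto simp: disjoint_family_on_def pairwise_def disjnt_def)
      also have "\<dots> \<le> emeasure M X" using spM by (metis emeasure_space)
      also have "ennreal ?D * emeasure M X = ennreal (B * \<delta> powr (real k - s))"
        using D0 by (simp add: emeasure_eq_measure B_def algebra_simps flip: ennreal_mult')
      finally show ?thesis by (simp add: mult_left_mono)
    qed
    ultimately show ?thesis by blast
  qed
  define \<delta> where "\<delta> n = 1 / (5 * \<Lambda> * real (Suc n))" for n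
  have dn: "0 < \<delta> n" "\<delta> n \<le> 1 / (5 * \<Lambda>)" for n
  proof -
    have "5 * \<Lambda> * 1 \<le> 5 * \<Lambda> * real (Suc n)" using \<Lambda> by (intro mult_left_mono) auto
    then show "0 < \<delta> n" "\<delta> n \<le> 1 / (5 * \<Lambda>)"
      unfolding \<delta>_def using \<Lambda> by (auto intro!: divide_left_mono mult_pos_pos simp del: of_nat_Suc)
  qed
  have "\<exists>Z\<in>sets N. (\<Union>y\<in>E. bad y) \<subseteq> Z \<and> emeasure N Z \<le> ennreal (B * \<delta> n powr (real k - s))" for n
    using step[OF dn] .
  then obtain Z where Z: "\<And>n. Z n \<in> sets N" "\<And>n. (\<Union>y\<in>E. bad y) \<subseteq> Z n"
    "\<And>n. emeasure N (Z n) \<le> ennreal (B * \<delta> n powr (real k - s))"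
    by metis
  have lim: "(\<lambda>n. ennreal (B * \<delta> n powr (real k - s))) \<longlonglongrightarrow> ennreal (B * 0)"
  proof (intro tendsto_ennrealI tendsto_mult tendsto_const)
    have "(\<lambda>n. (1 / (5 * \<Lambda>)) * (1 / real (Suc n))) \<longlonglongrightarrow> (1 / (5 * \<Lambda>)) * 0"
      by (intro tendsto_mult tendsto_const lim_1_over_n[THEN LIMSEQ_Suc])
    then have "\<delta> \<longlonglongrightarrow> 0" by (simp add: \<delta>_def[abs_def])
    then have "(\<lambda>n. \<delta> n powr (real k - s)) \<longlonglongrightarrow> 0 powr (real k - s)"
      using s dn(1) by (intro tendsto_powr2) (auto intro!: always_eventually less_imp_le)
    then show "(\<lambda>n. \<delta> n powr (real k - s)) \<longlonglongrightarrow> 0" by simp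
  qed
  have IZ: "(\<Inter>n. Z n) \<in> sets N" using Z(1) by auto
  have "emeasure N (\<Inter>n. Z n) \<le> ennreal (B * \<delta> n powr (real k - s))" for n
    using emeasure_mono[of "\<Inter>n. Z n" "Z n" N] Z(1,3) by (meson INF_lower UNIV_I order.trans)
  then have "emeasure N (\<Inter>n. Z n) \<le> ennreal (B * 0)"
    using lim by (intro tendsto_lowerbound[OF lim]) auto
  then have "(\<Inter>n. Z n) \<in> null_sets N" using IZ by (auto simp: null_sets_def)
  then show ?thesis using Z(2) by (intro bexI[of _ "\<Inter>n. Z n"]) blast+
qed

section \<open>Besicovitch coverings and densities\<close>

abbreviation recip :: "nat \<Rightarrow> real" where
  "recip n \<equiv> 1 / real (Suc n)"

text \<open>An open ball is the increasing union of smaller concentric balls, so its mass is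
  continuous from the left in the radius.\<close>

lemma measure_ball_gt_left:
  fixes M :: "'a::metric_space measure"
  assumes "finite_measure M" "sets M = sets (restrict_space borel X)" "c < measure M (ball y r \<inter> X)"
  obtains r' where "r' < r" "c < measure M (ball y r' \<inter> X)"
proof -
  interpret finite_measure M by fact
  have ballM: "ball y \<epsilon> \<inter> X \<in> sets M" for y \<epsilon>
    unfolding assms(2) sets_restrict_space by (subst Int_commute) (intro imageI borel_open open_ball)
  let ?A = "\<lambda>n. ball y (r - recip n) \<inter> X"
  have "(\<Union>n. ?A n) = ball y r \<inter> X"
  proof (intro equalityI subsetI)
    fix z assume z: "z \<in> ball y r \<inter> X"
    then obtain n where "inverse (real (Suc n)) < r - dist y z"
      using reals_Archimedean[of "r - dist y z"] by auto
    then have "dist y z < r - recip n" by (simp add: inverse_eq_divide)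
    then show "z \<in> (\<Union>n. ?A n)" using z by auto
  next
    fix z assume "z \<in> (\<Union>n. ?A n)"
    then obtain n where "z \<in> X" "dist y z < r - recip n" by auto
    moreover have "0 < recip n" by simp
    ultimately show "z \<in> ball y r \<inter> X" unfolding mem_ball Int_iff by linarith
  qed
  moreover have "(\<lambda>n. measure M (?A n)) \<longlonglongrightarrow> measure M (\<Union>n. ?A n)"
  proof (rule finite_Lim_measure_incseq)
    show "incseq ?A"
    proof (rule incseq_SucI, rule Int_mono[OF subset_ball order_refl])
      fix n
      have "recip (Suc n) \<le> recip n" by (intro divide_left_mono) auto
      then show "r - recip n \<le> r - recip (Suc n)" by linarith
    qed
  qed (use ballM in auto)
  ultimately have "eventually (\<lambda>n. c < measure M (?A n)) sequentially"
    using assms(3) by (simp add: order_tendstoD(1))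
  then obtain n where n: "c < measure M (?A n)" by (auto simp: eventually_sequentially)
  show ?thesis by (rule that[OF _ n]) simp
qed

text \<open>A strict lower bound survives a slight shrinking of the radius, and the shrunken ball
  lies in the original-size balls around all nearby centres. Openness, rather than mere
  measurability, later permits unions over uncountably many radii.\<close>

lemma open_measure_ball_gt:
  fixes M :: "'a::metric_space measure"
  assumes "finite_measure M" "sets M = sets (restrict_space borel X)"
  shows "open {y. c < measure M (ball y r \<inter> X)}"
  unfolding open_dist
proof (intro ballI)
  interpret finite_measure M by fact
  fix y assume "y \<in> {y. c < measure M (ball y r \<inter> X)}"
  then obtain r' where r': "r' < r" "c < measure M (ball y r' \<inter> X)"
    using measure_ball_gt_left[OF assms] by blast
  have "c < measure M (ball z r \<inter> X)" if z: "dist z y < r - r'" for z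
  proof -
    have "ball y r' \<inter> X \<subseteq> ball z r \<inter> X"
    proof
      fix w assume w: "w \<in> ball y r' \<inter> X"
      have "dist z w \<le> dist z y + dist y w" by (rule dist_triangle)
      then show "w \<in> ball z r \<inter> X" using z w by auto
    qed
    then have "measure M (ball y r' \<inter> X) \<le> measure M (ball z r \<inter> X)"
      using assms(2) by (intro finite_measure_mono) (auto simp: sets_restrict_space)
    then show ?thesis using r' by linarith
  qed
  then show "\<exists>e>0. \<forall>z. dist z y < e \<longrightarrow> z \<in> {y. c < measure M (ball y r \<inter> X)}"
    using r' by (intro exI[of _ "r - r'"]) auto
qed

text \<open>In a finite cover by balls of radius \<open>b / 2\<close>, two points of one ball are
  less than \<open>b\<close> apart, so separated points lie in balls with different centres.\<close>

lemma separated_card_bound: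
  fixes A :: "'a::euclidean_space set"
  assumes "bounded A" "0 < b"
  shows "\<exists>N. \<forall>F\<subseteq>A. (\<forall>x\<in>F. \<forall>y\<in>F. x \<noteq> y \<longrightarrow> b \<le> dist x y) \<longrightarrow> finite F \<and> card F \<le> N"
proof -
  have "compact (closure A)" using assms(1) by (simp add: compact_closure)
  then obtain C where C: "finite C" "closure A \<subseteq> (\<Union>x\<in>C. ball x (b / 2))"
    using assms(2) compact_imp_seq_compact seq_compact_imp_totally_bounded
    by (metis half_gt_zero_iff)
  have "finite F \<and> card F \<le> card C"
    if F: "F \<subseteq> A" "\<And>x y. x \<in> F \<Longrightarrow> y \<in> F \<Longrightarrow> x \<noteq> y \<Longrightarrow> b \<le> dist x y" for F
  proof -
    have "\<forall>x\<in>F. \<exists>c\<in>C. dist c x < b / 2"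
      using C(2) F(1) closure_subset[of A] by (auto simp: subset_eq)
    then obtain h where h: "\<And>x. x \<in> F \<Longrightarrow> h x \<in> C \<and> dist (h x) x < b / 2" by metis
    have inj: "inj_on h F"
    proof (rule inj_onI, rule ccontr)
      fix x y assume xy: "x \<in> F" "y \<in> F" "h x = h y" "x \<noteq> y"
      have "dist x y \<le> dist (h x) x + dist (h x) y" by (metis dist_commute dist_triangle)
      then show False using h[OF xy(1)] h[OF xy(2)] F(2)[OF xy(1,2,4)] xy(3) by simp
    qed
    have "h ` F \<subseteq> C" using h by auto
    then show ?thesis using inj C(1) by (metis card_inj_on_le finite_imageD finite_subset)
  qed
  then show ?thesis by (intro exI[of _ "card C"]) blast
qed

text \<open>Seen from a common point of two such balls, their centres subtend an angle of at least 60
  degrees.\<close>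

lemma ball_overlap_bound:
  "\<exists>N. \<forall>F (r :: 'a::euclidean_space \<Rightarrow> real) p.
     (\<forall>x\<in>F. \<forall>y\<in>F. x \<noteq> y \<longrightarrow> r x \<le> dist x y) \<longrightarrow> (\<forall>x\<in>F. p \<in> ball x (r x)) \<longrightarrow> finite F \<and> card F \<le> N"
proof -
  have "bounded (sphere (0::'a) 1)" by simp
  then obtain N where N: "\<And>F. F \<subseteq> sphere (0::'a) 1 \<Longrightarrow>
      (\<forall>x\<in>F. \<forall>y\<in>F. x \<noteq> y \<longrightarrow> 1 \<le> dist x y) \<Longrightarrow> finite F \<and> card F \<le> N"
    using separated_card_bound[of "sphere (0::'a) 1" 1] by auto
  have "finite F \<and> card F \<le> max N 1"
    if sep: "\<forall>x\<in>F. \<forall>y\<in>F. x \<noteq> y \<longrightarrow> r x \<le> dist x y" and p: "\<forall>x\<in>F. p \<in> ball x (r x)"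
    for F and r :: "'a \<Rightarrow> real" and p
  proof (cases "p \<in> F")
    case True
    have "F = {p}"
    proof (rule ccontr)
      assume "F \<noteq> {p}"
      then obtain x where x: "x \<in> F" "x \<noteq> p" using True by auto
      then have "r x \<le> dist x p" "dist x p < r x" using sep p True by auto
      then show False by simp
    qed
    then show ?thesis by simp
  next
    case False
    define u where "u x = (x - p) /\<^sub>R norm (x - p)" for x
    have ne: "norm (x - p) > 0" if "x \<in> F" for x using that False by auto
    \<comment> \<open>With \<open>y\<close> the farther of the two centres,
      \<open>norm (y - p) < r y \<le> norm (x - y)\<close> makes the side opposite \<open>p\<close>
      longer than \<open>norm (y - p)\<close>; the law of cosines then bounds the cosine of the
      angle at \<open>p\<close> by 1/2. The separation hypothesis holds for both orders of a pair,
      so either centre may be the farther one.\<close>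
    have far0: "1 \<le> dist (u x) (u y)" if xy: "x \<in> F" "y \<in> F" "x \<noteq> y" and le: "norm (x - p) \<le> norm (y - p)" for x y
    proof -
      let ?a = "norm (x - p)" and ?b = "norm (y - p)"
      have ab: "0 < ?a" "0 < ?b" using ne xy by auto
      have "?b < r y" using p xy by (auto simp: dist_norm)
      also have "r y \<le> norm (x - y)" using sep xy by (metis dist_commute dist_norm)
      finally have "?b\<^sup>2 < (norm (x - y))\<^sup>2" using ab by (intro power_strict_mono) auto
      also have "\<dots> = (norm ((x - p) - (y - p)))\<^sup>2" by simp
      also have "\<dots> = ?a\<^sup>2 + ?b\<^sup>2 - 2 * ((x - p) \<bullet> (y - p))"
        unfolding power2_norm_eq_inner by (simp add: inner_diff_left inner_diff_right inner_commute)
      finally have "2 * ((x - p) \<bullet> (y - p)) < ?a * ?a" by (simp add: power2_eq_square)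
      also have "\<dots> \<le> ?a * ?b" using le ab by (intro mult_left_mono) auto
      finally have *: "2 * ((x - p) \<bullet> (y - p)) \<le> ?a * ?b" by simp
      have uu: "u z \<bullet> u z = 1" if "z \<in> F" for z
        using ne[OF that] by (simp add: u_def dot_square_norm power2_eq_square)
      have "u x \<bullet> u y = ((x - p) \<bullet> (y - p)) / (?a * ?b)" by (simp add: u_def divide_inverse mult_ac)
      also have "\<dots> \<le> 1 / 2" using * ab by (simp add: field_simps)
      finally have "1 \<le> (dist (u x) (u y))\<^sup>2"
        unfolding dist_norm power2_norm_eq_inner using uu xy
        by (simp add: inner_diff_left inner_diff_right inner_commute)
      then show ?thesis using power2_le_imp_le[of 1 "dist (u x) (u y)"] by simp
    qed
    have far: "1 \<le> dist (u x) (u y)" if "x \<in> F" "y \<in> F" "x \<noteq> y" for x y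
      using far0[of x y] far0[of y x] that by (cases "norm (x - p) \<le> norm (y - p)") (auto simp: dist_commute)
    then have inj: "inj_on u F" by (force intro: inj_onI)
    have "u ` F \<subseteq> sphere 0 1" using ne by (auto simp: u_def)
    then have "finite (u ` F) \<and> card (u ` F) \<le> N" by (rule N) (use far in auto)
    then show ?thesis using inj by (auto simp: card_image finite_image_iff)
  qed
  then show ?thesis by blast
qed

text \<open>Greedy selection by decreasing radius. The induction adds the smallest radius last, when
  all earlier centres have larger radii, and among the points still uncovered it takes a maximal
  separated set. With finitely many radii no approximate maxima occur, so the separation involves
  the exact radii.\<close>

lemma besicovitch_finite_radii:
  fixes r :: "'a::euclidean_space \<Rightarrow> real"
  assumes "finite R"
  shows "bounded A \<Longrightarrow> r ` A \<subseteq> R \<Longrightarrow> (\<forall>b\<in>R. 0 < b) \<Longrightarrow>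
    \<exists>F\<subseteq>A. finite F \<and> A \<subseteq> (\<Union>x\<in>F. ball x (r x)) \<and> (\<forall>x\<in>F. \<forall>y\<in>F. x \<noteq> y \<longrightarrow> r x \<le> dist x y)"
  using assms
proof (induction R arbitrary: A rule: finite_linorder_min_induct)
  case empty
  then show ?case by auto
next
  case (insert b R)
  let ?A = "{x\<in>A. r x \<in> R}"
  have "bounded ?A" using insert.prems(1) by (rule bounded_subset) auto
  then obtain F where F: "F \<subseteq> ?A" "finite F" "?A \<subseteq> (\<Union>x\<in>F. ball x (r x))"
    "\<forall>x\<in>F. \<forall>y\<in>F. x \<noteq> y \<longrightarrow> r x \<le> dist x y"
  proof -
    have 1: "r ` ?A \<subseteq> R" by auto
    have 2: "\<forall>b\<in>R. 0 < b" using insert.prems(3) by simp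
    show ?thesis using insert.IH[OF \<open>bounded ?A\<close> 1 2] by (elim exE conjE) (rule that)
  qed
  define A' where "A' = {x\<in>A. r x = b} - (\<Union>x\<in>F. ball x (r x))"
  define sep where "sep G \<longleftrightarrow> G \<subseteq> A' \<and> (\<forall>x\<in>G. \<forall>y\<in>G. x \<noteq> y \<longrightarrow> b \<le> dist x y)" for G
  have bA': "bounded A'" using insert.prems(1) by (rule bounded_subset) (auto simp: A'_def)
  have b0: "0 < b" using insert.prems by simp
  have "\<exists>N. \<forall>G. sep G \<longrightarrow> finite G \<and> card G \<le> N"
    unfolding sep_def imp_conjL by (rule separated_card_bound[OF bA' b0])
  then obtain N where N: "\<And>G. sep G \<Longrightarrow> finite G \<and> card G \<le> N" by auto
  have "sep {}" by (simp add: sep_def)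
  \<comment> \<open>Cardinalities of separated subsets are bounded, so one of maximal size exists;
    an uncovered point could be added to it.\<close>
  then have "\<exists>G. sep G \<and> (\<forall>G'. sep G' \<longrightarrow> card G' \<le> card G)"
    using N by (intro ex_has_greatest_nat[where b="Suc N"]) (auto simp: less_Suc_eq_le)
  then obtain G where G: "sep G" "\<And>G'. sep G' \<Longrightarrow> card G' \<le> card G" by auto
  have fG: "finite G" using N[OF G(1)] ..
  have GA': "G \<subseteq> A'" and Gsep: "\<And>p q. p \<in> G \<Longrightarrow> q \<in> G \<Longrightarrow> p \<noteq> q \<Longrightarrow> b \<le> dist p q"
    using G(1) unfolding sep_def by auto
  have rG: "r p = b" "p \<in> A" "\<And>x. x \<in> F \<Longrightarrow> p \<notin> ball x (r x)" if "p \<in> G" for p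
    using GA' that unfolding A'_def by auto
  have covG: "A' \<subseteq> (\<Union>x\<in>G. ball x b)"
  proof (rule ccontr)
    assume "\<not> ?thesis"
    then obtain z where z0: "z \<in> A'" "z \<notin> (\<Union>x\<in>G. ball x b)" by blast
    have z: "z \<in> A'" "\<And>x. x \<in> G \<Longrightarrow> b \<le> dist x z" using z0 by (auto simp: not_less)
    have z': "b \<le> dist z x" if "x \<in> G" for x using z(2)[OF that] by (simp add: dist_commute)
    have "sep (insert z G)" unfolding sep_def using z(1) z(2) z' GA' Gsep by blast
    then have "card (insert z G) \<le> card G" by (rule G(2))
    moreover have "z \<notin> G" using z(2)[of z] b0 by auto
    ultimately show False using fG by simp
  qed
  have FA: "p \<in> A" "r p \<in> R" if "p \<in> F" for p using F(1) that by auto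
  show ?case
  proof (intro exI[of _ "F \<union> G"] conjI)
    show "F \<union> G \<subseteq> A" using FA rG by auto
    show "finite (F \<union> G)" using F(2) fG by auto
    show "A \<subseteq> (\<Union>x\<in>F \<union> G. ball x (r x))"
    proof
      fix z assume z: "z \<in> A"
      show "z \<in> (\<Union>x\<in>F \<union> G. ball x (r x))"
      proof (cases "z \<in> (\<Union>x\<in>F. ball x (r x))")
        case False
        then have "r z \<notin> R" using F(3) z by blast
        then have "r z = b" using z insert.prems(2) by auto
        then have "z \<in> A'" using z False unfolding A'_def by simp
        then obtain x where x: "x \<in> G" "z \<in> ball x b" using covG by blast
        then show ?thesis using rG(1)[OF x(1)] by auto
      qed auto
    qed
    show "\<forall>x\<in>F \<union> G. \<forall>y\<in>F \<union> G. x \<noteq> y \<longrightarrow> r x \<le> dist x y"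
    proof (intro ballI impI)
      fix x y assume xy: "x \<in> F \<union> G" "y \<in> F \<union> G" "x \<noteq> y"
      \<comment> \<open>A new centre \<open>q\<close> was left uncovered by the old balls, so it is
        at least \<open>r p\<close> away from \<open>p\<close>, and \<open>r q = b\<close> is
        smaller still.\<close>
      have cross: "r p \<le> dist p q" "r q \<le> dist p q" if "p \<in> F" "q \<in> G" for p q
      proof -
        have "q \<notin> ball p (r p)" "r q = b" using rG that by auto
        moreover have "b < r p" using FA that(1) insert.hyps by auto
        ultimately show "r p \<le> dist p q" "r q \<le> dist p q" by auto
      qed
      consider "x \<in> F" "y \<in> F" | "x \<in> F" "y \<in> G" | "x \<in> G" "y \<in> F" | "x \<in> G" "y \<in> G"
        using xy by blast
      then show "r x \<le> dist x y"
        using F(4) xy(3) cross[of x y] cross(2)[of y x] Gsep[of x y] rG(1)[of x]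
        by cases (auto simp: dist_commute)
    qed
  qed
qed

text \<open>The weak type inequality for the maximal function of \<kappa> relative to \<nu>. No
  point lies in more than \<open>N\<close> of the selected balls, so their \<kappa>-masses add up to
  at most \<open>N\<close> times the mass of \<open>U\<close>. The overlap number depends only on
  the ambient space and not on the measures.\<close>

lemma besicovitch_weak_type:
  fixes \<nu> \<kappa> :: "'a::euclidean_space measure"
  assumes N: "\<And>F (r :: 'a \<Rightarrow> real) p. (\<forall>x\<in>F. \<forall>y\<in>F. x \<noteq> y \<longrightarrow> r x \<le> dist x y) \<Longrightarrow>
      (\<forall>x\<in>F. p \<in> ball x (r x)) \<Longrightarrow> finite F \<and> card F \<le> N"
    and s: "sets \<nu> = sets borel" "sets \<kappa> = sets borel" "finite_measure \<nu>" "finite_measure \<kappa>"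
    and h: "bounded A" "finite R" "\<forall>b\<in>R. 0 < b" "0 < t" "U \<in> sets borel" "A \<in> sets borel"
    and A: "\<forall>y\<in>A. \<exists>r\<in>R. t * measure \<nu> (ball y r) \<le> measure \<kappa> (ball y r) \<and> ball y r \<subseteq> U"
  shows "t * measure \<nu> A \<le> real N * measure \<kappa> U"
proof -
  interpret n: finite_measure \<nu> by fact
  interpret k: finite_measure \<kappa> by fact
  obtain r where r: "\<And>y. y \<in> A \<Longrightarrow> r y \<in> R \<and> t * measure \<nu> (ball y (r y)) \<le> measure \<kappa> (ball y (r y)) \<and> ball y (r y) \<subseteq> U"
    using A by metis
  obtain F where F: "F \<subseteq> A" "finite F" "A \<subseteq> (\<Union>x\<in>F. ball x (r x))"
    "\<forall>x\<in>F. \<forall>y\<in>F. x \<noteq> y \<longrightarrow> r x \<le> dist x y"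
    using besicovitch_finite_radii[of R A r] h r by blast
  have "measure \<nu> A \<le> measure \<nu> (\<Union>x\<in>F. ball x (r x))"
    using F s by (intro n.finite_measure_mono) auto
  also have "\<dots> \<le> (\<Sum>x\<in>F. measure \<nu> (ball x (r x)))"
    using F s by (intro n.finite_measure_subadditive_finite) auto
  finally have "t * measure \<nu> A \<le> (\<Sum>x\<in>F. t * measure \<nu> (ball x (r x)))"
    using h by (simp add: sum_distrib_left[symmetric])
  also have "\<dots> \<le> (\<Sum>x\<in>F. measure \<kappa> (ball x (r x)))"
    using r F(1) by (intro sum_mono) auto
  also have "\<dots> = (\<integral>y. (\<Sum>x\<in>F. indicator (ball x (r x)) y) \<partial>\<kappa>)"
    using s by (subst Bochner_Integration.integral_sum) (auto simp: k.emeasure_finite less_top[symmetric] integrable_indicator_iff)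
  also have "\<dots> \<le> (\<integral>y. real N * indicator U y \<partial>\<kappa>)"
  proof (rule integral_mono)
    fix y
    have "(\<Sum>x\<in>F. indicator (ball x (r x)) y) = real (card {x\<in>F. y \<in> ball x (r x)})"
      using F(2) by (simp add: indicator_def Int_def if_distrib sum.If_cases)
    moreover have "card {x\<in>F. y \<in> ball x (r x)} \<le> N"
      using N[of "{x\<in>F. y \<in> ball x (r x)}" r y] F(4) by auto
    moreover have "{x\<in>F. y \<in> ball x (r x)} = {}" if "y \<notin> U" using r F(1) that by blast
    ultimately show "(\<Sum>x\<in>F. indicator (ball x (r x)) y) \<le> real N * indicator U y"
      by (cases "y \<in> U") auto
  qed (use s h in \<open>auto simp: k.emeasure_finite less_top[symmetric] integrable_indicator_iff\<close>)
  also have "\<dots> = real N * measure \<kappa> U" using s h by (simp add: sets_eq_imp_space_eq[OF s(2)])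
  finally show ?thesis .
qed

text \<open>The \<kappa>-mass of shrinking neighbourhoods \<open>U n\<close> of \<open>F\<close>
  tends to 0. By the weak type inequality the points of \<open>F\<close> at which \<kappa> exceeds
  \<open>t\<close> times \<nu> on some ball of radius below \<open>recip n\<close> have \<nu>-mass
  at most \<open>N / t\<close> times that of \<open>U n\<close> under \<kappa>; points with such
  radii arbitrarily small belong to all these sets.\<close>

lemma relative_density_zero:
  fixes \<nu> \<kappa> :: "'a::euclidean_space measure"
  assumes s: "sets \<nu> = sets borel" "sets \<kappa> = sets borel" and fm: "finite_measure \<nu>" "finite_measure \<kappa>"
    and F: "compact F" "measure \<kappa> F = 0"
  shows "AE y in \<nu>. y \<in> F \<longrightarrow>
    (\<forall>t>0. \<exists>\<rho>>0. \<forall>\<epsilon>. 0 < \<epsilon> \<longrightarrow> \<epsilon> < \<rho> \<longrightarrow> measure \<kappa> (ball y \<epsilon>) \<le> t * measure \<nu> (ball y \<epsilon>))"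
proof (cases "F = {}")
  case False
  interpret n: finite_measure \<nu> by fact
  interpret k: finite_measure \<kappa> by fact
  obtain N where N: "\<And>F (r :: 'a \<Rightarrow> real) p. (\<forall>x\<in>F. \<forall>y\<in>F. x \<noteq> y \<longrightarrow> r x \<le> dist x y) \<Longrightarrow>
      (\<forall>x\<in>F. p \<in> ball x (r x)) \<Longrightarrow> finite F \<and> card F \<le> N"
    using ball_overlap_bound by blast
  have meas: "(\<lambda>y. measure M (ball y r)) \<in> borel_measurable borel"
    if "finite_measure M" "sets M = sets borel" for M :: "'a measure" and r
    unfolding borel_measurable_iff_greater
    using open_measure_ball_gt[of M UNIV _ r] that by (auto simp: sets_restrict_UNIV)
  define U where "U n = {x. infdist x F < recip n}" for n
  have Uo: "open (U n)" for n
    unfolding U_def by (intro open_Collect_less continuous_intros)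
  have lim: "(\<lambda>n. measure \<kappa> (U n)) \<longlonglongrightarrow> 0"
  proof -
    have "(\<lambda>n. measure \<kappa> (U n)) \<longlonglongrightarrow> measure \<kappa> (\<Inter>n. U n)"
    proof (rule k.finite_Lim_measure_decseq)
      show "decseq U"
      proof (rule decseq_SucI)
        fix n
        have "recip (Suc n) \<le> recip n" by (intro divide_left_mono) auto
        then show "U (Suc n) \<subseteq> U n" unfolding U_def by auto
      qed
    qed (use s Uo in auto)
    also have "(\<Inter>n. U n) = F"
    proof (intro equalityI subsetI)
      fix x assume x: "x \<in> (\<Inter>n. U n)"
      have "infdist x F \<le> 0"
      proof (rule ccontr)
        assume "\<not> infdist x F \<le> 0"
        then obtain n where "inverse (real (Suc n)) < infdist x F"
          using reals_Archimedean[of "infdist x F"] by auto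
        moreover have "infdist x F < recip n" using x by (auto simp: U_def)
        ultimately show False by (simp add: inverse_eq_divide)
      qed
      then have "infdist x F = 0" using infdist_nonneg[of x F] by linarith
      then show "x \<in> F" using False F(1) in_closed_iff_infdist_zero compact_imp_closed by blast
    qed (auto simp: U_def)
    finally show ?thesis using F by simp
  qed
  \<comment> \<open>Rational radii below \<open>recip n\<close> are exhausted by finite sets
    \<open>R n j\<close>, since the weak type inequality admits finitely many radii only.\<close>
  define q where "q = from_nat_into (\<rat> :: real set)"
  have rq: "range q = \<rat>" unfolding q_def by (intro range_from_nat_into) (auto simp: countable_rat)
  define R where "R n j = q ` {..<j} \<inter> {0<..<recip n}" for n j :: nat
  define A where "A t n j = {y\<in>F. \<exists>r\<in>R n j. t * measure \<nu> (ball y r) < measure \<kappa> (ball y r)}" for t n j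
  have fR: "finite (R n j)" for n j by (simp add: R_def)
  have Ab: "A t n j \<in> sets borel" for t n j
  proof -
    have "A t n j = F \<inter> (\<Union>r\<in>R n j. {y. t * measure \<nu> (ball y r) < measure \<kappa> (ball y r)})"
      by (auto simp: A_def)
    also have "\<dots> \<in> sets borel"
      using compact_imp_closed[OF F(1)] fR meas[OF fm(1) s(1)] meas[OF fm(2) s(2)]
      by (intro sets.Int sets.finite_UN borel_measurable_less) (auto intro!: borel_measurable_less borel_measurable_times borel_closed)
    finally show ?thesis .
  qed
  have bnd: "t * measure \<nu> (A t n j) \<le> real N * measure \<kappa> (U n)" if "0 < t" for t n j
  proof (rule besicovitch_weak_type[OF N s fm _ fR[of n j]])
    show "bounded (A t n j)" using compact_imp_bounded[OF F(1)] by (rule bounded_subset) (auto simp: A_def)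
    show "\<forall>y\<in>A t n j. \<exists>r\<in>R n j. t * measure \<nu> (ball y r) \<le> measure \<kappa> (ball y r) \<and> ball y r \<subseteq> U n"
    proof
      fix y assume "y \<in> A t n j"
      then obtain r where r: "y \<in> F" "r \<in> R n j" "t * measure \<nu> (ball y r) < measure \<kappa> (ball y r)"
        by (auto simp: A_def)
      have "ball y r \<subseteq> U n"
      proof
        fix z assume z: "z \<in> ball y r"
        have "infdist z F \<le> dist z y" using r(1) by (rule infdist_le)
        then show "z \<in> U n" using z r(2) by (auto simp: U_def R_def dist_commute)
      qed
      then show "\<exists>r\<in>R n j. t * measure \<nu> (ball y r) \<le> measure \<kappa> (ball y r) \<and> ball y r \<subseteq> U n"
        using r by (intro bexI[of _ r]) auto
    qed
  qed (use that Ab Uo in \<open>auto simp: R_def\<close>)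
  have null: "measure \<nu> (\<Inter>n. \<Union>j. A t n j) = 0" if t: "0 < t" for t
  proof -
    have b1: "t * measure \<nu> (\<Union>j. A t n j) \<le> real N * measure \<kappa> (U n)" for n
    proof -
      have "incseq (A t n)" by (rule incseq_SucI) (force simp: A_def R_def)
      then have "(\<lambda>j. t * measure \<nu> (A t n j)) \<longlonglongrightarrow> t * measure \<nu> (\<Union>j. A t n j)"
        using Ab s by (intro tendsto_mult tendsto_const n.finite_Lim_measure_incseq) auto
      then show ?thesis by (rule LIMSEQ_le_const2) (use bnd[OF t] in auto)
    qed
    have b2: "t * measure \<nu> (\<Inter>n. \<Union>j. A t n j) \<le> real N * measure \<kappa> (U n)" for n
    proof -
      have "measure \<nu> (\<Inter>n. \<Union>j. A t n j) \<le> measure \<nu> (\<Union>j. A t n j)"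
        using Ab s by (intro n.finite_measure_mono) auto
      then have "t * measure \<nu> (\<Inter>n. \<Union>j. A t n j) \<le> t * measure \<nu> (\<Union>j. A t n j)" using t by simp
      then show ?thesis using b1[of n] by linarith
    qed
    have "(\<lambda>n. real N * measure \<kappa> (U n)) \<longlonglongrightarrow> real N * 0" by (intro tendsto_mult tendsto_const lim)
    then have "t * measure \<nu> (\<Inter>n. \<Union>j. A t n j) \<le> real N * 0" by (rule LIMSEQ_le_const) (use b2 in auto)
    then show ?thesis using t by (simp add: mult_le_0_iff measure_le_0_iff)
  qed
  have "AE y in \<nu>. \<forall>m. y \<notin> (\<Inter>n. \<Union>j. A (recip m) n j)"
  proof (subst AE_all_countable, rule allI, rule AE_not_in)
    fix m
    have "measure \<nu> (\<Inter>n. \<Union>j. A (recip m) n j) = 0" by (rule null) simp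
    then show "(\<Inter>n. \<Union>j. A (recip m) n j) \<in> null_sets \<nu>"
      using Ab s by (auto simp: null_sets_def n.emeasure_eq_measure)
  qed
  then show ?thesis
  proof (rule AE_mp, intro AE_I2 impI allI)
    fix y and t :: real assume y: "\<forall>m. y \<notin> (\<Inter>n. \<Union>j. A (recip m) n j)" "y \<in> F" "0 < t"
    obtain m where m: "recip m < t" using reals_Archimedean[OF \<open>0 < t\<close>] by (auto simp: inverse_eq_divide)
    obtain n where n: "\<And>j. y \<notin> A (recip m) n j" using y(1) by blast
    have "measure \<kappa> (ball y \<epsilon>) \<le> t * measure \<nu> (ball y \<epsilon>)" if e: "0 < \<epsilon>" "\<epsilon> < recip n" for \<epsilon>
    proof (rule ccontr)
      assume "\<not> ?thesis"
      then have less: "t * measure \<nu> (ball y \<epsilon>) < measure \<kappa> (ball y \<epsilon>)" by simp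
      then obtain r' where r': "r' < \<epsilon>" "t * measure \<nu> (ball y \<epsilon>) < measure \<kappa> (ball y r')"
        using measure_ball_gt_left[OF fm(2), of UNIV "t * measure \<nu> (ball y \<epsilon>)" y \<epsilon>] s(2) less by (auto simp: sets_restrict_UNIV)
      \<comment> \<open>Passing to a rational radius just below \<epsilon> does not increase the
        \<nu>-mass, and left continuity keeps the \<kappa>-mass above the bound. The
        \<open>max\<close> is there because \<open>r'\<close> may be negative.\<close>
      obtain r where r: "r \<in> \<rat>" "max r' 0 < r" "r < \<epsilon>"
        using Rats_dense_in_real[of "max r' 0" \<epsilon>] r' e by auto
      have "r \<in> range q" using r(1) rq by simp
      then obtain i where i: "q i = r" by auto
      have "recip m * measure \<nu> (ball y r) \<le> t * measure \<nu> (ball y \<epsilon>)"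
        using m r s \<open>0 < t\<close> by (intro mult_mono n.finite_measure_mono) auto
      also have "\<dots> < measure \<kappa> (ball y r')" by fact
      also have "\<dots> \<le> measure \<kappa> (ball y r)"
        using r s by (intro k.finite_measure_mono subset_ball) auto
      finally have "y \<in> A (recip m) n (Suc i)"
        using y(2) r e i by (auto simp: A_def R_def intro!: bexI[of _ r])
      then show False using n by blast
    qed
    then show "\<exists>\<rho>>0. \<forall>\<epsilon>. 0 < \<epsilon> \<longrightarrow> \<epsilon> < \<rho> \<longrightarrow> measure \<kappa> (ball y \<epsilon>) \<le> t * measure \<nu> (ball y \<epsilon>)"
      by (intro exI[of _ "recip n"]) auto
  qed
qed auto

section \<open>Predictability of injective observables\<close>

lemma restrict_borel_compact:
  fixes X :: "'a::t2_space set"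
  assumes "sets M = sets (restrict_space borel X)" "compact X"
  shows "space M = X" "B \<in> sets M \<longleftrightarrow> B \<in> sets borel \<and> B \<subseteq> X"
proof -
  show "space M = X" using assms(1)[THEN sets_eq_imp_space_eq] by (simp add: space_restrict_space)
  have "X \<in> sets borel" using assms(2) by (simp add: borel_closed compact_imp_closed)
  then show "B \<in> sets M \<longleftrightarrow> B \<in> sets borel \<and> B \<subseteq> X"
    unfolding assms(1) by (auto simp: sets_restrict_space_iff)
qed

text \<open>Inner regularity concerns Borel measures of the ambient space, so it is applied to the
  image of \<mu> under the inclusion of \<open>X\<close>.\<close>

lemma compact_inner_approx:
  fixes \<mu> :: "'a::euclidean_space measure"
  assumes "finite_measure \<mu>" "sets \<mu> = sets (restrict_space borel X)" "compact X" "A \<in> sets \<mu>" "0 < e"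
  obtains K where "compact K" "K \<subseteq> A" "measure \<mu> A < measure \<mu> K + e"
proof -
  interpret finite_measure \<mu> by fact
  note sp = restrict_borel_compact(1)[OF assms(2,3)] and setsb = restrict_borel_compact(2)[OF assms(2,3)]
  have id: "(\<lambda>x. x) \<in> \<mu> \<rightarrow>\<^sub>M borel"
    using assms(3) by (intro measurableI) (auto simp: sp setsb borel_closed compact_imp_closed)
  let ?N = "distr \<mu> borel (\<lambda>x. x)"
  have em: "emeasure ?N B = emeasure \<mu> B" if "B \<in> sets \<mu>" for B
    using that id by (subst emeasure_distr) (auto simp: sp setsb intro!: arg_cong[where f="emeasure \<mu>"])
  have "emeasure ?N A = (SUP K \<in> {K. K \<subseteq> A \<and> compact K}. emeasure ?N K)"
    using assms(4) id by (intro inner_regular) (auto simp: setsb emeasure_distr emeasure_eq_measure)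
  also have "\<dots> = (SUP K \<in> {K. K \<subseteq> A \<and> compact K}. emeasure \<mu> K)"
    using assms(4) by (intro SUP_cong refl em) (auto simp: setsb compact_imp_closed)
  finally have S: "emeasure \<mu> A = (SUP K \<in> {K. K \<subseteq> A \<and> compact K}. emeasure \<mu> K)"
    using em[OF assms(4)] by simp
  have "\<exists>K. K \<subseteq> A \<and> compact K \<and> measure \<mu> A < measure \<mu> K + e"
  proof (rule ccontr)
    assume no: "\<not> ?thesis"
    have "(SUP K \<in> {K. K \<subseteq> A \<and> compact K}. emeasure \<mu> K) \<le> ennreal (measure \<mu> A - e)"
      using no by (intro SUP_least) (auto simp: emeasure_eq_measure not_less intro!: ennreal_leI)
    then have le: "ennreal (measure \<mu> A) \<le> ennreal (measure \<mu> A - e)"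
      using S by (simp add: emeasure_eq_measure)
    \<comment> \<open>The empty set as a competitor shows \<open>e \<le> measure \<mu> A\<close>;
      otherwise \<open>ennreal\<close> would truncate the difference to 0 and the comparison would
      say nothing.\<close>
    have "\<not> measure \<mu> A < measure \<mu> {} + e"
      using no by (intro notI) (elim notE, intro exI[of _ "{}"], simp)
    then show False using le assms(5) by (simp add: ennreal_le_iff)
  qed
  then show ?thesis using that by blast
qed

text \<open>The complement of the support is a union of null sets taken from a countable
  basis.\<close>

lemma measure_support_restrict_borel:
  fixes M :: "'a::second_countable_topology measure"
  assumes "sets M = sets (restrict_space borel X)"
  shows "measure_support M \<in> sets M" "AE y in M. y \<in> measure_support M"
proof -
  have sp: "space M = X" using assms[THEN sets_eq_imp_space_eq] by (simp add: space_restrict_space)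
  obtain B :: "'a set set" where cB: "countable B" and tB: "topological_basis B"
    using ex_countable_basis by auto
  have oX: "U \<inter> X \<in> sets M" if "open U" for U
    unfolding assms sets_restrict_space using borel_open[OF that] by (subst Int_commute) (rule imageI)
  have B: "C \<in> B \<Longrightarrow> open C" for C using tB by (rule topological_basis_open)
  let ?B = "{C\<in>B. emeasure M (C \<inter> X) = 0}"
  have N: "(\<Union>C\<in>?B. C \<inter> X) \<in> null_sets M"
    using cB oX[OF B] by (intro null_sets_UN') (auto simp: null_sets_def)
  have eq: "measure_support M = space M - (\<Union>C\<in>?B. C \<inter> X)"
  proof (intro equalityI subsetI)
    fix y assume "y \<in> measure_support M"
    then have y: "y \<in> X" "\<And>U. open U \<Longrightarrow> y \<in> U \<Longrightarrow> 0 < emeasure M (U \<inter> X)"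
      by (auto simp: measure_support_def sp)
    have "y \<notin> C" if "C \<in> ?B" for C
      using that y(2)[of C] B[of C] by auto
    then show "y \<in> space M - (\<Union>C\<in>?B. C \<inter> X)" using y(1) sp by auto
  next
    fix y assume y: "y \<in> space M - (\<Union>C\<in>?B. C \<inter> X)"
    have "0 < emeasure M (U \<inter> space M)" if U: "open U" "y \<in> U" for U
    proof -
      obtain C where C: "C \<in> B" "y \<in> C" "C \<subseteq> U" by (rule topological_basisE[OF tB U])
      have "emeasure M (C \<inter> X) \<noteq> 0" using y C sp by auto
      moreover have "emeasure M (C \<inter> X) \<le> emeasure M (U \<inter> X)"
        using C(3) oX[OF U(1)] by (intro emeasure_mono) auto
      ultimately show ?thesis unfolding sp by (metis bot.extremum_uniqueI bot_ennreal not_gr_zero)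
    qed
    then show "y \<in> measure_support M" using y by (auto simp: measure_support_def)
  qed
  show "measure_support M \<in> sets M" unfolding eq using N by auto
  show "AE y in M. y \<in> measure_support M" unfolding eq
    using AE_not_in[OF N] by (auto intro: AE_mp)
qed

lemma set_integral_le_split:
  fixes h :: "'a \<Rightarrow> real"
  assumes "finite_measure M" "h \<in> borel_measurable M" "P \<in> sets M" "Q \<in> sets M"
    and "\<And>x. x \<in> P \<Longrightarrow> 0 \<le> h x" "\<And>x. x \<in> P \<Longrightarrow> h x \<le> b" "\<And>x. x \<in> P - Q \<Longrightarrow> h x \<le> a" "0 \<le> a" "0 \<le> b"
  shows "(LINT x:P|M. h x) \<le> a * measure M P + b * measure M (P \<inter> Q)"
proof -
  interpret finite_measure M by fact
  have i: "integrable M (\<lambda>x. indicator P x * h x)"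
    by (rule integrable_const_bound[where B=b])
      (use assms in \<open>auto simp: indicator_def intro!: AE_I2 borel_measurable_times\<close>)
  have "(LINT x:P|M. h x) = (\<integral>x. indicator P x * h x \<partial>M)"
    by (simp add: set_lebesgue_integral_def)
  also have "\<dots> \<le> (\<integral>x. a * indicator P x + b * indicator (P \<inter> Q) x \<partial>M)"
  proof (rule integral_mono[OF i])
    show "integrable M (\<lambda>x. a * indicator P x + b * indicator (P \<inter> Q) x)"
      using assms by (auto simp: integrable_indicator_iff emeasure_eq_measure intro!: Bochner_Integration.integrable_add)
    show "indicator P x * h x \<le> a * indicator P x + b * indicator (P \<inter> Q) x" for x
      using assms(6)[of x] assms(7)[of x] assms(8,9) by (cases "x \<in> P"; cases "x \<in> Q") auto
  qed
  also have "\<dots> = a * measure M P + b * measure M (P \<inter> Q)"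
  proof -
    have "integrable M (\<lambda>x. a * indicator P x)" "integrable M (\<lambda>x. b * indicator (P \<inter> Q) x)"
      using assms by (auto simp: integrable_indicator_iff emeasure_eq_measure)
    then have "(\<integral>x. a * indicator P x + b * indicator (P \<inter> Q) x \<partial>M)
      = (\<integral>x. a * indicator P x \<partial>M) + (\<integral>x. b * indicator (P \<inter> Q) x \<partial>M)"
      by (rule Bochner_Integration.integral_add)
    then show ?thesis using assms sets.sets_into_space[OF assms(3)] by (simp add: Int_absorb2 inf.absorb1 le_infI1)
  qed
  finally show ?thesis .
qed

text \<open>Only the fraction \<open>\<eta>\<close> of \<open>P\<close> lies in \<open>Q\<close>, where the crude bound \<open>B\<close> is used.\<close>

lemma pred_deviation_le:
  fixes \<phi> :: "'a \<Rightarrow> 'b::euclidean_space"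
  assumes fin: "finite_measure \<mu>" and f: "(\<lambda>x. \<phi> (T x)) \<in> borel_measurable \<mu>"
    and P: "P = \<phi> -` ball y \<epsilon> \<inter> space \<mu>" "P \<in> sets \<mu>" "0 < measure \<mu> P"
    and Q: "Q \<in> sets \<mu>" "measure \<mu> (P \<inter> Q) \<le> \<eta> * measure \<mu> P"
    and bd: "\<And>x. x \<in> P \<Longrightarrow> norm (\<phi> (T x)) \<le> B" "norm c \<le> B" "0 \<le> B"
    and close: "\<And>x. x \<in> P - Q \<Longrightarrow> norm (\<phi> (T x) - c) \<le> \<eta>" and \<eta>: "0 \<le> \<eta>"
  shows "pred_deviation \<mu> T \<phi> \<epsilon> y \<le> sqrt ((2 * \<eta> + 2 * B * \<eta>)\<^sup>2 + (3 * B + \<eta> + 2 * B * \<eta>)\<^sup>2 * \<eta>)"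
proof -
  interpret finite_measure \<mu> by fact
  let ?p = "measure \<mu> P"
  let ?f = "\<lambda>x. \<phi> (T x)"
  define m where "m = pred_mean \<mu> T \<phi> \<epsilon> y"
  have int: "integrable \<mu> (\<lambda>x. indicator P x *\<^sub>R (?f x - v))" for v
  proof (rule integrable_const_bound[where B="B + norm v"])
    show "AE x in \<mu>. norm (indicator P x *\<^sub>R (?f x - v)) \<le> B + norm v"
    proof (rule AE_I2)
      fix x
      show "norm (indicator P x *\<^sub>R (?f x - v)) \<le> B + norm v"
        using bd(1)[of x] bd(3) norm_triangle_ineq4[of "?f x" v] by (cases "x \<in> P") auto
    qed
    show "(\<lambda>x. indicator P x *\<^sub>R (?f x - v)) \<in> borel_measurable \<mu>"
      using f P(2) by measurable
  qed
  \<comment> \<open>The mean differs from \<open>c\<close> by the average of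
    \<open>\<phi> (T x) - c\<close>, so it inherits closeness to \<open>c\<close> from most of
    \<open>P\<close>.\<close>
  have "m - c = (1 / ?p) *\<^sub>R (LINT x:P|\<mu>. ?f x - c)"
  proof -
    have "(LINT x:P|\<mu>. ?f x - c) = (\<integral>x. indicator P x *\<^sub>R ?f x - indicator P x *\<^sub>R c \<partial>\<mu>)"
      by (simp add: set_lebesgue_integral_def scaleR_diff_right)
    also have "\<dots> = (\<integral>x. indicator P x *\<^sub>R ?f x \<partial>\<mu>) - (\<integral>x. indicator P x *\<^sub>R c \<partial>\<mu>)"
      using int[of 0] P by (intro Bochner_Integration.integral_diff) (auto simp: integrable_indicator_iff emeasure_eq_measure)
    also have "(\<integral>x. indicator P x *\<^sub>R c \<partial>\<mu>) = ?p *\<^sub>R c"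
      using P sets.sets_into_space[OF P(2)]
      by (subst integral_scaleR_left) (auto simp: integrable_indicator_iff emeasure_eq_measure Int_absorb2)
    finally show ?thesis
      using P(3) by (simp add: m_def pred_mean_def Let_def P(1)[symmetric] set_lebesgue_integral_def scaleR_diff_right)
  qed
  then have "norm (m - c) \<le> (1 / ?p) * (LINT x:P|\<mu>. norm (?f x - c))"
    using integral_norm_bound[of \<mu> "\<lambda>x. indicator P x *\<^sub>R (?f x - c)"] P(3)
    by (auto simp: set_lebesgue_integral_def intro!: divide_right_mono)
  also have "\<dots> \<le> (1 / ?p) * (\<eta> * ?p + 2 * B * (\<eta> * ?p))"
  proof (rule mult_left_mono)
    have "(LINT x:P|\<mu>. norm (?f x - c)) \<le> \<eta> * ?p + 2 * B * measure \<mu> (P \<inter> Q)"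
    proof (rule set_integral_le_split[OF fin])
      show "norm (?f x - c) \<le> 2 * B" if "x \<in> P" for x
        using bd(1)[OF that] bd(2) norm_triangle_ineq4[of "?f x" c] by simp
    qed (use f P Q close \<eta> bd(3) in auto)
    also have "\<dots> \<le> \<eta> * ?p + 2 * B * (\<eta> * ?p)" using Q bd(3) by (intro add_mono mult_left_mono order_refl) auto
    finally show "(LINT x:P|\<mu>. norm (?f x - c)) \<le> \<eta> * ?p + 2 * B * (\<eta> * ?p)" .
  qed simp
  also have "\<dots> = \<eta> + 2 * B * \<eta>" using P(3) by (simp add: field_simps)
  finally have mc: "norm (m - c) \<le> \<eta> + 2 * B * \<eta>" .
  \<comment> \<open>The distance to the mean is at most the distance to \<open>c\<close> plus
    \<open>\<eta> + 2 * B * \<eta>\<close>. The former is at most \<eta> off \<open>Q\<close>; on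
    all of \<open>P\<close> it is at most \<open>2 * B\<close>, which is enlarged to
    \<open>3 * B\<close>.\<close>
  have d1: "norm (?f x - m) \<le> 2 * \<eta> + 2 * B * \<eta>" if "x \<in> P - Q" for x
    using close[OF that] mc norm_triangle_ineq4[of "?f x - c" "m - c"] by simp
  have d2: "norm (?f x - m) \<le> 3 * B + \<eta> + 2 * B * \<eta>" if "x \<in> P" for x
    using bd(1)[OF that] bd(2,3) mc norm_triangle_ineq4[of "?f x - c" "m - c"] norm_triangle_ineq4[of "?f x" c] by simp
  have "(LINT x:P|\<mu>. (norm (?f x - m))\<^sup>2) \<le> (2 * \<eta> + 2 * B * \<eta>)\<^sup>2 * ?p + (3 * B + \<eta> + 2 * B * \<eta>)\<^sup>2 * measure \<mu> (P \<inter> Q)"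
    by (rule set_integral_le_split[OF fin])
      (use f P Q d1 d2 \<eta> bd(3) in \<open>auto intro!: power_mono\<close>)
  also have "\<dots> \<le> (2 * \<eta> + 2 * B * \<eta>)\<^sup>2 * ?p + (3 * B + \<eta> + 2 * B * \<eta>)\<^sup>2 * (\<eta> * ?p)"
    using Q by (intro add_mono mult_left_mono) auto
  finally have "(1 / ?p) * (LINT x:P|\<mu>. (norm (?f x - m))\<^sup>2) \<le> (2 * \<eta> + 2 * B * \<eta>)\<^sup>2 + (3 * B + \<eta> + 2 * B * \<eta>)\<^sup>2 * \<eta>"
    using P(3) by (simp add: field_simps)
  then show ?thesis
    unfolding pred_deviation_def Let_def P(1)[symmetric] m_def by (rule real_sqrt_le_mono)
qed

text \<open>At \<open>y = \<phi> x0\<close> with \<open>x0 \<in> K n\<close> the expected value is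
  \<open>\<phi> (T x0)\<close>. On the part of the preimage of a small ball that lies in
  \<open>K n\<close>, continuity of the inverse keeps \<open>\<phi> (T x)\<close> near this value;
  the other part has small relative mass, and boundedness of \<phi> is enough there.\<close>

lemma AE_predictable_if_injective:
  fixes \<phi> :: "'a::euclidean_space \<Rightarrow> 'b::euclidean_space"
  assumes X: "compact X" and pr: "prob_space \<mu>" and sets: "sets \<mu> = sets (restrict_space borel X)"
    and T: "continuous_on X T" "T ` X \<subseteq> X" and \<phi>: "continuous_on X \<phi>"
    and A: "A \<in> sets \<mu>" "measure \<mu> A = 1" "inj_on \<phi> A"
  shows "AE y in distr \<mu> borel \<phi>. predictable \<mu> T \<phi> y"
proof -
  interpret prob_space \<mu> by fact
  have fin: "finite_measure \<mu>" by unfold_locales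
  note sp = restrict_borel_compact(1)[OF sets X] and setsb = restrict_borel_compact(2)[OF sets X]
  have \<phi>m[measurable]: "\<phi> \<in> borel_measurable \<mu>"
    using borel_measurable_continuous_on_restrict[OF \<phi>] measurable_cong_sets[OF sets refl] by blast
  have fc: "continuous_on X (\<lambda>x. \<phi> (T x))" by (rule continuous_on_compose2[OF \<phi> T])
  have fm: "(\<lambda>x. \<phi> (T x)) \<in> borel_measurable \<mu>"
    using borel_measurable_continuous_on_restrict[OF fc] measurable_cong_sets[OF sets refl] by blast
  define \<nu> where "\<nu> = distr \<mu> borel \<phi>"
  have s\<nu>: "sets \<nu> = sets borel" by (simp add: \<nu>_def)
  have f\<nu>: "finite_measure \<nu>" unfolding \<nu>_def by (rule finite_measure_distr) measurable
  have m\<nu>: "measure \<nu> E = measure \<mu> (\<phi> -` E \<inter> X)" if "E \<in> sets borel" for E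
    unfolding \<nu>_def using that by (subst measure_distr) (auto simp: sp)
  obtain B0 where "\<And>x. x \<in> X \<Longrightarrow> norm (\<phi> x) \<le> B0"
    using compact_imp_bounded[OF compact_continuous_image[OF \<phi> X]] unfolding bounded_iff by auto
  then obtain B where B: "\<And>x. x \<in> X \<Longrightarrow> norm (\<phi> x) \<le> B" "0 \<le> B"
    by (meson max.cobounded1 max.cobounded2 order.trans that)
  have "\<exists>K. compact K \<and> K \<subseteq> A \<and> 1 < measure \<mu> K + recip n" for n
    using compact_inner_approx[OF fin sets X A(1), of "recip n"] A(2) by auto
  then obtain K where K: "\<And>n. compact (K n)" "\<And>n. K n \<subseteq> A" "\<And>n. 1 < measure \<mu> (K n) + recip n"
    by metis
  have KX: "K n \<subseteq> X" for n using K(2) A(1) setsb by blast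
  have Km: "K n \<in> sets \<mu>" for n using K(1) KX setsb by (simp add: borel_closed compact_imp_closed)
  have \<phi>K: "compact (\<phi> ` K n)" for n
    using \<phi> K(1) KX continuous_on_subset by (blast intro: compact_continuous_image)
  \<comment> \<open>The image of the part of \<mu> outside \<open>K n\<close>: its value on a ball
    is the mass of the uncontrolled part of the preimage.\<close>
  define \<kappa> where "\<kappa> n = distr (density \<mu> (indicator (X - K n))) borel \<phi>" for n
  have s\<kappa>: "sets (\<kappa> n) = sets borel" for n by (simp add: \<kappa>_def)
  have e\<kappa>: "emeasure (\<kappa> n) E = emeasure \<mu> ((\<phi> -` E \<inter> X) \<inter> (X - K n))" if "E \<in> sets borel" for n E
  proof -
    have "\<phi> \<in> measurable (density \<mu> (indicator (X - K n))) borel" by simp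
    moreover have "\<phi> -` E \<inter> X \<in> sets \<mu>" using measurable_sets[OF \<phi>m that] by (simp add: sp)
    moreover have "X - K n \<in> sets \<mu>" using Km sp by (metis sets.compl_sets)
    ultimately show ?thesis
      unfolding \<kappa>_def using that by (simp add: emeasure_distr emeasure_restricted sp Int_commute)
  qed
  have f\<kappa>: "finite_measure (\<kappa> n)" for n
  proof (rule finite_measureI)
    have "space (\<kappa> n) = UNIV" by (simp add: \<kappa>_def)
    then show "emeasure (\<kappa> n) (space (\<kappa> n)) \<noteq> \<infinity>"
      using e\<kappa>[of UNIV n] by (simp add: emeasure_eq_measure)
  qed
  have m\<kappa>: "measure (\<kappa> n) E = measure \<mu> ((\<phi> -` E \<inter> X) \<inter> (X - K n))" if "E \<in> sets borel" for n E
    using e\<kappa>[OF that] by (simp add: measure_def)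
  have k0: "measure (\<kappa> n) (\<phi> ` K n) = 0" for n
  proof -
    have "\<phi> -` (\<phi> ` K n) \<inter> X \<inter> (X - K n) \<subseteq> X - A"
      using K(2) A(3) by (auto simp: inj_on_def)
    moreover have "X - A \<in> sets \<mu>" using A(1) sp by (metis sets.compl_sets)
    moreover have "measure \<mu> (X - A) = 0" using prob_compl[OF A(1)] A(2) sp by simp
    ultimately have "measure \<mu> (\<phi> -` (\<phi> ` K n) \<inter> X \<inter> (X - K n)) \<le> 0"
      using finite_measure_mono by metis
    then show ?thesis
      using m\<kappa>[OF borel_closed[OF compact_imp_closed[OF \<phi>K]]] by (simp add: measure_le_0_iff)
  qed
  have dens: "AE y in \<nu>. \<forall>n. y \<in> \<phi> ` K n \<longrightarrow>
    (\<forall>t>0. \<exists>\<rho>>0. \<forall>\<epsilon>. 0 < \<epsilon> \<longrightarrow> \<epsilon> < \<rho> \<longrightarrow> measure (\<kappa> n) (ball y \<epsilon>) \<le> t * measure \<nu> (ball y \<epsilon>))"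
    unfolding AE_all_countable using relative_density_zero[OF s\<nu> s\<kappa> f\<nu> f\<kappa> \<phi>K k0] by blast
  have cov: "AE y in \<nu>. \<exists>n. y \<in> \<phi> ` K n"
  proof -
    interpret n: prob_space \<nu> unfolding \<nu>_def by (rule prob_space_distr) measurable
    have U: "(\<Union>n. \<phi> ` K n) \<in> sets \<nu>" using \<phi>K by (auto simp: s\<nu> intro: borel_closed compact_imp_closed)
    have "1 - recip n \<le> n.prob (\<Union>n. \<phi> ` K n)" for n
    proof -
      have "1 - recip n \<le> measure \<mu> (K n)" using K(3)[of n] by linarith
      also have "\<dots> \<le> measure \<mu> (\<phi> -` (\<Union>n. \<phi> ` K n) \<inter> X)"
        using U KX measurable_sets[OF \<phi>m, of "\<Union>n. \<phi> ` K n"]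
        by (intro finite_measure_mono) (auto simp: s\<nu> sp)
      also have "\<dots> = n.prob (\<Union>n. \<phi> ` K n)" using U by (simp add: m\<nu> s\<nu>)
      finally show ?thesis .
    qed
    moreover have "(\<lambda>n. 1 - recip n) \<longlonglongrightarrow> 1 - 0"
      by (intro tendsto_diff tendsto_const lim_1_over_n[THEN LIMSEQ_Suc])
    ultimately have "1 - 0 \<le> n.prob (\<Union>n. \<phi> ` K n)" by (intro LIMSEQ_le_const2[of "\<lambda>n. 1 - recip n"]) auto
    then have "n.prob (\<Union>n. \<phi> ` K n) = 1" using n.prob_le_1 by (simp add: order.antisym)
    then have "AE y in \<nu>. y \<in> (\<Union>n. \<phi> ` K n)" using n.prob_eq_1[OF U] by simp
    then show ?thesis by simp
  qed
  have pred: "predictable \<mu> T \<phi> y"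
    if y: "y \<in> \<phi> ` K n" and ysup: "y \<in> measure_support \<nu>"
      and d: "\<forall>t>0. \<exists>\<rho>>0. \<forall>\<epsilon>. 0 < \<epsilon> \<longrightarrow> \<epsilon> < \<rho> \<longrightarrow> measure (\<kappa> n) (ball y \<epsilon>) \<le> t * measure \<nu> (ball y \<epsilon>)"
    for y n
  proof -
    have inj: "inj_on \<phi> (K n)" using A(3) K(2) inj_on_subset by blast
    have \<phi>Kc: "continuous_on (K n) \<phi>" using \<phi> KX continuous_on_subset by blast
    obtain x0 where x0: "x0 \<in> K n" "y = \<phi> x0" using y by blast
    let ?c = "\<phi> (T x0)"
    have "continuous_on (\<phi> ` K n) (the_inv_into (K n) \<phi>)"
      by (rule continuous_on_inv_into[OF \<phi>Kc K(1) inj])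
    then have Gc: "continuous_on (\<phi> ` K n) (\<lambda>w. \<phi> (T (the_inv_into (K n) \<phi> w)))"
      using KX by (intro continuous_on_compose2[OF fc]) (use KX[of n] the_inv_into_into[OF inj _ order_refl] in blast)+
    have pos: "0 < measure \<mu> (\<phi> -` ball y \<epsilon> \<inter> X)" if "0 < \<epsilon>" for \<epsilon>
    proof -
      interpret n: finite_measure \<nu> by (rule f\<nu>)
      have "space \<nu> = UNIV" by (simp add: \<nu>_def)
      then have "0 < emeasure \<nu> (ball y \<epsilon>)" using ysup that unfolding measure_support_def by auto
      then show ?thesis using m\<nu>[of "ball y \<epsilon>"] by (simp add: n.emeasure_eq_measure)
    qed
    \<comment> \<open>The bound of \<open>pred_deviation_le\<close>, which tends to 0 with \<eta>
      because \<open>B\<close> is fixed.\<close>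
    define b where "b \<eta> = sqrt ((2 * \<eta> + 2 * B * \<eta>)\<^sup>2 + (3 * B + \<eta> + 2 * B * \<eta>)\<^sup>2 * \<eta>)" for \<eta>
    have ev: "eventually (\<lambda>\<epsilon>. pred_deviation \<mu> T \<phi> \<epsilon> y \<le> b \<eta>) (at_right 0)" if \<eta>: "0 < \<eta>" for \<eta>
    proof -
      obtain \<rho> where \<rho>: "0 < \<rho>" "\<And>\<epsilon>. 0 < \<epsilon> \<Longrightarrow> \<epsilon> < \<rho> \<Longrightarrow> measure (\<kappa> n) (ball y \<epsilon>) \<le> \<eta> * measure \<nu> (ball y \<epsilon>)"
        using d \<eta> by blast
      obtain \<rho>' where \<rho>': "0 < \<rho>'" "\<And>w. w \<in> \<phi> ` K n \<Longrightarrow> dist w y < \<rho>' \<Longrightarrow>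
          dist (\<phi> (T (the_inv_into (K n) \<phi> w))) (\<phi> (T (the_inv_into (K n) \<phi> y))) < \<eta>"
        using Gc y \<eta> unfolding continuous_on_iff by blast
      have "pred_deviation \<mu> T \<phi> \<epsilon> y \<le> b \<eta>" if e: "0 < \<epsilon>" "\<epsilon> < min \<rho> \<rho>'" for \<epsilon>
        unfolding b_def
      proof (rule pred_deviation_le[where P="\<phi> -` ball y \<epsilon> \<inter> X" and Q="X - K n" and c="?c"])
        show "\<phi> -` ball y \<epsilon> \<inter> X \<in> sets \<mu>" using measurable_sets[OF \<phi>m, of "ball y \<epsilon>"] by (simp add: sp)
        show "X - K n \<in> sets \<mu>" using Km sp by (metis sets.compl_sets)
        show "measure \<mu> (\<phi> -` ball y \<epsilon> \<inter> X \<inter> (X - K n)) \<le> \<eta> * measure \<mu> (\<phi> -` ball y \<epsilon> \<inter> X)"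
          using \<rho>(2)[of \<epsilon>] e by (simp add: m\<kappa> m\<nu>)
        show "norm (\<phi> (T x) - ?c) \<le> \<eta>" if x: "x \<in> \<phi> -` ball y \<epsilon> \<inter> X - (X - K n)" for x
        proof -
          have "dist (\<phi> (T (the_inv_into (K n) \<phi> (\<phi> x)))) (\<phi> (T (the_inv_into (K n) \<phi> y))) < \<eta>"
            using x e by (intro \<rho>'(2)) (auto simp: dist_commute)
          then show ?thesis using x x0 inj by (auto simp: dist_norm the_inv_into_f_f)
        qed
        have "x0 \<in> X" using x0(1) KX by blast
        then show "norm ?c \<le> B" using T(2) B(1) by auto
        show "norm (\<phi> (T x)) \<le> B" if "x \<in> \<phi> -` ball y \<epsilon> \<inter> X" for x
          using that T(2) B(1) by auto
        show "0 < measure \<mu> (\<phi> -` ball y \<epsilon> \<inter> X)" using pos e(1) .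
      qed (use fin fm sp B(2) \<eta> in auto)
      then show ?thesis unfolding eventually_at_right_field
        using \<rho>(1) \<rho>'(1) by (intro exI[of _ "min \<rho> \<rho>'"]) auto
    qed
    have blim: "(b \<longlongrightarrow> 0) (at_right 0)"
    proof -
      have "(b \<longlongrightarrow> sqrt ((2 * 0 + 2 * B * 0)\<^sup>2 + (3 * B + 0 + 2 * B * 0)\<^sup>2 * 0)) (at_right 0)"
        unfolding b_def by (intro tendsto_intros)
      then show ?thesis by simp
    qed
    have "((\<lambda>\<epsilon>. pred_deviation \<mu> T \<phi> \<epsilon> y) \<longlongrightarrow> 0) (at_right 0)"
    proof (rule order_tendstoI)
      fix a :: real assume "a < 0"
      moreover have "0 \<le> pred_deviation \<mu> T \<phi> \<epsilon> y" for \<epsilon>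
        unfolding pred_deviation_def Let_def set_lebesgue_integral_def
        by (intro real_sqrt_ge_zero mult_nonneg_nonneg integral_nonneg_AE) auto
      ultimately show "eventually (\<lambda>\<epsilon>. a < pred_deviation \<mu> T \<phi> \<epsilon> y) (at_right 0)"
        by (intro always_eventually allI) (rule less_le_trans)
    next
      fix a :: real assume "0 < a"
      then have "eventually (\<lambda>\<eta>. b \<eta> < a \<and> 0 < \<eta>) (at_right 0)"
        using order_tendstoD(2)[OF blim] eventually_at_right_less[of 0] by (auto intro: eventually_conj)
      then obtain \<eta> where "b \<eta> < a" "0 < \<eta>"
        by (metis (mono_tags, lifting) eventually_happens trivial_limit_at_right_real)
      then show "eventually (\<lambda>\<epsilon>. pred_deviation \<mu> T \<phi> \<epsilon> y < a) (at_right 0)"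
        using ev[of \<eta>] by (auto elim!: eventually_mono)
    qed
    then show ?thesis using ysup by (simp add: predictable_def \<nu>_def)
  qed
  have "AE y in \<nu>. predictable \<mu> T \<phi> y"
    using dens cov measure_support_restrict_borel(2)[of \<nu> UNIV, unfolded sets_restrict_UNIV, OF s\<nu>] by eventually_elim (use pred in blast)
  then show ?thesis unfolding \<nu>_def .
qed

section \<open>Local dimension of ergodic measures\<close>

text \<open>\<open>X\<close> is not convex, so the mean value inequality is applied to a local
  extension on a closed ball of the ambient space, where the partial derivatives are bounded by
  compactness. Compactness of \<open>X\<close> turns the local constants into a global one.\<close>

lemma Cr_map_lipschitz:
  fixes f :: "'a::euclidean_space \<Rightarrow> 'b::real_normed_vector"
  assumes "compact X" "1 \<le> r" "Cr_map r X f"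
  shows "\<exists>L. lipschitz_on L X f"
proof -
  have loc: "\<exists>u>0. \<exists>L. lipschitz_on L (cball x u \<inter> X) f" if "x \<in> X" for x
  proof -
    obtain U F where U: "open U" "x \<in> U" "Cr_on r U F" "\<And>y. y \<in> U \<inter> X \<Longrightarrow> F y = f y"
    proof -
      have "\<exists>U F. open U \<and> x \<in> U \<and> Cr_on r U F \<and> (\<forall>y\<in>U \<inter> X. F y = f y)"
        using assms(3) \<open>x \<in> X\<close> by (simp add: Cr_map_def)
      then show ?thesis using that by (elim exE conjE) simp
    qed
    have "Ck_on (Suc 0) U F"
      using U(3) assms(2) unfolding Cr_on_def by (auto simp: one_enat_def)
    then have F: "\<And>y. y \<in> U \<Longrightarrow> F differentiable (at y)"
      "\<And>v. continuous_on U (\<lambda>y. frechet_derivative F (at y) v)" by auto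
    obtain u where u: "0 < u" "cball x u \<subseteq> U" using U(1,2) open_contains_cball by blast
    have "\<exists>C. \<forall>y\<in>cball x u. norm (frechet_derivative F (at y) b) \<le> C" for b
    proof -
      have "compact ((\<lambda>y. frechet_derivative F (at y) b) ` cball x u)"
        using continuous_on_subset[OF F(2) u(2)] by (intro compact_continuous_image) auto
      from compact_imp_bounded[OF this] show ?thesis by (simp add: bounded_iff)
    qed
    then obtain C where C: "\<And>b y. y \<in> cball x u \<Longrightarrow> norm (frechet_derivative F (at y) b) \<le> C b"
      by metis
    define L where "L = (\<Sum>b\<in>Basis. C b)"
    have on: "onorm (frechet_derivative F (at y)) \<le> L" if "y \<in> cball x u" for y
    proof -
      have "bounded_linear (frechet_derivative F (at y))"
        using F(1)[of y] u(2) that frechet_derivative_works has_derivative_bounded_linear by blast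
      then have "onorm (frechet_derivative F (at y)) \<le> (\<Sum>b\<in>Basis. norm (frechet_derivative F (at y) b))"
        by (rule onorm_componentwise)
      also have "\<dots> \<le> L" unfolding L_def using C[OF that] by (intro sum_mono)
      finally show ?thesis .
    qed
    have "lipschitz_on \<bar>L\<bar> (cball x u \<inter> X) f"
    proof (rule lipschitz_onI)
      fix y z assume yz: "y \<in> cball x u \<inter> X" "z \<in> cball x u \<inter> X"
      have "norm (F y - F z) \<le> L * norm (y - z)"
      proof (rule differentiable_bound[of "cball x u" F "\<lambda>y. frechet_derivative F (at y)"])
        show "(F has_derivative frechet_derivative F (at w)) (at w within cball x u)" if "w \<in> cball x u" for w
          using F(1)[of w] u(2) that frechet_derivative_works has_derivative_at_withinI by blast
      qed (use yz on in auto)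
      also have "\<dots> \<le> \<bar>L\<bar> * norm (y - z)" by (intro mult_right_mono) auto
      finally show "dist (f y) (f z) \<le> \<bar>L\<bar> * dist y z"
        using yz u(2) U(4) by (simp add: dist_norm subset_eq)
    qed auto
    then show ?thesis using u(1) by blast
  qed
  \<comment> \<open>\<open>local_lipschitz\<close> is about time-dependent maps; \<open>f\<close>
    enters as a constant family over the single time 0.\<close>
  have "local_lipschitz {0::real} X (\<lambda>_. f)"
    unfolding local_lipschitz_def
  proof (intro ballI)
    fix x and t :: real assume "x \<in> X" "t \<in> {0}"
    then obtain u L where "0 < u" "lipschitz_on L (cball x u \<inter> X) f" using loc by blast
    then show "\<exists>u>0. \<exists>L. \<forall>t\<in>cball t u \<inter> {0}. lipschitz_on L (cball x u \<inter> X) f" by blast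
  qed
  then obtain L where "\<And>t. t \<in> {0::real} \<Longrightarrow> lipschitz_on L X f"
    using local_lipschitz_compact_implies_lipschitz[where X=X and T="{0::real}" and f="\<lambda>_. f"] assms(1) by auto
  then show ?thesis by auto
qed

section \<open>Iterates of the map and forward invariant sets\<close>

lemma funpow_image_subset: "T ` X \<subseteq> X \<Longrightarrow> (T ^^ n) ` X \<subseteq> X"
  by (induction n) auto

lemma funpow_in: "T ` X \<subseteq> X \<Longrightarrow> x \<in> X \<Longrightarrow> (T ^^ n) x \<in> X"
  using funpow_image_subset[of T X n] by blast

lemma inj_on_funpow:
  assumes "inj_on T X" "T ` X \<subseteq> X"
  shows "inj_on (T ^^ n) X"
proof (induction n)
  case (Suc n)
  have "inj_on T ((T ^^ n) ` X)" by (rule inj_on_subset[OF assms(1) funpow_image_subset[OF assms(2)]])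
  with Suc show ?case unfolding funpow.simps by (rule comp_inj_on)
qed simp

lemma lipschitz_on_funpow:
  assumes "lipschitz_on L X T" "T ` X \<subseteq> X"
  shows "\<exists>M. lipschitz_on M X (T ^^ n)"
proof (induction n)
  case 0
  show ?case using lipschitz_on_id[of X] by (auto simp: id_def)
next
  case (Suc n)
  then obtain M where M: "lipschitz_on M X (T ^^ n)" ..
  have "lipschitz_on L ((T ^^ n) ` X) T"
    by (rule lipschitz_on_subset[OF assms(1) funpow_image_subset[OF assms(2)]])
  then have "lipschitz_on (L * M) X (T \<circ> (T ^^ n))" using M by (intro lipschitz_on_compose)
  then show ?case by auto
qed

locale ergodic_system = prob_space \<mu> for \<mu> :: "'a::euclidean_space measure" +
  fixes X :: "'a set" and T :: "'a \<Rightarrow> 'a" and L :: real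
  assumes cX: "compact X" and sets_mu: "sets \<mu> = sets (restrict_space borel X)"
    and invT: "invariant_measure T \<mu>" and erg: "ergodic_measure T \<mu>"
    and injT: "inj_on T X" and TX: "T ` X \<subseteq> X" and LT: "lipschitz_on L X T"
begin

lemmas space_mu = restrict_borel_compact(1)[OF sets_mu cX]
  and sets_mu_iff = restrict_borel_compact(2)[OF sets_mu cX]

lemma fin: "finite_measure \<mu>" by unfold_locales

lemma open_Int_sets: "open U \<Longrightarrow> U \<inter> X \<in> sets \<mu>"
  unfolding sets_mu sets_restrict_space by (subst Int_commute) (intro imageI borel_open)

lemma borel_Int_sets: "U \<in> sets borel \<Longrightarrow> X \<inter> U \<in> sets \<mu>"
  unfolding sets_mu sets_restrict_space by (rule imageI)

lemma measurable_funpow: "T ^^ n \<in> \<mu> \<rightarrow>\<^sub>M \<mu>"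
  using invT unfolding invariant_measure_def by (induction n) (auto intro: measurable_comp)

lemma continuous_on_funpow: "continuous_on X (T ^^ n)"
  using lipschitz_on_funpow[OF LT TX] lipschitz_on_continuous_on by blast

lemma measure_vimage_Tn:
  assumes "A \<in> sets \<mu>"
  shows "prob ((T ^^ n) -` A \<inter> X) = prob A"
proof (induction n)
  case 0
  then show ?case using assms sets.sets_into_space[OF assms] space_mu by (simp add: Int_absorb2)
next
  case (Suc n)
  have m: "T \<in> \<mu> \<rightarrow>\<^sub>M \<mu>" "distr \<mu> \<mu> T = \<mu>" using invT by (auto simp: invariant_measure_def)
  let ?B = "(T ^^ n) -` A \<inter> X"
  have B: "?B \<in> sets \<mu>" using measurable_sets[OF measurable_funpow assms] space_mu by simp
  have "prob ?B = measure (distr \<mu> \<mu> T) ?B" by (simp add: m)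
  also have "\<dots> = prob (T -` ?B \<inter> X)" using m(1) B by (subst measure_distr) (auto simp: space_mu)
  also have "T -` ?B \<inter> X = (T ^^ Suc n) -` A \<inter> X" using TX by (auto simp: funpow_swap1)
  finally show ?case using Suc by (simp only:)
qed

text \<open>The union of the preimages of a forward invariant set is fully invariant and, the preimages being
  increasing of equal measure, has the same measure.\<close>

lemma forward_invariant_full:
  assumes "A \<in> sets \<mu>" "\<And>x. x \<in> A \<Longrightarrow> T x \<in> A" "0 < prob A"
  shows "prob A = 1"
proof -
  let ?B = "\<lambda>n. (T ^^ n) -` A \<inter> X"
  have B: "?B n \<in> sets \<mu>" for n using measurable_sets[OF measurable_funpow assms(1)] space_mu by simp
  have mono: "?B n \<subseteq> ?B (Suc n)" for n using assms(2) by auto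
  have "(\<lambda>n. prob (?B n)) \<longlonglongrightarrow> prob (\<Union>n. ?B n)"
    using B by (intro finite_Lim_measure_incseq incseq_SucI mono) (simp only: image_subset_iff, blast)
  then have eq: "prob (\<Union>n. ?B n) = prob A"
    using measure_vimage_Tn[OF assms(1)] LIMSEQ_unique[OF _ tendsto_const] by auto
  \<comment> \<open>\<open>ergodic_measure\<close> speaks of exactly invariant sets, so it is
    applied to the union instead of \<open>A\<close>.\<close>
  have "T -` (\<Union>n. ?B n) \<inter> space \<mu> = (\<Union>n. ?B n)"
  proof (intro equalityI subsetI)
    fix x assume "x \<in> T -` (\<Union>n. ?B n) \<inter> space \<mu>"
    then obtain n where "x \<in> X" "(T ^^ n) (T x) \<in> A" using space_mu by auto
    then have "x \<in> ?B (Suc n)" by (simp add: funpow_swap1)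
    then show "x \<in> (\<Union>n. ?B n)" by blast
  next
    fix x assume "x \<in> (\<Union>n. ?B n)"
    then obtain n where "x \<in> ?B n" by blast
    then have "x \<in> X" "(T ^^ Suc n) x \<in> A" using mono[of n] by auto
    moreover have "T x \<in> X" using \<open>x \<in> X\<close> TX by auto
    ultimately have "T x \<in> ?B n" by (simp add: funpow_swap1)
    then show "x \<in> T -` (\<Union>n. ?B n) \<inter> space \<mu>" using \<open>x \<in> X\<close> space_mu by blast
  qed
  moreover have "(\<Union>n. ?B n) \<in> sets \<mu>" using B by (intro sets.countable_UN) auto
  ultimately have "prob (\<Union>n. ?B n) = 0 \<or> prob (\<Union>n. ?B n) = 1"
    using erg unfolding ergodic_measure_def by blast
  then show ?thesis using assms(3) eq by auto
qed

text \<open>Points of lower local dimension at most \<open>s\<close> in quantitative form: heavy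
  balls occur along some sequence of scales. The constant \<open>c\<close> is explicit because
  \<open>T\<close> worsens it by a factor; the union over all \<open>recip n\<close> absorbs that
  loss and is forward invariant.\<close>

definition low_dim :: "real \<Rightarrow> real \<Rightarrow> 'a set" where
  "low_dim s c = {x\<in>X. \<forall>\<delta>>0. \<exists>\<epsilon>. 0 < \<epsilon> \<and> \<epsilon> < \<delta> \<and> c * \<epsilon> powr s < prob (ball x \<epsilon> \<inter> X)}"

abbreviation low_dim_all :: "real \<Rightarrow> 'a set" where
  "low_dim_all s \<equiv> (\<Union>n. low_dim s (recip n))"

text \<open>The radii form an uncountable index set, but each condition is open in the centre, so
  their union is open; only the threshold \<delta> is made discrete.\<close>

lemma sets_low_dim: "low_dim s c \<in> sets \<mu>"
proof -
  let ?U = "\<lambda>n. \<Union>\<epsilon>\<in>{0<..<recip n}. {x. c * \<epsilon> powr s < prob (ball x \<epsilon> \<inter> X)}"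
  have "low_dim s c = X \<inter> (\<Inter>n. ?U n)"
  proof (intro equalityI subsetI)
    fix x assume x: "x \<in> X \<inter> (\<Inter>n. ?U n)"
    show "x \<in> low_dim s c" unfolding low_dim_def
    proof (intro CollectI conjI allI impI)
      show "x \<in> X" using x by auto
      fix \<delta> :: real assume "0 < \<delta>"
      then obtain n where n: "recip n < \<delta>" using reals_Archimedean by (auto simp: inverse_eq_divide)
      have "x \<in> ?U n" using x by blast
      then show "\<exists>\<epsilon>. 0 < \<epsilon> \<and> \<epsilon> < \<delta> \<and> c * \<epsilon> powr s < prob (ball x \<epsilon> \<inter> X)"
        using n by (auto intro: order.strict_trans)
    qed
  next
    fix x assume x: "x \<in> low_dim s c"
    have "x \<in> ?U n" for n
    proof -
      have "0 < recip n" by simp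
      then obtain \<epsilon> where "0 < \<epsilon>" "\<epsilon> < recip n" "c * \<epsilon> powr s < prob (ball x \<epsilon> \<inter> X)"
        using x unfolding low_dim_def by blast
      then show ?thesis by auto
    qed
    then show "x \<in> X \<inter> (\<Inter>n. ?U n)" using x by (auto simp: low_dim_def)
  qed
  moreover have "open (?U n)" for n using open_measure_ball_gt[OF fin sets_mu] by auto
  then have "(\<Inter>n. ?U n) \<in> sets borel"
    by (intro sets.countable_INT'' borel_open) auto
  ultimately show ?thesis by (simp only: borel_Int_sets)
qed

lemma low_dim_mono: "c' \<le> c \<Longrightarrow> low_dim s c \<subseteq> low_dim s c'"
proof
  fix x assume c: "c' \<le> c" and x: "x \<in> low_dim s c"
  show "x \<in> low_dim s c'" unfolding low_dim_def
  proof (intro CollectI conjI allI impI)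
    show "x \<in> X" using x by (simp add: low_dim_def)
    fix \<delta> :: real assume "0 < \<delta>"
    then obtain \<epsilon> where e: "0 < \<epsilon>" "\<epsilon> < \<delta>" "c * \<epsilon> powr s < prob (ball x \<epsilon> \<inter> X)"
      using x unfolding low_dim_def by blast
    have "c' * \<epsilon> powr s \<le> c * \<epsilon> powr s" using c by (intro mult_right_mono) auto
    then show "\<exists>\<epsilon>. 0 < \<epsilon> \<and> \<epsilon> < \<delta> \<and> c' * \<epsilon> powr s < prob (ball x \<epsilon> \<inter> X)"
      using e(1,2) le_less_trans[OF _ e(3)] by (intro exI[of _ \<epsilon>]) simp
  qed
qed

text \<open>\<open>T\<close> preserves \<mu> and maps the ball of radius \<epsilon> into the ball of
  radius \<open>max L 1 * \<epsilon>\<close> around the image, which is therefore at least as heavy.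
  The factor in the constant compensates the change of radius; \<open>max\<close> keeps the scaling
  positive.\<close>

lemma low_dim_forward:
  assumes "x \<in> low_dim s c" "0 < c"
  shows "T x \<in> low_dim s (c * max L 1 powr (- s))"
proof -
  let ?M = "max L 1"
  have x: "x \<in> X" "T x \<in> X" using assms TX by (auto simp: low_dim_def)
  show ?thesis unfolding low_dim_def
  proof (intro CollectI conjI allI impI)
    fix \<delta> :: real assume d: "0 < \<delta>"
    then have "0 < \<delta> / ?M" by simp
    then obtain \<epsilon> where e: "0 < \<epsilon>" "\<epsilon> < \<delta> / ?M" "c * \<epsilon> powr s < prob (ball x \<epsilon> \<inter> X)"
      using assms(1) unfolding low_dim_def by blast
    have "ball x \<epsilon> \<inter> X \<subseteq> (T ^^ 1) -` (ball (T x) (?M * \<epsilon>) \<inter> X) \<inter> X"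
    proof
      fix y assume y: "y \<in> ball x \<epsilon> \<inter> X"
      have "dist (T x) (T y) \<le> L * dist x y" using LT x y by (auto dest: lipschitz_onD)
      also have "\<dots> \<le> ?M * dist x y" by (intro mult_right_mono) auto
      also have "\<dots> < ?M * \<epsilon>" using y by (intro mult_strict_left_mono) auto
      finally show "y \<in> (T ^^ 1) -` (ball (T x) (?M * \<epsilon>) \<inter> X) \<inter> X" using y TX by auto
    qed
    then have "prob (ball x \<epsilon> \<inter> X) \<le> prob ((T ^^ 1) -` (ball (T x) (?M * \<epsilon>) \<inter> X) \<inter> X)"
      using measurable_sets[OF measurable_funpow open_Int_sets[of "ball (T x) (?M * \<epsilon>)"], of 1] space_mu
      by (intro finite_measure_mono) auto
    also have "\<dots> = prob (ball (T x) (?M * \<epsilon>) \<inter> X)" by (rule measure_vimage_Tn) (auto intro: open_Int_sets)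
    finally have "c * \<epsilon> powr s < prob (ball (T x) (?M * \<epsilon>) \<inter> X)" using e by simp
    moreover have "c * ?M powr (- s) * (?M * \<epsilon>) powr s = c * \<epsilon> powr s"
      using e by (simp add: powr_mult powr_minus field_simps)
    ultimately show "\<exists>\<epsilon>'. 0 < \<epsilon>' \<and> \<epsilon>' < \<delta> \<and> c * ?M powr (- s) * \<epsilon>' powr s < prob (ball (T x) \<epsilon>' \<inter> X)"
      using e by (intro exI[of _ "?M * \<epsilon>"]) (auto simp: field_simps)
  qed (use x in auto)
qed

lemma low_dim_union_full:
  assumes "0 < prob (low_dim s 1)"
  shows "prob (low_dim_all s) = 1"
proof (rule forward_invariant_full)
  show m: "low_dim_all s \<in> sets \<mu>" using sets_low_dim by auto
  show "T x \<in> low_dim_all s" if x: "x \<in> low_dim_all s" for x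
  proof -
    obtain n where "x \<in> low_dim s (recip n)" using x by blast
    then have Tx: "T x \<in> low_dim s (recip n * max L 1 powr (- s))" by (rule low_dim_forward) simp
    have "0 < recip n * max L 1 powr (- s)" by simp
    then obtain m where "recip m < recip n * max L 1 powr (- s)"
      using reals_Archimedean by (metis inverse_eq_divide)
    then show ?thesis using Tx low_dim_mono[of "recip m"] by (meson UN_iff UNIV_I less_imp_le subsetD)
  qed
  have "low_dim s 1 \<subseteq> low_dim_all s" by (rule order.trans[OF _ UN_upper[of 0]]) auto
  then have "prob (low_dim s 1) \<le> prob (low_dim_all s)"
    using m by (intro finite_measure_mono) auto
  then show "0 < prob (low_dim_all s)" using assms by simp
qed

text \<open>A ball around a point of the support contains one of finitely many balls of half the
  radius and of positive mass. For fixed \<epsilon> this bounds the logarithm in the information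
  dimension.\<close>

lemma measure_ball_lower_bound:
  assumes "0 < \<epsilon>"
  shows "\<exists>m>0. \<forall>x\<in>measure_support \<mu>. m \<le> prob (ball x \<epsilon> \<inter> X)"
proof -
  obtain C where C: "finite C" "X \<subseteq> (\<Union>c\<in>C. ball c (\<epsilon> / 2))"
    using cX assms compact_imp_seq_compact seq_compact_imp_totally_bounded by (metis half_gt_zero_iff)
  \<comment> \<open>Inserting 1 keeps the minimum taken over a nonempty set.\<close>
  let ?V = "insert 1 {prob (ball c (\<epsilon> / 2) \<inter> X) |c. c \<in> C \<and> 0 < prob (ball c (\<epsilon> / 2) \<inter> X)}"
  have f: "finite ?V" using C(1) by auto
  have "0 < Min ?V" using f by (subst Min_gr_iff) auto
  moreover have "Min ?V \<le> prob (ball x \<epsilon> \<inter> X)" if x: "x \<in> measure_support \<mu>" for x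
  proof -
    have "x \<in> X" using x by (simp add: measure_support_def space_mu)
    then obtain c where c: "c \<in> C" "x \<in> ball c (\<epsilon> / 2)" using C(2) by blast
    then have "0 < emeasure \<mu> (ball c (\<epsilon> / 2) \<inter> X)"
      using x by (auto simp: measure_support_def space_mu)
    then have "0 < prob (ball c (\<epsilon> / 2) \<inter> X)" by (simp add: emeasure_eq_measure)
    then have "Min ?V \<le> prob (ball c (\<epsilon> / 2) \<inter> X)" using f c(1) by (intro Min_le) auto
    also have "\<dots> \<le> prob (ball x \<epsilon> \<inter> X)"
    proof (rule finite_measure_mono[OF _ open_Int_sets])
      show "ball c (\<epsilon> / 2) \<inter> X \<subseteq> ball x \<epsilon> \<inter> X"
      proof
        fix z assume z: "z \<in> ball c (\<epsilon> / 2) \<inter> X"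
        have "dist x z \<le> dist c x + dist c z" by (metis dist_commute dist_triangle)
        then show "z \<in> ball x \<epsilon> \<inter> X" using z c(2) by auto
      qed
    qed auto
    finally show ?thesis .
  qed
  ultimately show ?thesis by blast
qed

text \<open>The integrand is nonnegative and, off \<open>low_dim s 1\<close>, at least \<open>s\<close> for small \<open>\<epsilon>\<close>.\<close>

lemma low_dim_positive:
  assumes s: "0 < s" "lower_info_dim \<mu> < ereal s"
  shows "0 < prob (low_dim s 1)"
proof (rule ccontr)
  assume "\<not> ?thesis"
  then have D0: "prob (low_dim s 1) = 0" using measure_nonneg[of \<mu> "low_dim s 1"] by linarith
  let ?S = "measure_support \<mu>"
  have S: "?S \<in> sets \<mu>" "AE x in \<mu>. x \<in> ?S" using measure_support_restrict_borel[OF sets_mu] by auto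
  \<comment> \<open>On \<open>G n\<close> all balls of radius below \<open>recip n\<close> have mass
    at most \<open>\<epsilon> powr s\<close>. This uniformity replaces the exchange of limit and
    integral; under the contrary assumption the sets \<open>G n\<close> increase to full
    measure.\<close>
  define G where "G n = X - (\<Union>\<epsilon>\<in>{0<..<recip n}. {x. 1 * \<epsilon> powr s < prob (ball x \<epsilon> \<inter> X)})" for n
  have G: "G n \<in> sets \<mu>" for n
  proof -
    have "open (\<Union>\<epsilon>\<in>{0<..<recip n}. {x. 1 * \<epsilon> powr s < prob (ball x \<epsilon> \<inter> X)})"
      using open_measure_ball_gt[OF fin sets_mu] by auto
    then show ?thesis unfolding G_def Diff_eq by (intro borel_Int_sets borel_closed closed_Compl)
  qed
  have Gm: "(\<lambda>n. prob (G n)) \<longlonglongrightarrow> 1"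
  proof -
    have inc: "incseq G"
    proof (rule incseq_SucI)
      fix n
      have "recip (Suc n) \<le> recip n" by (intro divide_left_mono) auto
      then show "G n \<subseteq> G (Suc n)" unfolding G_def by (intro Diff_mono order_refl UN_mono) auto
    qed
    have U: "(\<Union>n. G n) = space \<mu> - low_dim s 1"
    proof (intro equalityI subsetI)
      fix x assume "x \<in> (\<Union>n. G n)"
      then obtain n where "x \<in> G n" by blast
      then have n: "x \<in> X" "\<And>\<epsilon>. 0 < \<epsilon> \<Longrightarrow> \<epsilon> < recip n \<Longrightarrow> \<not> 1 * \<epsilon> powr s < prob (ball x \<epsilon> \<inter> X)"
        unfolding G_def by auto
      have "x \<notin> low_dim s 1"
      proof
        assume "x \<in> low_dim s 1"
        moreover have "0 < recip n" by simp
        ultimately show False using n(2) unfolding low_dim_def by blast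
      qed
      then show "x \<in> space \<mu> - low_dim s 1" using n space_mu by auto
    next
      fix x assume x: "x \<in> space \<mu> - low_dim s 1"
      then obtain \<delta> where d: "0 < \<delta>" "\<And>\<epsilon>. 0 < \<epsilon> \<Longrightarrow> \<epsilon> < \<delta> \<Longrightarrow> \<not> 1 * \<epsilon> powr s < prob (ball x \<epsilon> \<inter> X)"
        unfolding low_dim_def space_mu by blast
      obtain n where "recip n < \<delta>" using reals_Archimedean[OF d(1)] by (auto simp: inverse_eq_divide)
      then have "x \<in> G n" using d(2) x unfolding G_def space_mu by force
      then show "x \<in> (\<Union>n. G n)" by blast
    qed
    have "(\<lambda>n. prob (G n)) \<longlonglongrightarrow> prob (\<Union>n. G n)"
      using G inc by (intro finite_Lim_measure_incseq) auto
    then show ?thesis using U prob_compl[OF sets_low_dim] D0 by simp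
  qed
  let ?F = "\<lambda>\<epsilon> x. ln (prob (ball x \<epsilon> \<inter> space \<mu>)) / ln \<epsilon>"
  \<comment> \<open>As \<open>ln \<epsilon> < 0\<close>, masses at most 1 make the quotient
    nonnegative and masses at most \<open>\<epsilon> powr s\<close> make it at least
    \<open>s\<close>.\<close>
  have low: "s * prob (G n) \<le> (LINT x:?S|\<mu>. ?F \<epsilon> x)" if e: "0 < \<epsilon>" "\<epsilon> < min 1 (recip n)" for n \<epsilon>
  proof -
    have "0 < \<epsilon>" "\<epsilon> < 1" using e unfolding min_less_iff_conj by blast+
    then have e1: "0 < \<epsilon>" "\<epsilon> < 1" "ln \<epsilon> < 0" by auto
    obtain m where m: "0 < m" "\<And>x. x \<in> ?S \<Longrightarrow> m \<le> prob (ball x \<epsilon> \<inter> X)"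
      using measure_ball_lower_bound[OF e(1)] by blast
    have F0: "0 \<le> ?F \<epsilon> x" "?F \<epsilon> x \<le> ln m / ln \<epsilon>" if "x \<in> ?S" for x
    proof -
      have "0 < prob (ball x \<epsilon> \<inter> X)" "prob (ball x \<epsilon> \<inter> X) \<le> 1" "ln m \<le> ln (prob (ball x \<epsilon> \<inter> X))"
        using m(1) m(2)[OF that] by auto
      then show "0 \<le> ?F \<epsilon> x" "?F \<epsilon> x \<le> ln m / ln \<epsilon>"
        using e1 space_mu by (auto intro!: divide_nonpos_neg divide_right_mono_neg)
    qed
    have Fs: "s \<le> ?F \<epsilon> x" if "x \<in> ?S" "x \<in> G n" for x
    proof -
      have "0 < prob (ball x \<epsilon> \<inter> X)" using m(1) m(2)[OF that(1)] by auto
      moreover have "prob (ball x \<epsilon> \<inter> X) \<le> \<epsilon> powr s"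
        using that(2) e unfolding G_def by force
      ultimately have "ln (prob (ball x \<epsilon> \<inter> X)) \<le> ln (\<epsilon> powr s)" using e by (subst ln_le_cancel_iff) auto
      also have "\<dots> = s * ln \<epsilon>" using e by (simp add: ln_powr)
      finally show ?thesis using e1 space_mu by (simp add: neg_le_divide_eq)
    qed
    have bm: "(\<lambda>x. prob (ball x \<epsilon> \<inter> X)) \<in> borel_measurable \<mu>"
    proof -
      have "(\<lambda>x. prob (ball x \<epsilon> \<inter> X)) \<in> borel_measurable borel"
        unfolding borel_measurable_iff_greater using open_measure_ball_gt[OF fin sets_mu] by auto
      then have "(\<lambda>x. prob (ball x \<epsilon> \<inter> X)) \<in> borel_measurable (restrict_space borel X)"
        by (rule measurable_restrict_space1)
      then show ?thesis using measurable_cong_sets[OF sets_mu refl] by blast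
    qed
    \<comment> \<open>Integrability matters: the Bochner integral of a nonintegrable function is 0
      by convention, which would void the lower bound.\<close>
    have i: "integrable \<mu> (\<lambda>x. indicator ?S x * ?F \<epsilon> x)"
    proof (rule integrable_const_bound[where B="ln m / ln \<epsilon>"])
      have m0: "0 \<le> ln m / ln \<epsilon>"
      proof -
        have "\<exists>x. x \<in> ?S"
        proof (rule ccontr)
          assume "\<not> ?thesis"
          then have "AE x in \<mu>. False" using S(2) by simp
          then show False by simp
        qed
        then show ?thesis using F0 order.trans by blast
      qed
      show "AE x in \<mu>. norm (indicator ?S x * ?F \<epsilon> x) \<le> ln m / ln \<epsilon>"
      proof (rule AE_I2)
        fix x
        show "norm (indicator ?S x * ?F \<epsilon> x) \<le> ln m / ln \<epsilon>"
        proof (cases "x \<in> ?S")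
          case True
          have "norm (?F \<epsilon> x) = ?F \<epsilon> x" using F0(1)[OF True] by (simp only: real_norm_def abs_of_nonneg)
          then show ?thesis using True F0(2)[OF True] by (simp del: norm_divide)
        qed (use m0 in simp)
      qed
      show "(\<lambda>x. indicator ?S x * ?F \<epsilon> x) \<in> borel_measurable \<mu>"
        unfolding space_mu using bm S(1) by measurable
    qed
    have "s * prob (G n) = s * prob (?S \<inter> G n)"
      using S G by (subst measure_eq_AE[of "?S \<inter> G n" "G n"]) auto
    also have "\<dots> = (\<integral>x. s * indicator (?S \<inter> G n) x \<partial>\<mu>)"
      using S G sets.sets_into_space[OF G] by (simp add: Int_absorb2 le_infI2)
    also have "\<dots> \<le> (\<integral>x. indicator ?S x * ?F \<epsilon> x \<partial>\<mu>)"
    proof (rule integral_mono[OF _ i])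
      show "integrable \<mu> (\<lambda>x. s * indicator (?S \<inter> G n) x)"
        using S G by (auto simp: integrable_indicator_iff emeasure_eq_measure)
      show "s * indicator (?S \<inter> G n) x \<le> indicator ?S x * ?F \<epsilon> x" for x
        using F0[of x] Fs[of x] by (auto simp: indicator_def)
    qed
    finally show ?thesis by (simp add: set_lebesgue_integral_def)
  qed
  have "ereal (s * prob (G n)) \<le> lower_info_dim \<mu>" for n
    unfolding lower_info_dim_def
  proof (rule Liminf_bounded)
    show "eventually (\<lambda>\<epsilon>. ereal (s * prob (G n)) \<le> ereal (LINT x:?S|\<mu>. ?F \<epsilon> x)) (at_right 0)"
      unfolding eventually_at_right_field using low
      by (intro exI[of _ "min 1 (recip n)"]) auto
  qed
  moreover have "(\<lambda>n. ereal (s * prob (G n))) \<longlonglongrightarrow> ereal (s * 1)"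
    by (intro tendsto_ereal tendsto_mult tendsto_const Gm)
  ultimately have "ereal (s * 1) \<le> lower_info_dim \<mu>"
    by (intro LIMSEQ_le_const2[of "\<lambda>n. ereal (s * prob (G n))"]) blast+
  then show False using s(2) by simp
qed

section \<open>Periodic points and the choice of compact sets\<close>

lemma periodic_sets: "{x\<in>X. (T ^^ p) x = x} \<in> sets \<mu>"
proof -
  have "(T ^^ p) \<in> borel_measurable \<mu>"
    using borel_measurable_continuous_on_restrict[OF continuous_on_funpow] measurable_cong_sets[OF sets_mu refl] by blast
  moreover have "(\<lambda>x. x) \<in> borel_measurable \<mu>"
    using borel_measurable_continuous_on_restrict[OF continuous_on_id] measurable_cong_sets[OF sets_mu refl] by blast
  ultimately have "Measurable.pred \<mu> (\<lambda>x. (T ^^ p) x = x)" by measurable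
  then show ?thesis by (simp add: pred_def space_mu)
qed

lemma finite_sets: "finite F \<Longrightarrow> F \<subseteq> X \<Longrightarrow> F \<in> sets \<mu>"
  by (simp add: sets_mu_iff finite_imp_closed)

text \<open>If the periodic points carry the measure, then the points whose orbit comes close to a fixed point
  \<open>z\<close> of the support form an invariant set of positive measure.\<close>

lemma periodic_full:
  assumes p: "0 < p" and pos: "0 < prob {x\<in>X. (T ^^ p) x = x}"
  shows "\<exists>F\<subseteq>X. finite F \<and> prob F = 1"
proof -
  let ?E = "{x\<in>X. (T ^^ p) x = x}"
  have ET: "T x \<in> ?E" if "x \<in> ?E" for x
    using that TX by (auto simp: funpow_swap1[symmetric])
  have E1: "prob ?E = 1" using periodic_sets ET pos by (rule forward_invariant_full)
  have AEE: "AE x in \<mu>. x \<in> ?E" using prob_eq_1[OF periodic_sets] E1 by blast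
  have "\<exists>z. z \<in> ?E \<and> z \<in> measure_support \<mu>"
  proof (rule ccontr)
    assume no: "\<not> ?thesis"
    have "AE x in \<mu>. False"
      by (rule AE_mp[OF AE_conjI[OF AEE measure_support_restrict_borel(2)[OF sets_mu]]])
        (use no in \<open>intro AE_I2, blast\<close>)
    then show False by simp
  qed
  then obtain z where z: "z \<in> ?E" "z \<in> measure_support \<mu>" by blast
  \<comment> \<open>On \<open>?E\<close> the first \<open>p\<close> iterates are the whole orbit.
    The set is forward invariant: a visit at time \<open>i\<close> is a visit of \<open>T y\<close>
    at time \<open>i - 1\<close>, and at time \<open>p - 1\<close> if \<open>i = 0\<close>.\<close>
  define A where "A e = {y\<in>?E. \<exists>i<p. dist ((T ^^ i) y) z < e}" for e
  have Am: "A e \<in> sets \<mu>" for e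
  proof -
    have "A e = ?E \<inter> (\<Union>i<p. (T ^^ i) -` (ball z e \<inter> X) \<inter> X)"
      using funpow_in[OF TX] by (auto simp: A_def dist_commute)
    also have "\<dots> \<in> sets \<mu>"
    proof (rule sets.Int[OF periodic_sets sets.finite_UN])
      fix i
      show "(T ^^ i) -` (ball z e \<inter> X) \<inter> X \<in> sets \<mu>"
        using measurable_sets[OF measurable_funpow[of i] open_Int_sets[OF open_ball[of z e]]] by (simp only: space_mu)
    qed simp
    finally show ?thesis .
  qed
  have A1: "prob (A e) = 1" if e: "0 < e" for e
  proof (rule forward_invariant_full[OF Am])
    fix y assume "y \<in> A e"
    then obtain i where i: "y \<in> ?E" "i < p" "dist ((T ^^ i) y) z < e" by (auto simp: A_def)
    have "\<exists>j<p. dist ((T ^^ j) (T y)) z < e"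
    proof (cases i)
      case 0
      have "(T ^^ (p - 1)) (T y) = (T ^^ p) y"
        using p by (metis Suc_diff_1 funpow_swap1 funpow.simps(2) o_apply)
      also have "\<dots> = y" using i(1) by simp
      finally show ?thesis using i(3) 0 p by (intro exI[of _ "p - 1"]) auto
    next
      case (Suc j)
      then have "(T ^^ j) (T y) = (T ^^ i) y" by (simp add: funpow_swap1)
      then show ?thesis using i Suc by (intro exI[of _ j]) auto
    qed
    then show "T y \<in> A e" using ET[OF i(1)] by (simp add: A_def)
  next
    have "0 < emeasure \<mu> (ball z e \<inter> X)" using z(2) e by (auto simp: measure_support_def space_mu)
    also have "emeasure \<mu> (ball z e \<inter> X) \<le> emeasure \<mu> (A e)"
    proof (rule emeasure_mono_AE[OF _ Am])
      show "AE x in \<mu>. x \<in> ball z e \<inter> X \<longrightarrow> x \<in> A e"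
        using AEE
      proof eventually_elim
        case (elim x)
        show ?case
        proof
          assume "x \<in> ball z e \<inter> X"
          then have "dist ((T ^^ 0) x) z < e" by (simp add: dist_commute)
          then show "x \<in> A e" using elim p unfolding A_def by blast
        qed
      qed
    qed
    finally show "0 < prob (A e)" by (simp add: emeasure_eq_measure)
  qed
  \<comment> \<open>The limit of the sets \<open>A e\<close>: among \<open>p\<close> iterates,
    coming arbitrarily close to \<open>z\<close> means hitting \<open>z\<close>. Injectivity of the
    iterates leaves at most one point for each \<open>i\<close>.\<close>
  let ?F = "{y\<in>X. \<exists>i<p. (T ^^ i) y = z}"
  have "finite ?F"
  proof -
    have "finite {y\<in>X. (T ^^ i) y = z}" for i
    proof (rule finite_subset)
      show "{y\<in>X. (T ^^ i) y = z} \<subseteq> {the_inv_into X (T ^^ i) z}"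
        using the_inv_into_f_f[OF inj_on_funpow[OF injT TX]] by auto
    qed simp
    moreover have "?F = (\<Union>i<p. {y\<in>X. (T ^^ i) y = z})" by auto
    ultimately show ?thesis by simp
  qed
  moreover have "prob ?F = 1"
  proof -
    have Fm: "?F \<in> sets \<mu>" using \<open>finite ?F\<close> by (intro finite_sets) auto
    have "AE y in \<mu>. \<forall>n. y \<in> A (recip n)"
      unfolding AE_all_countable using prob_eq_1[OF Am] A1 by simp
    then have "AE y in \<mu>. y \<in> ?F"
    proof eventually_elim
      case (elim y)
      have yX: "y \<in> X" using elim by (auto simp: A_def)
      show ?case
      proof (rule ccontr)
        assume "y \<notin> ?F"
        then have ne: "\<And>i. i < p \<Longrightarrow> 0 < dist ((T ^^ i) y) z" using yX by auto
        let ?m = "Min ((\<lambda>i. dist ((T ^^ i) y) z) ` {..<p})"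
        have "0 < ?m" using ne p by (subst Min_gr_iff) auto
        then obtain n where n: "recip n < ?m" using reals_Archimedean by (metis inverse_eq_divide)
        obtain i where i: "i < p" "dist ((T ^^ i) y) z < recip n" using elim unfolding A_def by blast
        have "?m \<le> dist ((T ^^ i) y) z" using i(1) by (intro Min_le) auto
        then show False using n i(2) by simp
      qed
    qed
    then show ?thesis using prob_eq_1[OF Fm] by simp
  qed
  ultimately show ?thesis by (intro exI[of _ ?F]) auto
qed

text \<open>The sets \<open>K n\<close> avoid the periodic points unless these carry the measure; then their union is finite.\<close>

lemma good_compact_sets:
  assumes k: "0 < k" and dim: "lower_info_dim \<mu> < ereal (real k)"
  obtains s K where "s < real k" "\<And>n::nat. compact (K n)" "\<And>n. K n \<subseteq> X" "prob (\<Union>n. K n) = 1"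
    "(\<Union>n. K n) \<subseteq> low_dim_all s"
    "finite (\<Union>n. K n) \<or> (\<forall>y\<in>(\<Union>n. K n). inj_on (\<lambda>i. (T ^^ i) y) {..<k})"
proof -
  \<comment> \<open>The maximum with 0 makes the exponent \<open>s\<close> positive, as
    \<open>low_dim_positive\<close> demands.\<close>
  have "max 0 (lower_info_dim \<mu>) < ereal (real k)" using k dim by simp
  then obtain s where s: "max 0 (lower_info_dim \<mu>) < ereal s" "ereal s < ereal (real k)"
    using ereal_dense2 by blast
  have s': "0 < s" "lower_info_dim \<mu> < ereal s" "s < real k" using s by auto
  let ?D = "low_dim_all s"
  have Dm: "?D \<in> sets \<mu>" using sets_low_dim by (intro sets.countable_UN) auto
  have D1: "prob ?D = 1" using low_dim_union_full[OF low_dim_positive[OF s'(1,2)]] .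
  have DX: "?D \<subseteq> X" by (auto simp: low_dim_def)
  have AED: "AE x in \<mu>. x \<in> ?D" using prob_eq_1[OF Dm] D1 by blast
  let ?P = "\<lambda>p. {x\<in>X. (T ^^ p) x = x}"
  show ?thesis
  proof (cases "\<exists>p. 0 < p \<and> 0 < prob (?P p)")
    case True
    then obtain F where F: "F \<subseteq> X" "finite F" "prob F = 1" using periodic_full by metis
    have Fm: "F \<in> sets \<mu>" using F by (intro finite_sets)
    have "AE x in \<mu>. x \<in> F" using prob_eq_1[OF Fm] F by blast
    then have "AE x in \<mu>. x \<in> F \<inter> ?D" using AED by eventually_elim blast
    then have m: "prob (F \<inter> ?D) = 1" using prob_eq_1[of "F \<inter> ?D"] Fm Dm by blast
    show ?thesis
    proof (rule that[of s "\<lambda>_. F \<inter> ?D", OF s'(3)])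
      show "compact (F \<inter> ?D)" using F(2) by (intro finite_imp_compact) auto
    qed (use F m in auto)
  next
    case False
    have P0: "AE x in \<mu>. x \<notin> ?P p" if "0 < p" for p
    proof (rule AE_not_in)
      have "prob (?P p) = 0" using False that measure_nonneg[of \<mu> "?P p"] by (metis less_eq_real_def)
      then show "?P p \<in> null_sets \<mu>" using periodic_sets by (auto simp: null_sets_def emeasure_eq_measure)
    qed
    \<comment> \<open>Removing the periods below \<open>k\<close> is exactly what makes the first
      \<open>k\<close> iterates of each remaining point distinct.\<close>
    define A where "A = ?D - (\<Union>p\<in>{0<..<k}. ?P p)"
    have AD: "A \<subseteq> ?D" by (auto simp: A_def)
    have Am: "A \<in> sets \<mu>" unfolding A_def using periodic_sets by (intro sets.Diff[OF Dm] sets.finite_UN) auto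
    have "AE x in \<mu>. \<forall>p\<in>{0<..<k}. x \<notin> ?P p" using P0 by (intro AE_ball_countable[THEN iffD2]) auto
    then have "AE x in \<mu>. x \<in> A" unfolding A_def using AED by eventually_elim blast
    then have A1: "prob A = 1" using prob_eq_1[OF Am] by blast
    have "\<exists>K. compact K \<and> K \<subseteq> A \<and> 1 < prob K + recip n" for n
      by (rule compact_inner_approx[OF fin sets_mu cX Am, of "recip n"]) (auto simp: A1)
    then obtain K where K: "\<And>n. compact (K n)" "\<And>n. K n \<subseteq> A" "\<And>n. 1 < prob (K n) + recip n"
      by metis
    have KD: "K n \<subseteq> ?D" for n using K(2) AD by (rule order.trans)
    have KX: "K n \<subseteq> X" for n using KD DX by (rule order.trans)
    have Km: "K n \<in> sets \<mu>" for n using K(1)[of n] KX[of n] by (simp add: sets_mu_iff borel_closed compact_imp_closed)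
    have Um: "(\<Union>n. K n) \<in> sets \<mu>" using Km by (intro sets.countable_UN) auto
    have "1 - recip n \<le> prob (\<Union>n. K n)" for n
    proof -
      have "prob (K n) \<le> prob (\<Union>n. K n)" using Um by (intro finite_measure_mono UN_upper) auto
      then show ?thesis using K(3)[of n] by linarith
    qed
    moreover have "(\<lambda>n. 1 - recip n) \<longlonglongrightarrow> 1 - 0"
      by (intro tendsto_diff tendsto_const lim_1_over_n[THEN LIMSEQ_Suc])
    ultimately have "1 - 0 \<le> prob (\<Union>n. K n)"
      by (intro LIMSEQ_le_const2[of "\<lambda>n. 1 - recip n"]) blast+
    then have m1: "prob (\<Union>n. K n) = 1" using prob_le_1[of "\<Union>n. K n"] by linarith
    have inj: "inj_on (\<lambda>i. (T ^^ i) y) {..<k}" if y: "y \<in> (\<Union>n. K n)" for y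
    proof -
      have yX: "y \<in> X" using y KX by blast
      have np: "(T ^^ p) y \<noteq> y" if "0 < p" "p < k" for p using y K(2) yX that unfolding A_def by force
      have less: "(T ^^ i) y \<noteq> (T ^^ j) y" if "i < j" "j < k" for i j
      proof
        assume e: "(T ^^ i) y = (T ^^ j) y"
        have "(T ^^ j) y = (T ^^ i) ((T ^^ (j - i)) y)"
          using that(1) by (metis add_diff_inverse_nat funpow_add less_imp_le_nat not_less o_apply)
        then have "(T ^^ i) ((T ^^ (j - i)) y) = (T ^^ i) y" using e by (simp only:)
        then have "(T ^^ (j - i)) y = y"
          by (rule inj_onD[OF inj_on_funpow[OF injT TX]]) (use yX funpow_in[OF TX] in auto)
        then show False using np[of "j - i"] that by auto
      qed
      show ?thesis
      proof (rule inj_onI, rule ccontr)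
        fix i j assume "i \<in> {..<k}" "j \<in> {..<k}" "(T ^^ i) y = (T ^^ j) y" "i \<noteq> j"
        then show False using less[of i j] less[of j i] by (cases "i < j") auto
      qed
    qed
    show ?thesis
    proof (rule that[of s K, OF s'(3) K(1) KX m1])
      show "(\<Union>n. K n) \<subseteq> ?D" using KD by (rule UN_least)
      show "finite (\<Union>n. K n) \<or> (\<forall>y\<in>\<Union>n. K n. inj_on (\<lambda>i. (T ^^ i) y) {..<k})" using inj by blast
    qed
  qed
qed

end

section \<open>The space of Lipschitz functions\<close>

lemma lipschitz_on_probe:
  fixes X :: "'a::euclidean_space set"
  assumes "bounded X"
  shows "\<exists>C. lipschitz_on C X (probe i)"
proof -
  let ?v = "moment_vec (fst i) :: 'a"
  obtain R where R: "\<And>x. x \<in> X \<Longrightarrow> norm x \<le> R" using assms unfolding bounded_iff by auto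
  define M where "M = \<bar>R\<bar> * norm ?v"
  have M: "\<bar>x \<bullet> ?v\<bar> \<le> M" if "x \<in> X" for x
  proof -
    have "\<bar>x \<bullet> ?v\<bar> \<le> norm x * norm ?v" by (rule Cauchy_Schwarz_ineq2)
    also have "\<dots> \<le> M" unfolding M_def using R[OF that] by (intro mult_right_mono) auto
    finally show ?thesis .
  qed
  have M0: "0 \<le> M" by (simp add: M_def)
  have "\<exists>C. lipschitz_on C X (\<lambda>x. (x \<bullet> ?v) ^ j)" for j
  proof (induction j)
    case 0
    show ?case by (auto intro!: exI[of _ 0] lipschitz_onI)
  next
    case (Suc j)
    then obtain C where C: "lipschitz_on C X (\<lambda>x. (x \<bullet> ?v) ^ j)" ..
    have "lipschitz_on (M * C + M ^ j * norm ?v) X (\<lambda>x. (x \<bullet> ?v) ^ Suc j)"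
    proof (rule lipschitz_onI)
      fix x y assume xy: "x \<in> X" "y \<in> X"
      let ?a = "x \<bullet> ?v" and ?b = "y \<bullet> ?v"
      have "\<bar>?a ^ Suc j - ?b ^ Suc j\<bar> = \<bar>?a * (?a ^ j - ?b ^ j) + ?b ^ j * (?a - ?b)\<bar>"
        by (simp add: algebra_simps)
      also have "\<dots> \<le> \<bar>?a\<bar> * \<bar>?a ^ j - ?b ^ j\<bar> + \<bar>?b\<bar> ^ j * \<bar>?a - ?b\<bar>"
        by (rule order.trans[OF abs_triangle_ineq]) (simp add: abs_mult power_abs)
      also have "\<dots> \<le> M * (C * dist x y) + M ^ j * (norm ?v * dist x y)"
      proof (intro add_mono mult_mono M power_mono)
        show "\<bar>?a ^ j - ?b ^ j\<bar> \<le> C * dist x y" using lipschitz_onD[OF C xy] by (simp add: dist_real_def)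
        have "\<bar>(x - y) \<bullet> ?v\<bar> \<le> norm (x - y) * norm ?v" by (rule Cauchy_Schwarz_ineq2)
        then show "\<bar>?a - ?b\<bar> \<le> norm ?v * dist x y" by (simp add: inner_diff_left dist_norm mult.commute)
      qed (use xy M0 in auto)
      finally show "dist (?a ^ Suc j) (?b ^ Suc j) \<le> (M * C + M ^ j * norm ?v) * dist x y"
        by (simp add: dist_real_def algebra_simps)
    next
      have "0 \<le> C" using C by (rule lipschitz_on_nonneg)
      then show "0 \<le> M * C + M ^ j * norm ?v" using M0 by simp
    qed
    then show ?case ..
  qed
  then show ?thesis unfolding probe_def .
qed

locale compact_lip =
  fixes X :: "'a::euclidean_space set"
  assumes cX: "compact X" and neX: "X \<noteq> {}"
begin

section \<open>The Lipschitz norm\<close>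

lemma Lip_add: "f \<in> Lip X \<Longrightarrow> g \<in> Lip X \<Longrightarrow> (\<lambda>x. f x + g x) \<in> Lip X"
  unfolding Lip_def by (auto intro: lipschitz_on_add)

lemma Lip_minus: "f \<in> Lip X \<Longrightarrow> g \<in> Lip X \<Longrightarrow> (\<lambda>x. f x - g x) \<in> Lip X"
  unfolding Lip_def by (auto intro: lipschitz_on_diff)

lemma Lip_abs_bound:
  assumes "h \<in> Lip X"
  shows "bdd_above ((\<lambda>x. \<bar>h x\<bar>) ` X)"
proof -
  have "continuous_on X h" using assms unfolding Lip_def by (auto intro: lipschitz_on_continuous_on)
  then have "compact ((\<lambda>x. \<bar>h x\<bar>) ` X)" using cX by (intro compact_continuous_image continuous_intros)
  then show ?thesis by (intro bounded_imp_bdd_above compact_imp_bounded)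
qed

text \<open>Every difference quotient lies below every admissible constant, hence below their
  infimum. That the infimum is itself admissible gives the triangle inequality for the norm.\<close>

lemma lipschitz_on_Inf:
  assumes "h \<in> Lip X"
  shows "lipschitz_on (Inf {C. lipschitz_on C X h}) X h"
proof (rule lipschitz_onI)
  have ne: "{C. lipschitz_on C X h} \<noteq> {}" using assms by (auto simp: Lip_def)
  show "0 \<le> Inf {C. lipschitz_on C X h}" using ne by (intro cInf_greatest) (auto dest: lipschitz_on_nonneg)
  fix x y assume xy: "x \<in> X" "y \<in> X"
  show "dist (h x) (h y) \<le> Inf {C. lipschitz_on C X h} * dist x y"
  proof (cases "x = y")
    case False
    have "dist (h x) (h y) / dist x y \<le> Inf {C. lipschitz_on C X h}"
      using ne
    proof (rule cInf_greatest)
      fix C assume "C \<in> {C. lipschitz_on C X h}"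
      then have "dist (h x) (h y) \<le> C * dist x y" using xy by (auto dest: lipschitz_onD)
      then show "dist (h x) (h y) / dist x y \<le> C" using False by (simp add: divide_le_eq)
    qed
    then show ?thesis using False by (simp add: divide_le_eq)
  qed simp
qed

lemma Lip_norm_le:
  assumes "\<And>x. x \<in> X \<Longrightarrow> \<bar>h x\<bar> \<le> a" "lipschitz_on C X h"
  shows "Lip_norm X h \<le> a + C"
  unfolding Lip_norm_def
proof (rule add_mono)
  show "(SUP x\<in>X. \<bar>h x\<bar>) \<le> a" using neX assms(1) by (rule cSUP_least)
  have "bdd_below {C. lipschitz_on C X h}" by (rule bdd_belowI[of _ 0]) (auto dest: lipschitz_on_nonneg)
  then show "Inf {C. lipschitz_on C X h} \<le> C" using assms(2) by (intro cInf_lower) auto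
qed

lemma Lip_norm_ge:
  assumes "h \<in> Lip X" "x \<in> X"
  shows "\<bar>h x\<bar> \<le> Lip_norm X h"
proof -
  have "\<bar>h x\<bar> \<le> (SUP x\<in>X. \<bar>h x\<bar>)" using assms(2) Lip_abs_bound[OF assms(1)] by (rule cSUP_upper)
  moreover have "0 \<le> Inf {C. lipschitz_on C X h}" using lipschitz_on_Inf[OF assms(1)] by (rule lipschitz_on_nonneg)
  ultimately show ?thesis by (simp add: Lip_norm_def)
qed

lemma Lip_norm_triangle:
  assumes "f \<in> Lip X" "g \<in> Lip X"
  shows "Lip_norm X (\<lambda>x. f x + g x) \<le> Lip_norm X f + Lip_norm X g"
proof -
  have "Lip_norm X (\<lambda>x. f x + g x) \<le> ((SUP x\<in>X. \<bar>f x\<bar>) + (SUP x\<in>X. \<bar>g x\<bar>))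
      + (Inf {C. lipschitz_on C X f} + Inf {C. lipschitz_on C X g})"
  proof (rule Lip_norm_le)
    fix x assume x: "x \<in> X"
    have "\<bar>f x + g x\<bar> \<le> \<bar>f x\<bar> + \<bar>g x\<bar>" by (rule abs_triangle_ineq)
    also have "\<dots> \<le> (SUP x\<in>X. \<bar>f x\<bar>) + (SUP x\<in>X. \<bar>g x\<bar>)"
      by (intro add_mono cSUP_upper x Lip_abs_bound assms)
    finally show "\<bar>f x + g x\<bar> \<le> (SUP x\<in>X. \<bar>f x\<bar>) + (SUP x\<in>X. \<bar>g x\<bar>)" .
  qed (intro lipschitz_on_add lipschitz_on_Inf assms)
  then show ?thesis by (simp add: Lip_norm_def)
qed

lemma Lip_norm_nonneg: "h \<in> Lip X \<Longrightarrow> 0 \<le> Lip_norm X h"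
  using neX Lip_norm_ge by (meson abs_ge_zero equals0I order.trans)

lemma Lip_norm_minus_commute: "Lip_norm X (\<lambda>x. f x - g x) = Lip_norm X (\<lambda>x. g x - f x)"
proof -
  have "dist (f x - g x) (f y - g y) = dist (g x - f x) (g y - f y)" for x y
    unfolding dist_real_def by arith
  then have "lipschitz_on C X (\<lambda>x. f x - g x) \<longleftrightarrow> lipschitz_on C X (\<lambda>x. g x - f x)" for C
    by (simp add: lipschitz_on_def)
  then show ?thesis by (simp add: Lip_norm_def abs_minus_commute)
qed

definition Lip_dist :: "('a \<Rightarrow> real) \<Rightarrow> ('a \<Rightarrow> real) \<Rightarrow> real" where
  "Lip_dist = (\<lambda>f g. if f \<in> Lip X \<and> g \<in> Lip X then Lip_norm X (\<lambda>x. f x - g x) else 0)"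

sublocale Lip: Metric_space "Lip X" Lip_dist
proof
  show "0 \<le> Lip_dist f g" for f g
    by (simp add: Lip_dist_def Lip_norm_nonneg Lip_minus)
  show "Lip_dist f g = Lip_dist g f" for f g
    using Lip_norm_minus_commute[of f g] by (auto simp: Lip_dist_def)
  show "Lip_dist f g = 0 \<longleftrightarrow> f = g" if fg: "f \<in> Lip X" "g \<in> Lip X" for f g
  proof
    assume "Lip_dist f g = 0"
    then have "\<bar>f x - g x\<bar> \<le> 0" if "x \<in> X" for x
      using Lip_norm_ge[OF Lip_minus[OF fg] that] fg by (simp add: Lip_dist_def)
    then have "f x = g x" for x using fg by (cases "x \<in> X") (auto simp: Lip_def)
    then show "f = g" by auto
  next
    assume "f = g"
    moreover have "Lip_norm X (\<lambda>x. 0) \<le> 0 + 0" by (rule Lip_norm_le) (auto intro!: lipschitz_onI)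
    moreover have "(\<lambda>x. 0) \<in> Lip X" by (auto simp: Lip_def intro!: exI[of _ 0] lipschitz_onI)
    ultimately show "Lip_dist f g = 0"
      using fg Lip_norm_nonneg[of "\<lambda>x. 0"] by (simp add: Lip_dist_def)
  qed
  show "Lip_dist f h \<le> Lip_dist f g + Lip_dist g h" if "f \<in> Lip X" "g \<in> Lip X" "h \<in> Lip X" for f g h
    using Lip_norm_triangle[OF Lip_minus[OF that(1,2)] Lip_minus[OF that(2,3)]] that
    by (simp add: Lip_dist_def)
qed

section \<open>Borel sets for the Lipschitz norm\<close>

lemma norm_topology_eq: "norm_topology (Lip X) (Lip_norm X) = Lip.mtopology"
  by (simp add: norm_topology_def Lip_dist_def)

abbreviation Lip_borel :: "('a \<Rightarrow> real) measure" where
  "Lip_borel \<equiv> norm_borel (Lip X) (Lip_norm X)"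

lemma openin_Lip_subset: "openin Lip.mtopology U \<Longrightarrow> U \<subseteq> Lip X"
  using openin_subset[of Lip.mtopology U] by simp

lemma space_norm_borel: "space Lip_borel = Lip X"
  unfolding norm_borel_def
  by (rule space_measure_of) (auto simp: norm_topology_eq dest: openin_Lip_subset)

lemma sets_norm_borel:
  "sets Lip_borel = sigma_sets (Lip X) {U. openin Lip.mtopology U}"
  unfolding norm_borel_def norm_topology_eq
  by (rule sets_measure_of) (auto dest: openin_Lip_subset)

text \<open>The supremum norm is dominated by \<open>Lip_norm\<close>, so uniformly open sets are
  open. The conditions on observables met later involve their values only.\<close>

lemma norm_borel_openI:
  assumes "U \<subseteq> Lip X"
    and "\<And>h. h \<in> U \<Longrightarrow> \<exists>r>0. \<forall>h'\<in>Lip X. (\<forall>x\<in>X. \<bar>h x - h' x\<bar> < r) \<longrightarrow> h' \<in> U"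
  shows "U \<in> sets Lip_borel"
proof -
  have "openin Lip.mtopology U"
    unfolding Lip.openin_mtopology
  proof (intro conjI assms(1) allI impI)
    fix h assume h: "h \<in> U"
    then obtain r where r: "0 < r" "\<And>h'. h' \<in> Lip X \<Longrightarrow> (\<And>x. x \<in> X \<Longrightarrow> \<bar>h x - h' x\<bar> < r) \<Longrightarrow> h' \<in> U"
      using assms(2) by blast
    have "Lip.mball h r \<subseteq> U"
    proof
      fix h' assume "h' \<in> Lip.mball h r"
      then have "h \<in> Lip X" "h' \<in> Lip X" "Lip_dist h h' < r" by (simp_all add: Lip.in_mball)
      then have h': "h \<in> Lip X" "h' \<in> Lip X" "Lip_norm X (\<lambda>x. h x - h' x) < r"
        by (simp_all add: Lip_dist_def)
      show "h' \<in> U"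
      proof (rule r(2)[OF h'(2)])
        show "\<bar>h x - h' x\<bar> < r" if "x \<in> X" for x
          using Lip_norm_ge[OF Lip_minus[OF h'(1,2)] that] h'(3) by simp
      qed
    qed
    then show "\<exists>r>0. Lip.mball h r \<subseteq> U" using r(1) by blast
  qed
  then show ?thesis unfolding sets_norm_borel by (intro sigma_sets.Basic) simp
qed

text \<open>Translations are isometries, so preimages of open sets are open. It transports the
  condition \<open>v + e \<in> S'\<close> to the parameter space of the perturbations.\<close>

lemma measurable_translate:
  assumes v: "v \<in> Lip X"
  shows "(\<lambda>e x. v x + e x) \<in> Lip_borel \<rightarrow>\<^sub>M Lip_borel"
proof -
  have "(\<lambda>e x. v x + e x) \<in> Lip_borel \<rightarrow>\<^sub>M sigma (Lip X) {U. openin Lip.mtopology U}"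
  proof (rule measurable_measure_of)
    show "{U. openin Lip.mtopology U} \<subseteq> Pow (Lip X)" by (auto dest: openin_Lip_subset)
    show "(\<lambda>e x. v x + e x) \<in> space Lip_borel \<rightarrow> Lip X"
      using Lip_add[OF v] by (simp add: space_norm_borel)
    fix U assume "U \<in> {U. openin Lip.mtopology U}"
    then have U: "openin Lip.mtopology U" by simp
    let ?V = "{e \<in> Lip X. (\<lambda>x. v x + e x) \<in> U}"
    have "openin Lip.mtopology ?V"
      unfolding Lip.openin_mtopology
    proof (intro conjI allI impI)
      fix e assume e: "e \<in> ?V"
      then obtain r where r: "0 < r" "Lip.mball (\<lambda>x. v x + e x) r \<subseteq> U"
        using U unfolding Lip.openin_mtopology by blast
      have "Lip.mball e r \<subseteq> ?V"
      proof
        fix e' assume "e' \<in> Lip.mball e r"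
        then have e': "e \<in> Lip X" "e' \<in> Lip X" "Lip_dist e e' < r" by (auto simp: Lip.in_mball)
        have "Lip_dist (\<lambda>x. v x + e x) (\<lambda>x. v x + e' x) = Lip_dist e e'"
          using e' Lip_add[OF v] by (simp add: Lip_dist_def)
        then have "(\<lambda>x. v x + e' x) \<in> Lip.mball (\<lambda>x. v x + e x) r"
          using e' Lip_add[OF v] by (simp add: Lip.in_mball)
        then show "e' \<in> ?V" using r(2) e' by blast
      qed
      then show "\<exists>r>0. Lip.mball e r \<subseteq> ?V" using r(1) by blast
    qed auto
    moreover have "(\<lambda>e x. v x + e x) -` U \<inter> space Lip_borel = ?V"
      by (auto simp: space_norm_borel)
    ultimately show "(\<lambda>e x. v x + e x) -` U \<inter> space Lip_borel \<in> sets Lip_borel"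
      unfolding sets_norm_borel by (intro sigma_sets.Basic) simp
  qed
  then show ?thesis by (simp only: norm_borel_def norm_topology_eq)
qed

section \<open>Finite-dimensional families of observables as probes for prevalence\<close>

definition lin_comb :: "'i set \<Rightarrow> ('i \<Rightarrow> 'a \<Rightarrow> real) \<Rightarrow> ('i \<Rightarrow> real) \<Rightarrow> 'a \<Rightarrow> real" where
  "lin_comb I p a x = (if x \<in> X then \<Sum>i\<in>I. a i * p i x else 0)"

lemma lipschitz_on_lin_comb:
  assumes "finite I" "\<And>i. i \<in> I \<Longrightarrow> lipschitz_on (C i) X (p i)"
  shows "lipschitz_on (\<Sum>i\<in>I. \<bar>a i\<bar> * C i) X (lin_comb I p a)"
proof (rule lipschitz_onI)
  have C: "0 \<le> C i" if "i \<in> I" for i using assms(2)[OF that] by (rule lipschitz_on_nonneg)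
  then show "0 \<le> (\<Sum>i\<in>I. \<bar>a i\<bar> * C i)" by (intro sum_nonneg mult_nonneg_nonneg) auto
  fix x y assume xy: "x \<in> X" "y \<in> X"
  have "\<bar>lin_comb I p a x - lin_comb I p a y\<bar> = \<bar>\<Sum>i\<in>I. a i * (p i x - p i y)\<bar>"
    using xy by (simp add: lin_comb_def sum_subtractf right_diff_distrib)
  also have "\<dots> \<le> (\<Sum>i\<in>I. \<bar>a i * (p i x - p i y)\<bar>)" by (rule sum_abs)
  also have "\<dots> \<le> (\<Sum>i\<in>I. \<bar>a i\<bar> * (C i * dist x y))"
  proof (rule sum_mono)
    fix i assume "i \<in> I"
    then have "\<bar>p i x - p i y\<bar> \<le> C i * dist x y"
      using lipschitz_onD[OF assms(2) xy] by (simp add: dist_real_def)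
    then show "\<bar>a i * (p i x - p i y)\<bar> \<le> \<bar>a i\<bar> * (C i * dist x y)"
      unfolding abs_mult by (intro mult_left_mono) auto
  qed
  finally show "dist (lin_comb I p a x) (lin_comb I p a y) \<le> (\<Sum>i\<in>I. \<bar>a i\<bar> * C i) * dist x y"
    by (simp add: dist_real_def sum_distrib_right mult.assoc)
qed

lemma lin_comb_in_Lip:
  assumes "finite I" "\<And>i. i \<in> I \<Longrightarrow> \<exists>C. lipschitz_on C X (p i)"
  shows "lin_comb I p a \<in> Lip X"
proof -
  obtain C where C: "\<And>i. i \<in> I \<Longrightarrow> lipschitz_on (C i) X (p i)" using assms(2) by metis
  show ?thesis unfolding Lip_def
    using lipschitz_on_lin_comb[OF assms(1), of C p a] C by (auto simp: lin_comb_def)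
qed

lemma Lip_dist_lin_comb_le:
  assumes "finite I" "\<And>i. i \<in> I \<Longrightarrow> \<exists>C. lipschitz_on C X (p i)"
  shows "\<exists>M. \<forall>a b. Lip_dist (lin_comb I p a) (lin_comb I p b) \<le> (\<Sum>i\<in>I. \<bar>a i - b i\<bar> * M i)"
proof -
  obtain C where C: "\<And>i. i \<in> I \<Longrightarrow> lipschitz_on (C i) X (p i)" using assms(2) by metis
  have "\<exists>B. \<forall>x\<in>X. \<bar>p i x\<bar> \<le> B" if "i \<in> I" for i
  proof -
    have "compact (p i ` X)"
      using cX lipschitz_on_continuous_on[OF C[OF that]] by (rule compact_continuous_image[rotated])
    from compact_imp_bounded[OF this] show ?thesis by (simp add: bounded_iff)
  qed
  then obtain B where B: "\<And>i x. i \<in> I \<Longrightarrow> x \<in> X \<Longrightarrow> \<bar>p i x\<bar> \<le> B i" by metis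
  have "Lip_dist (lin_comb I p a) (lin_comb I p b) \<le> (\<Sum>i\<in>I. \<bar>a i - b i\<bar> * (B i + C i))" for a b
  proof -
    have eq: "(\<lambda>x. lin_comb I p a x - lin_comb I p b x) = lin_comb I p (\<lambda>i. a i - b i)"
      by (auto simp: lin_comb_def sum_subtractf left_diff_distrib)
    have "Lip_norm X (lin_comb I p (\<lambda>i. a i - b i)) \<le> (\<Sum>i\<in>I. \<bar>a i - b i\<bar> * B i) + (\<Sum>i\<in>I. \<bar>a i - b i\<bar> * C i)"
    proof (rule Lip_norm_le)
      fix x assume x: "x \<in> X"
      have "\<bar>lin_comb I p (\<lambda>i. a i - b i) x\<bar> \<le> (\<Sum>i\<in>I. \<bar>(a i - b i) * p i x\<bar>)"
        using x by (simp add: lin_comb_def sum_abs)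
      also have "\<dots> \<le> (\<Sum>i\<in>I. \<bar>a i - b i\<bar> * B i)"
        unfolding abs_mult using B x by (intro sum_mono mult_left_mono) auto
      finally show "\<bar>lin_comb I p (\<lambda>i. a i - b i) x\<bar> \<le> (\<Sum>i\<in>I. \<bar>a i - b i\<bar> * B i)" .
    qed (rule lipschitz_on_lin_comb[OF assms(1) C])
    also have "\<dots> = (\<Sum>i\<in>I. \<bar>a i - b i\<bar> * (B i + C i))" by (simp add: sum.distrib distrib_left)
    finally show ?thesis using lin_comb_in_Lip[OF assms] by (simp add: Lip_dist_def eq)
  qed
  then show ?thesis by (intro exI[of _ "\<lambda>i. B i + C i"]) blast
qed

text \<open>The coefficients range over all functions with the product topology, not over
  extensional ones, so that Tychonoff's theorem applies to the closed cube. Finitely many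
  coordinates enter the estimate, which makes the neighbourhood open.\<close>

lemma continuous_map_lin_comb:
  fixes I :: "'i set"
  assumes "finite I" "\<And>i. i \<in> I \<Longrightarrow> \<exists>C. lipschitz_on C X (p i)"
  shows "continuous_map (euclidean :: ('i \<Rightarrow> real) topology) Lip.mtopology (lin_comb I p)"
  unfolding continuous_map_def
proof (intro conjI ballI allI impI)
  show "lin_comb I p \<in> topspace euclidean \<rightarrow> topspace Lip.mtopology"
    using lin_comb_in_Lip[OF assms] by simp
  fix U assume U: "openin Lip.mtopology U"
  obtain M where M: "\<And>a b. Lip_dist (lin_comb I p a) (lin_comb I p b) \<le> (\<Sum>i\<in>I. \<bar>a i - b i\<bar> * M i)"
    using Lip_dist_lin_comb_le[OF assms(1), of p] assms(2) by auto
  have "\<exists>W. open W \<and> a \<in> W \<and> W \<subseteq> {a. lin_comb I p a \<in> U}" if a: "lin_comb I p a \<in> U" for a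
  proof -
    obtain r where r: "0 < r" "Lip.mball (lin_comb I p a) r \<subseteq> U"
      using U a unfolding Lip.openin_mtopology by blast
    let ?W = "{b. (\<Sum>i\<in>I. \<bar>a i - b i\<bar> * M i) < r}"
    have "open ?W" by (intro open_Collect_less continuous_intros continuous_on_product_coordinates)
    moreover have "a \<in> ?W" using r(1) by simp
    moreover have "?W \<subseteq> {a. lin_comb I p a \<in> U}"
    proof
      fix b assume "b \<in> ?W"
      then have "Lip_dist (lin_comb I p a) (lin_comb I p b) < r" using M[of a b] by simp
      then have "lin_comb I p b \<in> Lip.mball (lin_comb I p a) r"
        using lin_comb_in_Lip[OF assms] by (simp add: Lip.in_mball)
      then show "b \<in> {a. lin_comb I p a \<in> U}" using r(2) by blast
    qed
    ultimately show ?thesis by blast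
  qed
  then have "open {a. lin_comb I p a \<in> U}" by (subst open_subopen) blast
  then show "openin euclidean {x \<in> topspace euclidean. lin_comb I p x \<in> U}" by simp
qed

lemma measurable_lin_comb:
  fixes I :: "'i::countable set"
  assumes "finite I" "\<And>i. i \<in> I \<Longrightarrow> \<exists>C. lipschitz_on C X (p i)"
  shows "lin_comb I p \<in> (lborel_fun I) \<rightarrow>\<^sub>M Lip_borel"
  unfolding norm_borel_def norm_topology_eq
proof (rule measurable_measure_of)
  show "{U. openin Lip.mtopology U} \<subseteq> Pow (Lip X)" by (auto dest: openin_Lip_subset)
  show "lin_comb I p \<in> space (lborel_fun I) \<rightarrow> Lip X"
    using lin_comb_in_Lip[OF assms] by simp
  fix U assume "U \<in> {U. openin Lip.mtopology U}"
  then have O: "open {a. lin_comb I p a \<in> U}"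
    using continuous_map_lin_comb[OF assms] unfolding continuous_map_def by simp
  \<comment> \<open>Extension by 0 off \<open>I\<close> leads to the product over the whole
    countable index type, where product measurability and topological Borel sets agree.\<close>
  define e where "e a = (\<lambda>i. if i \<in> I then a i else (0::real))" for a
  have "e \<in> (lborel_fun I) \<rightarrow>\<^sub>M (\<Pi>\<^sub>M i\<in>UNIV. (borel :: real measure))"
  proof (rule measurable_PiM_single')
    fix i
    show "(\<lambda>a. e a i) \<in> borel_measurable (lborel_fun I)"
      unfolding e_def by (cases "i \<in> I") simp_all
  qed auto
  then have "e \<in> borel_measurable (lborel_fun I)"
    using measurable_cong_sets[OF refl sets_PiM_equal_borel] by blast
  from measurable_sets[OF this borel_open[OF O]]
  have "e -` {a. lin_comb I p a \<in> U} \<inter> space (lborel_fun I) \<in> sets (lborel_fun I)" .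
  moreover have "lin_comb I p (e a) = lin_comb I p a" for a by (auto simp: lin_comb_def e_def)
  ultimately show "lin_comb I p -` U \<inter> space (lborel_fun I) \<in> sets (lborel_fun I)"
    by (simp add: vimage_def)
qed

definition cube :: "'i set \<Rightarrow> ('i \<Rightarrow> real) measure" where
  "cube I = uniform_measure (lborel_fun I) (Pi\<^sub>E I (\<lambda>_. {0..1}))"

lemma cube_sets: "finite I \<Longrightarrow> Pi\<^sub>E I (\<lambda>_. {0..1}) \<in> sets (lborel_fun I)"
  by (intro sets_PiM_I_finite) auto

lemma cube_emeasure: "finite I \<Longrightarrow> emeasure (lborel_fun I) (Pi\<^sub>E I (\<lambda>_. {0..1::real})) = 1"
proof -
  interpret product_sigma_finite "\<lambda>i::'i. lborel :: real measure" ..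
  show "finite I \<Longrightarrow> emeasure (lborel_fun I) (Pi\<^sub>E I (\<lambda>_. {0..1::real})) = 1"
    by (subst emeasure_PiM) auto
qed

lemma prob_space_cube: "finite I \<Longrightarrow> prob_space (cube I)"
  unfolding cube_def by (intro prob_space_uniform_measure) (simp_all add: cube_emeasure)

text \<open>The exceptional set is only asked to be covered by a null set: in the application it is
  a union over uncountably many partners.\<close>

lemma AE_cubeI:
  assumes I: "finite I" and N: "N \<in> null_sets (lborel_fun I)"
    "\<And>a. a \<in> Pi\<^sub>E I (\<lambda>_. {0..1}) \<Longrightarrow> \<not> P a \<Longrightarrow> a \<in> N"
  shows "AE a in cube I. P a"
  unfolding cube_def
proof (rule AE_uniform_measureI[OF cube_sets[OF I]])
  show "AE a in lborel_fun I. a \<in> Pi\<^sub>E I (\<lambda>_. {0..1}) \<longrightarrow> P a"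
    using AE_not_in[OF N(1)] by eventually_elim (use N(2) in blast)
qed

text \<open>The transverse measure is the law of the combination with coefficients uniform in the
  unit cube. It gives mass 1 to the compact image of the cube.\<close>

lemma prevalent_probe:
  fixes I :: "'i::countable set"
  assumes I: "finite I" "\<And>i. i \<in> I \<Longrightarrow> \<exists>C. lipschitz_on C X (p i)"
    and S: "S \<subseteq> Lip X" "S' \<subseteq> S" "S' \<in> sets Lip_borel"
    and ae: "\<And>v. v \<in> Lip X \<Longrightarrow> AE a in cube I. (\<lambda>x. v x + lin_comb I p a x) \<in> S'"
  shows "prevalent (Lip X) (Lip_norm X) S"
proof -
  let ?B = "Lip_borel"
  define L where "L = distr (cube I) ?B (lin_comb I p)"
  have m: "lin_comb I p \<in> cube I \<rightarrow>\<^sub>M ?B"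
    using measurable_lin_comb[OF I] by (simp add: cube_def)
  interpret c: prob_space "cube I" by (rule prob_space_cube[OF I(1)])
  define K where "K = lin_comb I p ` {a. \<forall>i. a i \<in> {0..1}}"
  have Kc: "compactin Lip.mtopology K"
    unfolding K_def
  proof (rule image_compactin[OF _ continuous_map_lin_comb[OF I]])
    have "compactin (product_topology (\<lambda>i::'i. euclidean) UNIV) (Pi\<^sub>E UNIV (\<lambda>_. {0..1::real}))"
      by (auto simp: compactin_PiE)
    then show "compactin euclidean {a::'i \<Rightarrow> real. \<forall>i. a i \<in> {0..1}}"
      by (simp add: euclidean_product_topology PiE_UNIV_domain Pi_def)
  qed
  have "closedin Lip.mtopology K" by (rule compactin_imp_closedin[OF Lip.Hausdorff_space_mtopology Kc])
  then have "openin Lip.mtopology (Lip X - K)" unfolding closedin_def by simp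
  then have "Lip X - K \<in> sets ?B" unfolding sets_norm_borel by (intro sigma_sets.Basic) simp
  then have "space ?B - (Lip X - K) \<in> sets ?B" by (rule sets.compl_sets)
  moreover have "K \<subseteq> Lip X" using compactin_subset_topspace[OF Kc] by simp
  ultimately have Km: "K \<in> sets ?B" by (simp add: space_norm_borel double_diff)
  have "emeasure L K = 1"
  proof -
    have "AE a in cube I. lin_comb I p a \<in> K"
    proof (rule AE_cubeI[OF I(1), of "{}"])
      fix a assume a: "a \<in> Pi\<^sub>E I (\<lambda>_. {0..1::real})" "lin_comb I p a \<notin> K"
      \<comment> \<open>\<open>K\<close> is the image of a cube in all coordinates, while points of
        the product space are undefined off \<open>I\<close>; \<open>lin_comb\<close> ignores these
        coordinates.\<close>
      let ?b = "\<lambda>i. if i \<in> I then a i else 0"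
      have "lin_comb I p ?b = lin_comb I p a" by (auto simp: lin_comb_def)
      moreover have "lin_comb I p ?b \<in> K" unfolding K_def using a by (intro imageI) auto
      ultimately show "a \<in> {}" using a by simp
    qed simp
    then have K1: "AE h in L. h \<in> K" unfolding L_def using m Km by (subst AE_distr_iff) auto
    interpret L: prob_space L unfolding L_def by (rule c.prob_space_distr[OF m])
    show ?thesis using K1 Km L.emeasure_eq_1_AE by (simp add: L_def)
  qed
  moreover have "AE e in L. (\<lambda>x. v x + e x) \<in> S'" if v: "v \<in> Lip X" for v
  proof -
    have tr: "(\<lambda>e x. v x + e x) \<in> ?B \<rightarrow>\<^sub>M ?B"
      by (rule measurable_translate[OF v])
    show ?thesis unfolding L_def
      using m measurable_sets[OF tr S(3)] ae[OF v]
      by (subst AE_distr_iff) (auto simp: vimage_def Int_def conj_commute L_def)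
  qed
  ultimately have "borel_prevalent (Lip X) (Lip_norm X) S'"
    unfolding borel_prevalent_def norm_topology_eq using S(3) Kc
    by (intro conjI exI[of _ L]) (auto simp: L_def)
  then show ?thesis unfolding prevalent_def using S by blast
qed

end

section \<open>Almost sure injectivity\<close>

locale delay_system = ergodic_system \<mu> X T L for \<mu> :: "'a::euclidean_space measure" and X T L +
  fixes k :: nat
  assumes k0: "0 < k"
begin

lemma neX: "X \<noteq> {}"
  using not_empty space_mu by simp

sublocale compact_lip X
  using cX neX by unfold_locales

section \<open>Points with a colliding partner\<close>

lemma cont_measurable: "continuous_on X f \<Longrightarrow> f \<in> borel_measurable \<mu>" for f :: "'a \<Rightarrow> real"
  using borel_measurable_continuous_on_restrict measurable_cong_sets[OF sets_mu refl] by blast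

lemma Lip_cont: "h \<in> Lip X \<Longrightarrow> continuous_on X h"
  unfolding Lip_def by (auto intro: lipschitz_on_continuous_on)

lemma cont_orbit: "continuous_on X h \<Longrightarrow> continuous_on X (\<lambda>x. h ((T ^^ i) x))" for h :: "'a \<Rightarrow> real"
  by (rule continuous_on_compose2[OF _ continuous_on_funpow funpow_image_subset[OF TX]])

text \<open>\<open>collide K g 0 h\<close> consists of the points whose delay vector is shared by a point of \<open>K\<close> at distance
  at least \<open>g\<close>; the parameter \<open>t\<close> relaxes all conditions.\<close>

definition close_pairs :: "real \<Rightarrow> real \<Rightarrow> ('a \<Rightarrow> real) \<Rightarrow> 'a \<Rightarrow> 'a \<Rightarrow> bool" where
  "close_pairs g t h x y \<longleftrightarrow> g - t \<le> dist x y \<and> (\<forall>i<k. \<bar>h ((T ^^ i) x) - h ((T ^^ i) y)\<bar> \<le> t)"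

definition collide :: "'a set \<Rightarrow> real \<Rightarrow> real \<Rightarrow> ('a \<Rightarrow> real) \<Rightarrow> 'a set" where
  "collide K g t h = {x\<in>X. \<exists>y\<in>K. close_pairs g t h x y}"

lemma close_pairs_mono: "close_pairs g t h x y \<Longrightarrow> t \<le> t' \<Longrightarrow> close_pairs g t' h x y"
  unfolding close_pairs_def by force

lemma compact_close_pairs:
  assumes h: "continuous_on X h" and K: "compact K" "K \<subseteq> X"
  shows "compact {z \<in> X \<times> K. close_pairs g t h (fst z) (snd z)}"
proof -
  have XK: "compact (X \<times> K)" using cX K(1) by (rule compact_Times)
  then have cl: "closed (X \<times> K)" by (rule compact_imp_closed)
  have A: "closed {z \<in> X \<times> K. g - t \<le> dist (fst z) (snd z)}"
    using cl by (intro continuous_on_closed_Collect_le continuous_intros)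
  have B: "closed {z \<in> X \<times> K. \<bar>h ((T ^^ i) (fst z)) - h ((T ^^ i) (snd z))\<bar> \<le> t}" for i
  proof (intro continuous_on_closed_Collect_le[OF _ _ cl] continuous_intros)
    show "continuous_on (X \<times> K) (\<lambda>z. h ((T ^^ i) (fst z)))"
      by (rule continuous_on_compose2[OF cont_orbit[OF h, of i]]) (auto intro: continuous_intros)
    show "continuous_on (X \<times> K) (\<lambda>z. h ((T ^^ i) (snd z)))"
      using K(2) by (intro continuous_on_compose2[OF cont_orbit[OF h, of i]]) (auto intro: continuous_intros)
  qed
  have "{z \<in> X \<times> K. close_pairs g t h (fst z) (snd z)} = (X \<times> K) \<inter> ({z \<in> X \<times> K. g - t \<le> dist (fst z) (snd z)}
      \<inter> (\<Inter>i\<in>{..<k}. {z \<in> X \<times> K. \<bar>h ((T ^^ i) (fst z)) - h ((T ^^ i) (snd z))\<bar> \<le> t}))"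
    using k0 unfolding close_pairs_def by blast
  moreover have "closed ({z \<in> X \<times> K. g - t \<le> dist (fst z) (snd z)}
      \<inter> (\<Inter>i\<in>{..<k}. {z \<in> X \<times> K. \<bar>h ((T ^^ i) (fst z)) - h ((T ^^ i) (snd z))\<bar> \<le> t}))"
    using A B by (intro closed_Int closed_INT ballI)
  ultimately show ?thesis using compact_Int_closed[OF XK] by simp
qed

lemma compact_collide:
  assumes "continuous_on X h" "compact K" "K \<subseteq> X"
  shows "compact (collide K g t h)"
proof -
  have "collide K g t h = fst ` {z \<in> X \<times> K. close_pairs g t h (fst z) (snd z)}"
    by (force simp: collide_def)
  then show ?thesis
    using compact_continuous_image[of _ fst, OF continuous_on_fst[OF continuous_on_id] compact_close_pairs[OF assms]]
    by simp
qed

lemma collide_sets: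
  assumes "continuous_on X h" "compact K" "K \<subseteq> X"
  shows "collide K g t h \<in> sets \<mu>"
proof -
  have "collide K g t h \<subseteq> X" by (auto simp: collide_def)
  then show ?thesis using compact_collide[OF assms] by (simp add: sets_mu_iff borel_closed compact_imp_closed)
qed

text \<open>The approximate partners of \<open>x\<close> in \<open>K\<close> form a decreasing
  sequence of nonempty compact sets; a common point is an exact partner.\<close>

lemma collide_limit:
  assumes h: "continuous_on X h" and K: "compact K" "K \<subseteq> X"
    and x: "\<And>n. x \<in> collide K g (recip n) h"
  shows "x \<in> collide K g 0 h"
proof -
  have xX: "x \<in> X" using x by (auto simp: collide_def)
  let ?F = "\<lambda>n. {y\<in>K. close_pairs g (recip n) h x y}"
  have "(\<Inter>n. ?F n) \<noteq> {}"
  proof (rule compact_nest)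
    fix n
    have "?F n = snd ` ({z \<in> X \<times> K. close_pairs g (recip n) h (fst z) (snd z)} \<inter> ({x} \<times> UNIV))"
      using xX by (force simp: image_iff)
    moreover have "compact ({z \<in> X \<times> K. close_pairs g (recip n) h (fst z) (snd z)} \<inter> ({x} \<times> UNIV))"
      by (intro compact_Int_closed compact_close_pairs h K closed_Times) auto
    ultimately show "compact (?F n)"
      using compact_continuous_image[of _ snd, OF continuous_on_snd[OF continuous_on_id]] by simp
    show "?F n \<noteq> {}" using x[of n] by (auto simp: collide_def)
  next
    fix m n :: nat assume "m \<le> n"
    then have "recip n \<le> recip m" by (intro divide_left_mono) auto
    then show "?F n \<subseteq> ?F m" using close_pairs_mono by blast
  qed
  then obtain y where y: "\<And>n. y \<in> K" "\<And>n. close_pairs g (recip n) h x y" by blast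
  have lim: "(\<lambda>n. recip n) \<longlonglongrightarrow> 0" by (rule lim_1_over_n[THEN LIMSEQ_Suc])
  have "close_pairs g 0 h x y" unfolding close_pairs_def
  proof (intro conjI allI impI)
    have "g - recip n \<le> dist x y" for n using y(2)[of n] unfolding close_pairs_def by blast
    moreover have "(\<lambda>n. g - recip n) \<longlonglongrightarrow> g - 0" by (intro tendsto_diff tendsto_const lim)
    ultimately show "g - 0 \<le> dist x y" by (intro LIMSEQ_le_const2[of "\<lambda>n. g - recip n"]) blast+
    fix i assume "i < k"
    then have "\<bar>h ((T ^^ i) x) - h ((T ^^ i) y)\<bar> \<le> recip n" for n
      using y(2)[of n] unfolding close_pairs_def by blast
    then show "\<bar>h ((T ^^ i) x) - h ((T ^^ i) y)\<bar> \<le> 0" using lim by (intro LIMSEQ_le_const[of "\<lambda>n. recip n"]) blast+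
  qed
  then show ?thesis using y(1) xX unfolding collide_def by blast
qed

text \<open>Each set of observables with collision probability below \<open>recip j\<close> is open
  in the supremum norm: the relaxed collision sets decrease to the exact one, and a relaxed set of
  small measure contains the exact sets of all nearby observables.\<close>

lemma collide_null_borel:
  assumes K: "compact K" "K \<subseteq> X"
  shows "{h \<in> Lip X. prob (collide K g 0 h) = 0} \<in> sets Lip_borel"
proof -
  let ?U = "\<lambda>j. {h \<in> Lip X. prob (collide K g 0 h) < recip j}"
  have "?U j \<in> sets Lip_borel" for j
  proof (rule norm_borel_openI)
    fix h assume "h \<in> ?U j"
    then have h: "h \<in> Lip X" "prob (collide K g 0 h) < recip j" by auto
    have hc: "continuous_on X h" using h(1) by (rule Lip_cont)
    let ?C = "\<lambda>n. collide K g (recip n) h"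
    have Cm: "?C n \<in> sets \<mu>" for n using collide_sets[OF hc K] .
    have "(\<lambda>n. prob (?C n)) \<longlonglongrightarrow> prob (\<Inter>n. ?C n)"
    proof (rule finite_Lim_measure_decseq)
      show "range ?C \<subseteq> sets \<mu>" using Cm by blast
      show "decseq ?C"
      proof (rule decseq_SucI)
        fix n
        have "recip (Suc n) \<le> recip n" by (intro divide_left_mono) auto
        then show "?C (Suc n) \<subseteq> ?C n" unfolding collide_def using close_pairs_mono by blast
      qed
    qed
    also have "(\<Inter>n. ?C n) = collide K g 0 h"
    proof (intro equalityI subsetI)
      fix x assume "x \<in> (\<Inter>n. ?C n)"
      then show "x \<in> collide K g 0 h" by (intro collide_limit[OF hc K]) blast
    next
      fix x assume "x \<in> collide K g 0 h"
      moreover have "0 \<le> recip n" for n by simp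
      ultimately show "x \<in> (\<Inter>n. ?C n)" unfolding collide_def using close_pairs_mono by blast
    qed
    finally have "eventually (\<lambda>n. prob (?C n) < recip j) sequentially"
      using h(2) by (rule order_tendstoD(2))
    then obtain n where n: "prob (?C n) < recip j" by (auto simp: eventually_sequentially)
    \<comment> \<open>Half of the tolerance, because a collision compares two values of the
      observable.\<close>
    show "\<exists>r>0. \<forall>h'\<in>Lip X. (\<forall>x\<in>X. \<bar>h x - h' x\<bar> < r) \<longrightarrow> h' \<in> ?U j"
    proof (intro exI[of _ "recip n / 2"] conjI ballI impI)
      fix h' assume h': "h' \<in> Lip X" "\<forall>x\<in>X. \<bar>h x - h' x\<bar> < recip n / 2"
      have "collide K g 0 h' \<subseteq> ?C n"
      proof
        fix x assume "x \<in> collide K g 0 h'"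
        then obtain y where y: "x \<in> X" "y \<in> K" "close_pairs g 0 h' x y" by (auto simp: collide_def)
        have "close_pairs g (recip n) h x y" unfolding close_pairs_def
        proof (intro conjI allI impI)
          have "0 \<le> recip n" by simp
          moreover have "g - 0 \<le> dist x y" using y(3) unfolding close_pairs_def by blast
          ultimately show "g - recip n \<le> dist x y" by linarith
          fix i assume i: "i < k"
          have "\<bar>a - b\<bar> \<le> t" if "\<bar>a' - b'\<bar> \<le> 0" "\<bar>a - a'\<bar> < t / 2" "\<bar>b - b'\<bar> < t / 2"
            for a b a' b' t :: real
            using that by linarith
          moreover have "\<bar>h' ((T ^^ i) x) - h' ((T ^^ i) y)\<bar> \<le> 0" using y(3) i unfolding close_pairs_def by blast
          moreover have "\<bar>h ((T ^^ i) x) - h' ((T ^^ i) x)\<bar> < recip n / 2"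
            "\<bar>h ((T ^^ i) y) - h' ((T ^^ i) y)\<bar> < recip n / 2"
            using h'(2) funpow_in[OF TX, of x i] funpow_in[OF TX, of y i] y(1,2) K(2) by blast+
          ultimately show "\<bar>h ((T ^^ i) x) - h ((T ^^ i) y)\<bar> \<le> recip n" .
        qed
        then show "x \<in> ?C n" using y(1,2) unfolding collide_def by blast
      qed
      then have "prob (collide K g 0 h') \<le> prob (?C n)" using Cm by (intro finite_measure_mono)
      then show "h' \<in> ?U j" using n h'(1) by simp
    qed simp
  qed auto
  then have "(\<Inter>j. ?U j) \<in> sets Lip_borel"
    by (intro sets.countable_INT) blast+
  moreover have "(\<Inter>j. ?U j) = {h \<in> Lip X. prob (collide K g 0 h) = 0}"
  proof (intro equalityI subsetI)
    fix h assume h: "h \<in> (\<Inter>j. ?U j)"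
    have "prob (collide K g 0 h) \<le> 0"
    proof (rule LIMSEQ_le_const[OF lim_1_over_n[THEN LIMSEQ_Suc]])
      have "prob (collide K g 0 h) < recip n" for n using h by blast
      then show "\<exists>N. \<forall>n\<ge>N. prob (collide K g 0 h) \<le> recip n" using less_imp_le by blast
    qed
    then have "prob (collide K g 0 h) = 0" using measure_nonneg[of \<mu> "collide K g 0 h"] by linarith
    then show "h \<in> {h \<in> Lip X. prob (collide K g 0 h) = 0}" using h by blast
  qed auto
  ultimately show ?thesis by simp
qed

section \<open>Random perturbations of an observable\<close>

definition probes :: "(nat \<times> nat) set" where "probes = probe_index TYPE('a) (2 * k)"

definition perturb :: "('a \<Rightarrow> real) \<Rightarrow> (nat \<times> nat \<Rightarrow> real) \<Rightarrow> 'a \<Rightarrow> real" where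
  "perturb v a x = v x + lin_comb probes probe a x"

lemma finite_probes [simp]: "finite probes" by (simp add: probes_def)

lemma probe_lip: "\<exists>C. lipschitz_on C X (probe i)"
  by (rule lipschitz_on_probe[OF compact_imp_bounded[OF cX]])

lemma perturb_Lip: "v \<in> Lip X \<Longrightarrow> perturb v a \<in> Lip X"
  unfolding perturb_def by (intro Lip_add lin_comb_in_Lip finite_probes probe_lip)

lemma perturb_eq: "x \<in> X \<Longrightarrow> perturb v a x = v x + (\<Sum>i\<in>probes. a i * probe i x)"
  by (simp add: perturb_def lin_comb_def)

lemma perturb_diff:
  "x \<in> X \<Longrightarrow> y \<in> X \<Longrightarrow> perturb v a x - perturb v a y = (v x - v y) + (\<Sum>i\<in>probes. (probe i x - probe i y) * a i)"
  by (simp add: perturb_eq algebra_simps sum_subtractf)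

text \<open>One constant serves the whole cube: the width of the slabs must not depend on the
  coefficients.\<close>

lemma perturb_lipschitz:
  assumes "v \<in> Lip X"
  shows "\<exists>C\<ge>0. \<forall>a\<in>Pi\<^sub>E probes (\<lambda>_. {0..1}). \<forall>x\<in>X. \<forall>y\<in>X. \<bar>perturb v a x - perturb v a y\<bar> \<le> C * dist x y"
proof -
  obtain Cv where Cv: "lipschitz_on Cv X v" using assms by (auto simp: Lip_def)
  obtain C where C: "\<And>i. lipschitz_on (C i) X (probe i)" using probe_lip by metis
  have C0: "0 \<le> C i" "0 \<le> Cv" for i using C[of i] Cv by (auto dest: lipschitz_on_nonneg)
  show ?thesis
  proof (intro exI[of _ "Cv + (\<Sum>i\<in>probes. C i)"] conjI ballI)
    show "0 \<le> Cv + (\<Sum>i\<in>probes. C i)" using C0 by (intro add_nonneg_nonneg sum_nonneg)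
    fix a x y assume a: "a \<in> Pi\<^sub>E probes (\<lambda>_. {0..1::real})" and xy: "x \<in> X" "y \<in> X"
    have "\<bar>perturb v a x - perturb v a y\<bar> \<le> \<bar>v x - v y\<bar> + (\<Sum>i\<in>probes. \<bar>(probe i x - probe i y) * a i\<bar>)"
      unfolding perturb_diff[OF xy] by (intro order.trans[OF abs_triangle_ineq] add_mono sum_abs order_refl)
    also have "\<dots> \<le> Cv * dist x y + (\<Sum>i\<in>probes. C i * dist x y)"
    proof (intro add_mono sum_mono)
      show "\<bar>v x - v y\<bar> \<le> Cv * dist x y" using lipschitz_onD[OF Cv xy] by (simp add: dist_real_def)
      fix i assume i: "i \<in> probes"
      have "\<bar>probe i x - probe i y\<bar> \<le> C i * dist x y" using lipschitz_onD[OF C xy] by (simp add: dist_real_def)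
      moreover have "0 \<le> a i" "a i \<le> 1" using PiE_mem[OF a i] by auto
      ultimately have "\<bar>probe i x - probe i y\<bar> * \<bar>a i\<bar> \<le> (C i * dist x y) * 1"
        by (intro mult_mono) auto
      then show "\<bar>(probe i x - probe i y) * a i\<bar> \<le> C i * dist x y" by (simp add: abs_mult)
    qed
    finally show "\<bar>perturb v a x - perturb v a y\<bar> \<le> (Cv + (\<Sum>i\<in>probes. C i)) * dist x y"
      by (simp add: distrib_right sum_distrib_right)
  qed
qed

text \<open>The combination \<open>e b\<close> interpolates the value 1 at \<open>(T ^^ b) y\<close>
  and 0 at the other points of both segments; the minus sign arises because \<open>y\<close> is
  subtracted. The segment of \<open>x\<close> may have repetitions.\<close>

lemma probe_dual:
  assumes inj: "inj_on (\<lambda>i. (T ^^ i) y) {..<k}" and disj: "\<And>a b. a < k \<Longrightarrow> b < k \<Longrightarrow> (T ^^ a) x \<noteq> (T ^^ b) y"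
  shows "\<exists>d. \<forall>a<k. \<forall>b<k. (\<Sum>i\<in>probes. (probe i ((T ^^ a) x) - probe i ((T ^^ a) y)) * d b i) = (if a = b then 1 else 0)"
proof -
  define Z where "Z = (\<lambda>i. (T ^^ i) x) ` {..<k} \<union> (\<lambda>i. (T ^^ i) y) ` {..<k}"
  have fZ: "finite Z" by (simp add: Z_def)
  have cZ: "card Z \<le> 2 * k"
    using card_Un_le[of "(\<lambda>i. (T ^^ i) x) ` {..<k}" "(\<lambda>i. (T ^^ i) y) ` {..<k}"]
      card_image_le[of "{..<k}" "\<lambda>i. (T ^^ i) x"] card_image_le[of "{..<k}" "\<lambda>i. (T ^^ i) y"]
    by (simp add: Z_def)
  have ZI: "(T ^^ a) x \<in> Z" "(T ^^ a) y \<in> Z" if "a < k" for a using that by (auto simp: Z_def)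
  have "\<forall>b\<in>{..<k}. \<exists>e. \<forall>z\<in>Z. (\<Sum>i\<in>probes. e i * probe i z) = (if z = (T ^^ b) y then 1 else 0)"
    unfolding probes_def using probe_interpolation[OF fZ cZ] ZI by auto
  from bchoice[OF this] obtain e
    where e: "\<forall>b\<in>{..<k}. \<forall>z\<in>Z. (\<Sum>i\<in>probes. e b i * probe i z) = (if z = (T ^^ b) y then 1 else 0)" ..
  have "(\<Sum>i\<in>probes. (probe i ((T ^^ a) x) - probe i ((T ^^ a) y)) * - e b i) = (if a = b then 1 else 0)"
    if ab: "a < k" "b < k" for a b
  proof -
    have "(\<Sum>i\<in>probes. (probe i ((T ^^ a) x) - probe i ((T ^^ a) y)) * - e b i)
      = (\<Sum>i\<in>probes. e b i * probe i ((T ^^ a) y)) - (\<Sum>i\<in>probes. e b i * probe i ((T ^^ a) x))"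
      by (simp add: algebra_simps sum_subtractf)
    also have "\<dots> = (if (T ^^ a) y = (T ^^ b) y then 1 else 0) - 0"
      using ab disj[OF ab] e ZI[OF ab(1)] by simp
    also have "(T ^^ a) y = (T ^^ b) y \<longleftrightarrow> a = b" using inj_onD[OF inj, of a b] ab by auto
    finally show ?thesis by simp
  qed
  then show ?thesis by (intro exI[of _ "\<lambda>b i. - e b i"]) blast
qed

text \<open>For two distinct points one coordinate is enough: the coefficients with equal values lie
  in slabs of volume proportional to \<open>recip n\<close>. This serves the finitely many partners
  for which no dual system is at hand.\<close>

lemma collision_null_pair:
  assumes x: "x \<in> X" "y \<in> X" "x \<noteq> y"
  shows "\<exists>N\<in>null_sets (lborel_fun probes).
    {a\<in>Pi\<^sub>E probes (\<lambda>_. {0..1}). perturb v a x = perturb v a y} \<subseteq> N"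
proof -
  have "card {x, y} \<le> 2 * k" using x(3) k0 by simp
  then obtain e where e: "\<forall>z\<in>{x, y}. (\<Sum>i\<in>probes. e i * probe i z) = (if z = x then 1 else 0)"
    unfolding probes_def using probe_interpolation[of "{x, y}" "2 * k" x] by auto
  define c where "c = (\<Sum>i\<in>probes. \<bar>e i\<bar>)"
  have c: "0 \<le> c" "\<And>i. i \<in> probes \<Longrightarrow> \<bar>e i\<bar> \<le> c"
    unfolding c_def by (auto intro: sum_nonneg member_le_sum)
  let ?S = "\<lambda>\<epsilon>. {a \<in> space (lborel_fun probes).
      (\<forall>i\<in>probes. a i \<in> {0..1}) \<and> (\<forall>j<1::nat. \<bar>(v x - v y) + (\<Sum>i\<in>probes. (probe i x - probe i y) * a i)\<bar> \<le> \<epsilon>)}"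
  have dual: "(\<Sum>i\<in>probes. (probe i x - probe i y) * e i) = 1"
    using e x(3) by (simp add: algebra_simps sum_subtractf)
  define B where "B = (6 * real 1 * c + 1) ^ card probes * 2 ^ 1"
  have vol: "?S \<epsilon> \<in> sets (lborel_fun probes)"
    "emeasure (lborel_fun probes) (?S \<epsilon>) \<le> ennreal (B * \<epsilon> ^ 1)" if "0 < \<epsilon>" "\<epsilon> \<le> 1" for \<epsilon>
    using slab_volume[where I=probes and c=c and k=1 and m="\<lambda>_ i. probe i x - probe i y" and v="\<lambda>_. e"
        and w="\<lambda>_. v x - v y", OF finite_probes c(1) _ c(2) that] dual
    unfolding B_def by auto
  let ?N = "\<Inter>n. ?S (recip n)"
  have Nm: "?N \<in> sets (lborel_fun probes)"
    using vol(1) by (intro sets.countable_INT) auto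
  have "(\<lambda>n. ennreal (B * (recip n))) \<longlonglongrightarrow> ennreal (B * 0)"
    by (intro tendsto_ennrealI tendsto_mult tendsto_const lim_1_over_n[THEN LIMSEQ_Suc])
  moreover have "emeasure (lborel_fun probes) ?N \<le> ennreal (B * (recip n))" for n
  proof -
    have "emeasure (lborel_fun probes) ?N \<le> emeasure (lborel_fun probes) (?S (recip n))"
      by (intro emeasure_mono INF_lower vol(1)) auto
    also have "\<dots> \<le> ennreal (B * (recip n))" using vol(2)[of "recip n"] by simp
    finally show ?thesis .
  qed
  ultimately have "emeasure (lborel_fun probes) ?N \<le> ennreal (B * 0)"
    by (intro LIMSEQ_le_const[of "\<lambda>n. ennreal (B * (recip n))"]) blast+
  then have "?N \<in> null_sets (lborel_fun probes)" using Nm by (auto simp: null_sets_def)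
  moreover have "{a\<in>Pi\<^sub>E probes (\<lambda>_. {0..1}). perturb v a x = perturb v a y} \<subseteq> ?N"
  proof
    fix a assume "a \<in> {a\<in>Pi\<^sub>E probes (\<lambda>_. {0..1}). perturb v a x = perturb v a y}"
    then have a: "a \<in> Pi\<^sub>E probes (\<lambda>_. {0..1})" "perturb v a x - perturb v a y = 0" by auto
    have "(v x - v y) + (\<Sum>i\<in>probes. (probe i x - probe i y) * a i) = 0"
      using a(2) unfolding perturb_diff[OF x(1,2)] .
    then show "a \<in> ?N" using a(1) by (auto simp: space_PiM PiE_iff)
  qed
  ultimately show ?thesis by blast
qed

lemma finite_orbit_preimage: "finite {y\<in>X. (T ^^ i) y = z}"
proof (rule finite_subset)
  show "{y\<in>X. (T ^^ i) y = z} \<subseteq> {the_inv_into X (T ^^ i) z}"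
    using the_inv_into_f_f[OF inj_on_funpow[OF injT TX]] by auto
qed simp

text \<open>\<open>D\<close> is split into a finite set \<open>C\<close>, treated pair by pair, and
  countably many pieces \<open>E n m\<close> on which all constants of the covering argument are
  uniform.\<close>

lemma collision_null:
  assumes x: "x \<in> X" and v: "v \<in> Lip X" and s: "s < real k"
    and D: "D \<subseteq> X" "D \<subseteq> low_dim_all s"
    and good: "finite D \<or> (\<forall>y\<in>D. inj_on (\<lambda>i. (T ^^ i) y) {..<k})"
  shows "\<exists>N\<in>null_sets (lborel_fun probes).
    {a\<in>Pi\<^sub>E probes (\<lambda>_. {0..1}). \<exists>y\<in>D. y \<noteq> x \<and> (\<forall>j<k. perturb v a ((T ^^ j) x) = perturb v a ((T ^^ j) y))} \<subseteq> N"
proof -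
  let ?P = "lborel_fun probes"
  let ?Q = "Pi\<^sub>E probes (\<lambda>_. {0..1::real})"
  define bad where "bad y = {a\<in>?Q. \<forall>j<k. perturb v a ((T ^^ j) x) = perturb v a ((T ^^ j) y)}" for y
  define slab where "slab y \<epsilon> = {a \<in> space ?P. (\<forall>i\<in>probes. a i \<in> {0..1}) \<and>
      (\<forall>j<k. \<bar>(v ((T ^^ j) x) - v ((T ^^ j) y))
        + (\<Sum>i\<in>probes. (probe i ((T ^^ j) x) - probe i ((T ^^ j) y)) * a i)\<bar> \<le> \<epsilon>)}" for y \<epsilon>
  \<comment> \<open>An infinite \<open>D\<close> contributes the points whose segment meets that of
    \<open>x\<close>, finitely many by injectivity of the iterates. As \<open>0 < k\<close>,
    \<open>C\<close> contains \<open>x\<close> as soon as \<open>D\<close> does, so points of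
    \<open>D - C\<close> differ from \<open>x\<close>.\<close>
  define C where "C = (if finite D then D else {y\<in>D. \<exists>a<k. \<exists>b<k. (T ^^ a) x = (T ^^ b) y})"
  have fC: "finite C"
  proof (cases "finite D")
    case False
    have "C \<subseteq> (\<Union>a<k. \<Union>b<k. {y\<in>X. (T ^^ b) y = (T ^^ a) x})"
    proof
      fix y assume "y \<in> C"
      then obtain a b where "y \<in> D" "a < k" "b < k" "(T ^^ b) y = (T ^^ a) x"
        using False by (auto simp: C_def)
      then show "y \<in> (\<Union>a<k. \<Union>b<k. {y\<in>X. (T ^^ b) y = (T ^^ a) x})" using D(1) by blast
    qed
    moreover have "finite (\<Union>a<k. \<Union>b<k. {y\<in>X. (T ^^ b) y = (T ^^ a) x})"
      using finite_orbit_preimage by auto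
    ultimately show ?thesis by (rule finite_subset)
  qed (simp add: C_def)
  have CD: "C \<subseteq> D" by (auto simp: C_def)
  have N1: "\<exists>N\<in>null_sets ?P. bad y \<subseteq> N" if y: "y \<in> C - {x}" for y
  proof -
    have "y \<in> D" using y CD by blast
    then have "y \<in> X" "x \<noteq> y" using y D(1) by auto
    then obtain N where N: "N \<in> null_sets ?P" "{a\<in>?Q. perturb v a x = perturb v a y} \<subseteq> N"
      using collision_null_pair[OF x] by blast
    have "bad y \<subseteq> {a\<in>?Q. perturb v a x = perturb v a y}"
    proof
      fix a assume "a \<in> bad y"
      then have "a \<in> ?Q" "perturb v a ((T ^^ 0) x) = perturb v a ((T ^^ 0) y)"
        using k0 unfolding bad_def by blast+
      then show "a \<in> {a\<in>?Q. perturb v a x = perturb v a y}" by simp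
    qed
    then show ?thesis using N by (intro bexI[of _ N]) (rule order.trans)
  qed
  then have "\<forall>y\<in>C - {x}. \<exists>N. N \<in> null_sets ?P \<and> bad y \<subseteq> N"
    unfolding Bex_def by (rule ballI)
  from bchoice[OF this] obtain N1 where "\<forall>y\<in>C - {x}. N1 y \<in> null_sets ?P \<and> bad y \<subseteq> N1 y" ..
  then have N1: "N1 y \<in> null_sets ?P" "bad y \<subseteq> N1 y" if "y \<in> C - {x}" for y using that by blast+
  define dual where "dual y d \<longleftrightarrow> (\<forall>a<k. \<forall>b<k.
      (\<Sum>i\<in>probes. (probe i ((T ^^ a) x) - probe i ((T ^^ a) y)) * d b i) = (if a = b then 1 else 0))" for y d
  \<comment> \<open>Every remaining point has a dual system and a mass constant, but without common
    bounds; \<open>n\<close> and \<open>m\<close> sort the points by integer bounds.\<close>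
  define E where "E n m = {y\<in>D - C. y \<in> low_dim s (recip m) \<and>
      (\<exists>d. dual y d \<and> (\<forall>b<k. \<forall>i\<in>probes. \<bar>d b i\<bar> \<le> real n))}" for n m :: nat
  have cov: "y \<in> (\<Union>n m. E n m)" if y: "y \<in> D - C" for y
  proof -
    have "infinite D" using y by (auto simp: C_def)
    then have "\<exists>d. dual y d" unfolding dual_def
      using y good by (intro probe_dual) (auto simp: C_def)
    then obtain d where d: "dual y d" ..
    define S where "S = (\<Sum>b<k. \<Sum>i\<in>probes. \<bar>d b i\<bar>)"
    obtain n :: nat where n: "S \<le> real n" using real_arch_simple by blast
    have "\<bar>d b i\<bar> \<le> real n" if "b < k" "i \<in> probes" for b i
    proof -
      have "\<bar>d b i\<bar> \<le> (\<Sum>i\<in>probes. \<bar>d b i\<bar>)" using that by (intro member_le_sum) auto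
      also have "\<dots> \<le> S" unfolding S_def using that
        by (intro member_le_sum[of b "{..<k}" "\<lambda>b. \<Sum>i\<in>probes. \<bar>d b i\<bar>"]) (auto intro: sum_nonneg)
      finally show ?thesis using n by simp
    qed
    moreover obtain m where "y \<in> low_dim s (recip m)" using D(2) y by blast
    ultimately have "y \<in> E n m" using y d unfolding E_def by blast
    then show ?thesis by blast
  qed
  obtain Cu where Cu: "0 \<le> Cu" "\<And>a y z. a \<in> ?Q \<Longrightarrow> y \<in> X \<Longrightarrow> z \<in> X \<Longrightarrow> \<bar>perturb v a y - perturb v a z\<bar> \<le> Cu * dist y z"
    using perturb_lipschitz[OF v] by blast
  obtain M where M: "\<And>j. lipschitz_on (M j) X (T ^^ j)" using lipschitz_on_funpow[OF LT TX] by metis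
  \<comment> \<open>\<open>Cu\<close> and \<open>M j\<close> are Lipschitz constants of the
    perturbed observables and of the iterates; the summand 1 ensures
    \<open>1 \<le> \<Lambda>\<close>.\<close>
  define \<Lambda> where "\<Lambda> = 1 + Cu * (\<Sum>j<k. M j)"
  have M0: "0 \<le> M j" for j using M by (rule lipschitz_on_nonneg)
  have \<Lambda>1: "1 \<le> \<Lambda>" unfolding \<Lambda>_def using Cu(1) M0 by (simp add: sum_nonneg)
  have N2: "\<exists>Z\<in>null_sets ?P. (\<Union>y\<in>E n m. bad y) \<subseteq> Z" for n m
  proof (rule null_union_transversal[where M=\<mu> and X=X and c="recip m" and s=s and k=k
        and \<Lambda>=\<Lambda> and C="(6 * real k * real n + 1) ^ card probes * 2 ^ k"
        and S=slab, OF fin sets_mu])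
    fix y \<delta> assume "y \<in> E n m" "0 < (\<delta>::real)"
    then show "\<exists>\<epsilon>>0. \<epsilon> < \<delta> \<and> recip m * \<epsilon> powr s < prob (ball y \<epsilon> \<inter> X)"
      by (simp add: E_def low_dim_def)
  next
    fix y \<epsilon> assume y: "y \<in> E n m" and e: "0 < (\<epsilon>::real)" "\<epsilon> \<le> 1"
    then obtain d where d: "dual y d" "\<forall>b<k. \<forall>i\<in>probes. \<bar>d b i\<bar> \<le> real n" unfolding E_def by blast
    have du: "(\<Sum>i\<in>probes. (probe i ((T ^^ a) x) - probe i ((T ^^ a) y)) * d b i) = (if a = b then 1 else 0)"
      if "a < k" "b < k" for a b using d(1) that unfolding dual_def by blast
    have db: "\<bar>d b i\<bar> \<le> real n" if "b < k" "i \<in> probes" for b i using d(2) that by blast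
    show "slab y \<epsilon> \<in> sets ?P \<and> emeasure ?P (slab y \<epsilon>) \<le> ennreal ((6 * real k * real n + 1) ^ card probes * 2 ^ k * \<epsilon> ^ k)"
      using slab_volume[where I=probes and c="real n" and k=k and v=d and w="\<lambda>j. v ((T ^^ j) x) - v ((T ^^ j) y)"
          and m="\<lambda>j i. probe i ((T ^^ j) x) - probe i ((T ^^ j) y)", OF finite_probes of_nat_0_le_iff du db e]
      unfolding slab_def by blast
  next
    \<comment> \<open>For bad coefficients the delay vector of \<open>x\<close> equals that of
      \<open>y\<close>, whose coordinates are within \<open>\<Lambda> * \<epsilon>\<close> of those
      of \<open>y'\<close>.\<close>
    fix y y' \<epsilon> assume yy: "y \<in> E n m" "y' \<in> E n m" "0 < (\<epsilon>::real)" "dist y y' \<le> \<epsilon>"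
    have X: "y \<in> X" "y' \<in> X" using yy D(1) unfolding E_def by blast+
    show "bad y \<subseteq> slab y' (\<Lambda> * \<epsilon>)"
      unfolding slab_def
    proof (intro subsetI CollectI conjI allI impI)
      fix a assume a: "a \<in> bad y"
      then have aQ: "a \<in> ?Q" by (simp add: bad_def)
      then show "a \<in> space ?P" "\<forall>i\<in>probes. a i \<in> {0..1}" by (auto simp: space_PiM PiE_iff)
      fix j assume j: "j < k"
      have Tj: "(T ^^ j) x \<in> X" "(T ^^ j) y \<in> X" "(T ^^ j) y' \<in> X" using funpow_in[OF TX] x X by blast+
      have "\<bar>perturb v a ((T ^^ j) x) - perturb v a ((T ^^ j) y')\<bar> = \<bar>perturb v a ((T ^^ j) y) - perturb v a ((T ^^ j) y')\<bar>"
        using a j by (simp add: bad_def)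
      also have "\<dots> \<le> Cu * dist ((T ^^ j) y) ((T ^^ j) y')" using Cu(2)[OF aQ Tj(2,3)] .
      also have "\<dots> \<le> Cu * (M j * dist y y')" using Cu(1) lipschitz_onD[OF M X] by (intro mult_left_mono)
      also have "\<dots> \<le> Cu * ((\<Sum>j<k. M j) * \<epsilon>)"
        using Cu(1) M0 j yy(4) by (intro mult_left_mono mult_mono member_le_sum) (auto intro: sum_nonneg)
      also have "\<dots> \<le> \<Lambda> * \<epsilon>" using yy(3) by (simp add: \<Lambda>_def distrib_right)
      finally show "\<bar>(v ((T ^^ j) x) - v ((T ^^ j) y'))
            + (\<Sum>i\<in>probes. (probe i ((T ^^ j) x) - probe i ((T ^^ j) y')) * a i)\<bar> \<le> \<Lambda> * \<epsilon>"
        unfolding perturb_diff[OF Tj(1,3)] .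
    qed
  qed (use s \<Lambda>1 in auto)
  then obtain N2 where N2: "\<And>n m. N2 n m \<in> null_sets ?P" "\<And>n m. (\<Union>y\<in>E n m. bad y) \<subseteq> N2 n m" by metis
  let ?N = "(\<Union>y\<in>C - {x}. N1 y) \<union> (\<Union>n. \<Union>m. N2 n m)"
  have "?N \<in> null_sets ?P"
    using N1 N2(1) fC by (intro null_sets.Un null_sets_UN' null_sets_UN) (auto intro: countable_finite)
  moreover have "{a\<in>?Q. \<exists>y\<in>D. y \<noteq> x \<and> (\<forall>j<k. perturb v a ((T ^^ j) x) = perturb v a ((T ^^ j) y))} \<subseteq> ?N"
  proof
    fix a assume "a \<in> {a\<in>?Q. \<exists>y\<in>D. y \<noteq> x \<and> (\<forall>j<k. perturb v a ((T ^^ j) x) = perturb v a ((T ^^ j) y))}"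
    then obtain y where y: "y \<in> D" "y \<noteq> x" "a \<in> bad y" by (auto simp: bad_def)
    show "a \<in> ?N"
    proof (cases "y \<in> C")
      case True
      then show ?thesis using N1[of y] y by blast
    next
      case False
      then obtain n m where "y \<in> E n m" using cov y(1) by blast
      then show ?thesis using N2(2)[of n m] y(3) by blast
    qed
  qed
  ultimately show ?thesis by blast
qed

text \<open>The tolerance \<open>recip n\<close> leaves room to move the partner into a dense
  subset; letting it tend to 0 restores an exact partner. With a countable \<open>Q\<close> this
  makes the collision relation jointly measurable, as Fubini's theorem requires.\<close>

lemma collide_iff_dense:
  assumes h: "continuous_on X h" and K: "compact K" "K \<subseteq> X" and Q: "Q \<subseteq> K" "K \<subseteq> closure Q" and x: "x \<in> X"
  shows "x \<in> collide K g 0 h \<longleftrightarrow> (\<forall>n. \<exists>q\<in>Q. close_pairs g (recip n) h x q)"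
proof
  assume "\<forall>n. \<exists>q\<in>Q. close_pairs g (recip n) h x q"
  then show "x \<in> collide K g 0 h"
    using Q(1) x by (intro collide_limit[OF h K]) (auto simp: collide_def)
next
  assume "x \<in> collide K g 0 h"
  then obtain y where y: "y \<in> K" "close_pairs g 0 h x y" by (auto simp: collide_def)
  show "\<forall>n. \<exists>q\<in>Q. close_pairs g (recip n) h x q"
  proof
    fix n
    let ?t = "recip n"
    have t: "0 < ?t" by simp
    have "\<exists>d>0. \<forall>q\<in>X. dist q y < d \<longrightarrow> \<bar>h ((T ^^ i) q) - h ((T ^^ i) y)\<bar> < ?t" for i
    proof -
      have "y \<in> X" using y(1) K(2) by blast
      then show ?thesis using cont_orbit[OF h, of i] t unfolding continuous_on_iff dist_real_def by blast
    qed
    then obtain d where d: "\<And>i. 0 < d i" "\<And>i q. q \<in> X \<Longrightarrow> dist q y < d i \<Longrightarrow> \<bar>h ((T ^^ i) q) - h ((T ^^ i) y)\<bar> < ?t"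
      by metis
    let ?e = "Min (insert ?t (d ` {..<k}))"
    have "0 < ?e" using d(1) t by (subst Min_gr_iff) auto
    then obtain q where q: "q \<in> Q" "dist q y < ?e" using Q(2) y(1) closure_approachable by blast
    have "close_pairs g ?t h x q" unfolding close_pairs_def
    proof (intro conjI allI impI)
      have "g - 0 \<le> dist x y" using y(2) unfolding close_pairs_def by blast
      moreover have "dist x y \<le> dist x q + dist q y" by (rule dist_triangle)
      moreover have "?e \<le> ?t" by (intro Min_le) auto
      ultimately show "g - ?t \<le> dist x q" using q(2) by linarith
      fix i assume i: "i < k"
      have "?e \<le> d i" using i by (intro Min_le) auto
      with q(2) have "dist q y < d i" by (rule less_le_trans)
      moreover have "q \<in> X" using q(1) Q(1) K(2) by blast
      ultimately have "\<bar>h ((T ^^ i) q) - h ((T ^^ i) y)\<bar> < ?t" by (intro d(2))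
      moreover have "\<bar>h ((T ^^ i) x) - h ((T ^^ i) y)\<bar> \<le> 0" using y(2) i unfolding close_pairs_def by blast
      ultimately show "\<bar>h ((T ^^ i) x) - h ((T ^^ i) q)\<bar> \<le> ?t" by linarith
    qed
    then show "\<exists>q\<in>Q. close_pairs g ?t h x q" using q(1) by blast
  qed
qed

lemma collide_joint_measurable:
  assumes v: "v \<in> Lip X" and K: "compact K" "K \<subseteq> X"
  shows "{z \<in> space (\<mu> \<Otimes>\<^sub>M cube probes). fst z \<notin> collide K g 0 (perturb v (snd z))} \<in> sets (\<mu> \<Otimes>\<^sub>M cube probes)"
proof -
  let ?M = "\<mu> \<Otimes>\<^sub>M cube probes"
  obtain Q where Q: "countable Q" "Q \<subseteq> K" "K \<subseteq> closure Q" by (rule separable)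
  have comp: "(\<lambda>z. snd z i) \<in> borel_measurable ?M" if i: "i \<in> probes" for i
  proof -
    have "(\<lambda>a. a i) \<in> borel_measurable (lborel_fun probes)" using i by simp
    then have "(\<lambda>a. a i) \<in> borel_measurable (cube probes)" unfolding cube_def by simp
    then show ?thesis by (rule measurable_compose[OF measurable_snd])
  qed
  have orb: "(\<lambda>z. f ((T ^^ j) (fst z))) \<in> borel_measurable ?M" if "continuous_on X f" for f :: "'a \<Rightarrow> real" and j
    by (rule measurable_compose[OF measurable_fst cont_measurable[OF cont_orbit[OF that]]])
  have pc: "continuous_on X (probe i)" for i by (rule continuous_probe)
  have up: "(\<lambda>z. perturb v (snd z) ((T ^^ j) (fst z))) \<in> borel_measurable ?M" for j
  proof -
    have "(\<lambda>z. v ((T ^^ j) (fst z)) + (\<Sum>i\<in>probes. snd z i * probe i ((T ^^ j) (fst z)))) \<in> borel_measurable ?M"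
      by (intro borel_measurable_add orb Lip_cont v borel_measurable_sum borel_measurable_times comp pc)
    moreover have "perturb v (snd z) ((T ^^ j) (fst z)) = v ((T ^^ j) (fst z)) + (\<Sum>i\<in>probes. snd z i * probe i ((T ^^ j) (fst z)))"
      if "z \<in> space ?M" for z
      using that funpow_in[OF TX] by (intro perturb_eq) (auto simp: space_pair_measure space_mu)
    ultimately show ?thesis by (subst measurable_cong) auto
  qed
  have uq: "(\<lambda>z. perturb v (snd z) y) \<in> borel_measurable ?M" if y: "y \<in> X" for y
    unfolding perturb_eq[OF y]
    by (intro borel_measurable_add borel_measurable_sum borel_measurable_times comp borel_measurable_const)
  have dm: "(\<lambda>z. dist (fst z) q) \<in> borel_measurable ?M" for q
    by (rule measurable_compose[OF measurable_fst cont_measurable]) (intro continuous_intros)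
  have cp: "{z \<in> space ?M. close_pairs g t (perturb v (snd z)) (fst z) q} \<in> sets ?M" if q: "q \<in> Q" for q t
  proof -
    have Tq: "(T ^^ j) q \<in> X" for j using q Q(2) K(2) funpow_in[OF TX] by blast
    note [measurable] = up uq[OF Tq] dm
    have "Measurable.pred ?M (\<lambda>z. close_pairs g t (perturb v (snd z)) (fst z) q)"
      unfolding close_pairs_def
      by measurable
    then show ?thesis by (simp add: pred_def)
  qed
  have "{z \<in> space ?M. fst z \<notin> collide K g 0 (perturb v (snd z))}
    = space ?M - (\<Inter>n. \<Union>q\<in>Q. {z \<in> space ?M. close_pairs g (recip n) (perturb v (snd z)) (fst z) q})"
  proof -
    have "fst z \<in> collide K g 0 (perturb v (snd z)) \<longleftrightarrow>
        (\<forall>n. \<exists>q\<in>Q. close_pairs g (recip n) (perturb v (snd z)) (fst z) q)" if "z \<in> space ?M" for z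
      using that by (intro collide_iff_dense Lip_cont perturb_Lip v K Q) (auto simp: space_pair_measure space_mu)
    then have "{z \<in> space ?M. fst z \<notin> collide K g 0 (perturb v (snd z))} =
        {z \<in> space ?M. \<not> (\<forall>n. \<exists>q\<in>Q. close_pairs g (recip n) (perturb v (snd z)) (fst z) q)}"
      by (intro Collect_cong conj_cong refl) simp
    then show ?thesis by auto
  qed
  also have "\<dots> \<in> sets ?M"
    using cp Q(1) by (intro sets.compl_sets sets.countable_INT sets.countable_UN') auto
  finally show ?thesis .
qed

lemma AE_collide_null:
  assumes v: "v \<in> Lip X" and K: "compact K" "K \<subseteq> D" and g: "0 < g" and s: "s < real k"
    and D: "D \<subseteq> X" "D \<subseteq> low_dim_all s"
    and good: "finite D \<or> (\<forall>y\<in>D. inj_on (\<lambda>i. (T ^^ i) y) {..<k})"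
  shows "AE a in cube probes. prob (collide K g 0 (perturb v a)) = 0"
proof -
  interpret c: prob_space "cube probes" by (rule prob_space_cube[OF finite_probes])
  interpret pair_sigma_finite \<mu> "cube probes" ..
  have KX: "K \<subseteq> X" using K(2) D(1) by blast
  have "AE a in cube probes. x \<notin> collide K g 0 (perturb v a)" if x: "x \<in> X" for x
  proof -
    obtain N where N: "N \<in> null_sets (lborel_fun probes)"
      "{a\<in>Pi\<^sub>E probes (\<lambda>_. {0..1}). \<exists>y\<in>D. y \<noteq> x \<and> (\<forall>j<k. perturb v a ((T ^^ j) x) = perturb v a ((T ^^ j) y))} \<subseteq> N"
      using collision_null[OF x v s D good] by blast
    show ?thesis
    proof (rule AE_cubeI[OF finite_probes N(1)])
      fix a assume a: "a \<in> Pi\<^sub>E probes (\<lambda>_. {0..1::real})" "\<not> x \<notin> collide K g 0 (perturb v a)"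
      then obtain y where y: "y \<in> K" "close_pairs g 0 (perturb v a) x y" by (auto simp: collide_def)
      \<comment> \<open>The positive gap \<open>g\<close> forces the partner to differ from
        \<open>x\<close>.\<close>
      then have "y \<in> D" "y \<noteq> x" "\<forall>j<k. perturb v a ((T ^^ j) x) = perturb v a ((T ^^ j) y)"
        using K(2) g by (auto simp: close_pairs_def)
      then show "a \<in> N" using N(2) a(1) by blast
    qed
  qed
  then have "AE x in \<mu>. AE a in cube probes. x \<notin> collide K g 0 (perturb v a)" by (rule AE_I2) (simp add: space_mu)
  then have "AE a in cube probes. AE x in \<mu>. x \<notin> collide K g 0 (perturb v a)"
    using AE_commute[OF collide_joint_measurable[OF v K(1) KX]] by blast
  then show ?thesis
  proof eventually_elim
    case (elim a)
    have m: "collide K g 0 (perturb v a) \<in> sets \<mu>"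
      by (intro collide_sets Lip_cont perturb_Lip v K KX)
    have "{x \<in> space \<mu>. \<not> x \<notin> collide K g 0 (perturb v a)} = collide K g 0 (perturb v a)"
      using sets.sets_into_space[OF m] by blast
    then have "emeasure \<mu> (collide K g 0 (perturb v a)) = 0"
      using elim m AE_iff_measurable[of "collide K g 0 (perturb v a)" \<mu>] by auto
    then show ?case by (simp add: measure_def)
  qed
qed

text \<open>\<open>S'\<close> consists of countably many null conditions, one for each compact set
  and each gap \<open>recip m\<close>. Deleting the corresponding null sets leaves a set of full
  measure without collisions, since two distinct points have a distance above some gap.\<close>

lemma prevalent_injective:
  assumes dim: "lower_info_dim \<mu> < ereal (real k)"
    and S: "S \<subseteq> Lip X"
    and suff: "\<And>h A. h \<in> Lip X \<Longrightarrow> A \<in> sets \<mu> \<Longrightarrow> prob A = 1 \<Longrightarrow>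
      (\<And>x y. x \<in> A \<Longrightarrow> y \<in> A \<Longrightarrow> (\<forall>j<k. h ((T ^^ j) x) = h ((T ^^ j) y)) \<Longrightarrow> x = y) \<Longrightarrow> h \<in> S"
  shows "prevalent (Lip X) (Lip_norm X) S"
proof -
  obtain s K where s: "s < real k" and K: "\<And>n::nat. compact (K n)" "\<And>n. K n \<subseteq> X" "prob (\<Union>n. K n) = 1"
    "(\<Union>n. K n) \<subseteq> low_dim_all s"
    "finite (\<Union>n. K n) \<or> (\<forall>y\<in>(\<Union>n. K n). inj_on (\<lambda>i. (T ^^ i) y) {..<k})"
    by (rule good_compact_sets[OF k0 dim]) metis
  let ?g = "\<lambda>m::nat. recip m"
  define S' where "S' = (\<Inter>n. \<Inter>m. {h \<in> Lip X. prob (collide (K n) (?g m) 0 h) = 0})"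
  have UX: "(\<Union>n. K n) \<subseteq> X" using K(2) by blast
  show ?thesis
  proof (rule prevalent_probe[where I=probes and p=probe, OF finite_probes probe_lip S])
    show "S' \<in> sets Lip_borel"
      unfolding S'_def using collide_null_borel[OF K(1,2)] by (intro sets.countable_INT) blast+
    show "S' \<subseteq> S"
    proof
      fix h assume h: "h \<in> S'"
      then have hL: "h \<in> Lip X" by (auto simp: S'_def)
      have z: "prob (collide (K n) (?g m) 0 h) = 0" for n m using h unfolding S'_def by blast
      have cm: "collide (K n) (?g m) 0 h \<in> sets \<mu>" for n m using collide_sets[OF Lip_cont[OF hL] K(1,2)] .
      have "K n \<in> sets \<mu>" for n using K(1,2) by (simp add: sets_mu_iff borel_closed compact_imp_closed)
      then have Um: "(\<Union>n. K n) \<in> sets \<mu>" by (intro sets.countable_UN) auto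
      let ?B = "\<Union>n. \<Union>m. collide (K n) (?g m) 0 h"
      have "?B \<in> null_sets \<mu>"
        using z cm by (intro null_sets_UN) (auto simp: null_sets_def emeasure_eq_measure)
      then have "AE x in \<mu>. x \<notin> ?B" by (rule AE_not_in)
      moreover have "AE x in \<mu>. x \<in> (\<Union>n. K n)" using prob_eq_1[OF Um] K(3) by blast
      ultimately have ae: "AE x in \<mu>. x \<in> (\<Union>n. K n) - ?B" by eventually_elim blast
      have "?B \<in> sets \<mu>" using cm by (intro sets.countable_UN) auto
      then have Am: "(\<Union>n. K n) - ?B \<in> sets \<mu>" by (rule sets.Diff[OF Um])
      show "h \<in> S"
      proof (rule suff[OF hL Am])
        show "prob ((\<Union>n. K n) - ?B) = 1" using prob_eq_1[OF Am] ae by blast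
        fix x y assume x: "x \<in> (\<Union>n. K n) - ?B" and y: "y \<in> (\<Union>n. K n) - ?B"
          and eq: "\<forall>j<k. h ((T ^^ j) x) = h ((T ^^ j) y)"
        show "x = y"
        proof (rule ccontr)
          assume "x \<noteq> y"
          then obtain m where m: "?g m < dist x y"
            using reals_Archimedean[of "dist x y"] by (auto simp: inverse_eq_divide)
          obtain n where "y \<in> K n" using y by blast
          moreover have "close_pairs (?g m) 0 h x y" using m eq by (simp add: close_pairs_def)
          moreover have "x \<in> X" using x UX by blast
          ultimately have "x \<in> collide (K n) (?g m) 0 h" unfolding collide_def by blast
          then show False using x by blast
        qed
      qed
    qed
    fix v assume v: "v \<in> Lip X"
    have "AE a in cube probes. \<forall>n m. prob (collide (K n) (?g m) 0 (perturb v a)) = 0"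
      unfolding AE_all_countable
      using AE_collide_null[OF v K(1) UN_upper _ s UX K(4,5)] by simp
    then show "AE a in cube probes. (\<lambda>x. v x + lin_comb probes probe a x) \<in> S'"
    proof eventually_elim
      case (elim a)
      then have "perturb v a \<in> S'" unfolding S'_def using perturb_Lip[OF v] by blast
      then show ?case by (simp add: perturb_def[abs_def])
    qed
  qed
qed

end

section \<open>Delay vectors in coordinates and the conclusion\<close>

lemma rank_bij: "bij_betw (\<lambda>i::'k::{finite,linorder}. card {j. j < i}) UNIV {..<CARD('k)}"
proof -
  have mono: "card {l. l < i} < card {l. l < j}" if "i < j" for i j :: 'k
    using that by (intro psubset_card_mono) auto
  have inj: "inj (\<lambda>i::'k. card {j. j < i})"
  proof (rule injI, rule ccontr)
    fix i j :: 'k assume "card {l. l < i} = card {l. l < j}" "i \<noteq> j"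
    then show False using mono[of i j] mono[of j i] unfolding neq_iff by auto
  qed
  have "card {j. j < i} < CARD('k)" for i :: 'k by (intro psubset_card_mono) auto
  then have sub: "range (\<lambda>i::'k. card {j. j < i}) \<subseteq> {..<CARD('k)}" by auto
  have "card (range (\<lambda>i::'k. card {j. j < i})) = CARD('k)" using inj by (rule card_image)
  then have "range (\<lambda>i::'k. card {j. j < i}) = {..<CARD('k)}" using sub by (intro card_subset_eq) auto
  then show ?thesis using inj by (simp add: bij_betw_def)
qed

lemma delay_map_eq_iff:
  "(delay_map T h x :: real ^ 'k::{finite,linorder}) = delay_map T h y \<longleftrightarrow>
    (\<forall>j<CARD('k). h ((T ^^ j) x) = h ((T ^^ j) y))"
proof -
  have "(\<forall>i::'k. h ((T ^^ card {j. j < i}) x) = h ((T ^^ card {j. j < i}) y)) \<longleftrightarrow>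
      (\<forall>n\<in>range (\<lambda>i::'k. card {j. j < i}). h ((T ^^ n) x) = h ((T ^^ n) y))" by auto
  also have "range (\<lambda>i::'k. card {j. j < i}) = {..<CARD('k)}" using rank_bij[where 'k='k] by (simp add: bij_betw_def)
  finally show ?thesis by (auto simp: delay_map_def vec_eq_iff)
qed

theorem corollary1p10:
  fixes X :: "'a::euclidean_space set" and d :: nat and r :: enat
    and g :: "'a \<Rightarrow> 'a \<Rightarrow> 'a \<Rightarrow> real" and T :: "'a \<Rightarrow> 'a" and \<mu> :: "'a measure"
    and \<phi> :: "('a \<Rightarrow> real) \<Rightarrow> 'a \<Rightarrow> real ^ 'k::{finite,linorder}"
  assumes "compact X" and "embedded_manifold d X" and "riemannian_metric X g"
    and "1 \<le> r" and "Cr_diffeo r X T"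
    and "prob_space \<mu>" and "sets \<mu> = sets (restrict_space borel X)"
    and "natural_measure X g T \<mu> \<or> invariant_measure T \<mu>"
    and "ergodic_measure T \<mu>"
    and "\<phi> = delay_map T"
    and "lower_info_dim \<mu> < ereal (real CARD('k::{finite,linorder}))"
  shows "prevalent (Lip X) (Lip_norm X)
    {h \<in> Lip X.
       (\<exists>A\<in>sets \<mu>. measure \<mu> A = 1 \<and> inj_on (\<phi> h) A) \<and>
       (AE y in distr \<mu> borel (\<phi> h). predictable \<mu> T (\<phi> h) y)}"
proof -
  have T: "inj_on T X" "T ` X \<subseteq> X" "Cr_map r X T"
    using assms(5) by (auto simp: Cr_diffeo_def bij_betw_def)
  obtain L where L: "lipschitz_on L X T" using Cr_map_lipschitz[OF assms(1,4) T(3)] ..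
  interpret delay_system \<mu> X T L "CARD('k)"
  proof (intro delay_system.intro ergodic_system.intro ergodic_system_axioms.intro delay_system_axioms.intro)
    \<comment> \<open>Natural measures are invariant by definition, so the two alternatives are
      treated together.\<close>
    show "invariant_measure T \<mu>" using assms(8) by (auto simp: natural_measure_def)
  qed (use assms T L in auto)
  show ?thesis
  proof (rule prevalent_injective[OF assms(11)])
    fix h A assume h: "h \<in> Lip X" and A: "A \<in> sets \<mu>" "measure \<mu> A = 1"
      and sep: "\<And>x y. x \<in> A \<Longrightarrow> y \<in> A \<Longrightarrow> (\<forall>j<CARD('k). h ((T ^^ j) x) = h ((T ^^ j) y)) \<Longrightarrow> x = y"
    have inj: "inj_on (\<phi> h) A"
      by (rule inj_onI) (use sep in \<open>simp add: assms(10) delay_map_eq_iff\<close>)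
    have "continuous_on X (\<phi> h)"
      unfolding assms(10) delay_map_def[abs_def]
      by (intro continuous_on_vec_lambda cont_orbit Lip_cont h)
    then have "AE y in distr \<mu> borel (\<phi> h). predictable \<mu> T (\<phi> h) y"
      using continuous_on_funpow[of 1] A inj by (intro AE_predictable_if_injective[OF assms(1,6,7) _ T(2)]) auto
    then show "h \<in> {h \<in> Lip X. (\<exists>A\<in>sets \<mu>. measure \<mu> A = 1 \<and> inj_on (\<phi> h) A) \<and>
       (AE y in distr \<mu> borel (\<phi> h). predictable \<mu> T (\<phi> h) y)}"
      using h A inj by blast
  qed auto
qed

end
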